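(* Let $p,q\ge 2$ be integers. There is a tight regular polyhedron of type $\{p,q\}$ if and only if one of the following holds: (1) $p$ and $q$ are both even; (2) $p$ is odd and $q$ is an even divisor of $2p$; (3) $q$ is odd and $p$ is an even divisor of $2q$; (4) $p=4$ and $q$ is an odd multiple of $3$; (5) $q=4$ and $p$ is an odd multiple of $3$. Moreover, in cases (2) and (3) there is exactly one such polyhedron up to isomorphism, and it is orientably regular; in cases (4) and (5) there is exactly one such polyhedron up to isomorphism, and it is non-orientably regular.
   Context: An (abstract) polyhedron is a partially ordered set whose elements have rank 0 (vertices), 1 (edges) or 2 (faces) such that: every flag (maximal chain) consists of one vertex, one edge and one face, mutually incident; each edge is incident with exactly two vertices and exactly two faces; the graph formed by the vertices and edges is connected; and for every vertex $F_0$ the poset $\{G : G>F_0\}$ is isomorphic to the vertex–edge incidence poset of a connected 2-regular graph. For a flag $\Phi$ and $i\in\{0,1,2\}$, $\Phi^i$ denotes the unique flag differing from $\Phi$ exactly in its element of rank $i$. A polyhedron has type $\{p,q\}$ if every face is incident with exactly $p$ edges and every vertex with exactly $q$ edges. An automorphism is an incidence- and rank-preserving bijection; the polyhedron is regular if its automorphism group $\Gamma$ acts transitively on flags. Fixing a base flag $\Phi$, $\Gamma$ is generated by $\rho_0,\rho_1,\rho_2$ where $\rho_i$ maps $\Phi$ to $\Phi^i$; put $\sigma_1=\rho_0\rho_1$, $\sigma_2=\rho_1\rho_2$ and $\Gamma^+=\langle\sigma_1,\sigma_2\rangle$. A regular polyhedron is orientably regular if $[\Gamma:\Gamma^+]=2$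 and non-orientably regular if $\Gamma^+=\Gamma$. A finite polyhedron of type $\{p,q\}$ has at least $2pq$ flags; it is called tight if it has exactly $2pq$ flags.
   Formalization: Polyhedra are also required to have polygonal (connected) faces; without this, the cube with opposite faces identified is tight regular of type {8,3}, outside (1)–(5). In the equivalence, polyhedra have natural numbers as elements; being finite, all are isomorphic to such. *)

theory Defs
  imports "HOL-Algebra.Algebra"
begin

text \<open>
  Graphs are multigraphs: parallel edges have to be allowed, since the vertex-figures (faces) of a
  polyhedron of type \<open>{p,q}\<close> with \<open>q = 2\<close> (\<open>p = 2\<close>) are digons. Loops are not needed: a loop in a
  vertex-figure would give an edge of the polyhedron lying on a single face.
\<close>

record ('v, 'e) multigraph =
  mverts :: "'v set"
  medges :: "'e set"
  mends :: "'e \<Rightarrow> 'v set"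

definition is_multigraph :: "('v, 'e) multigraph \<Rightarrow> bool" where
  "is_multigraph G \<longleftrightarrow> (\<forall>e \<in> medges G. mends G e \<subseteq> mverts G \<and> card (mends G e) = 2)"

definition connected_multigraph :: "('v, 'e) multigraph \<Rightarrow> bool" where
  "connected_multigraph G \<longleftrightarrow>
    (\<forall>u \<in> mverts G. \<forall>v \<in> mverts G. (u, v) \<in> {(x, y). \<exists>e \<in> medges G. mends G e = {x, y}}\<^sup>*)"

definition regular_multigraph :: "nat \<Rightarrow> ('v, 'e) multigraph \<Rightarrow> bool" where
  "regular_multigraph d G \<longleftrightarrow> (\<forall>v \<in> mverts G. card {e \<in> medges G. v \<in> mends G e} = d)"

text \<open>The vertex--edge incidence poset, as a reflexive order relation.\<close>

definition incidence_poset :: "('v, 'e) multigraph \<Rightarrow> ('v + 'e) rel" where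
  "incidence_poset G =
    Id_on (Inl ` mverts G \<union> Inr ` medges G) \<union>
    {(Inl v, Inr e) | v e. v \<in> mverts G \<and> e \<in> medges G \<and> v \<in> mends G e}"

text \<open>Isomorphism of posets given by reflexive order relations (so the carrier is the field).\<close>

definition poset_iso :: "'a rel \<Rightarrow> 'b rel \<Rightarrow> bool" where
  "poset_iso r s \<longleftrightarrow> (\<exists>f. bij_betw f (Field r) (Field s) \<and>
    (\<forall>x \<in> Field r. \<forall>y \<in> Field r. (x, y) \<in> r \<longleftrightarrow> (f x, f y) \<in> s))"

text \<open>
  Taking vertices and edges of the graph from the carrier type of the poset is no restriction,
  as both sets embed into the carrier of the poset.
\<close>

definition polygonal :: "'a rel \<Rightarrow> bool" where
  "polygonal r \<longleftrightarrow> (\<exists>G :: ('a, 'a) multigraph. is_multigraph G \<and> connected_multigraph G \<and>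
    regular_multigraph 2 G \<and> poset_iso r (incidence_poset G))"

text \<open>Ranked posets; \<open>leq\<close> is the reflexive order, and \<open>rk\<close> is only relevant on \<open>elems\<close>.\<close>

record 'a ranked_poset =
  elems :: "'a set"
  leq :: "'a rel"
  rk :: "'a \<Rightarrow> nat"

definition of_rank :: "'a ranked_poset \<Rightarrow> nat \<Rightarrow> 'a set" where
  "of_rank P i = {x \<in> elems P. rk P x = i}"

abbreviation "vertices P \<equiv> of_rank P 0"
abbreviation "edges P \<equiv> of_rank P 1"
abbreviation "faces P \<equiv> of_rank P 2"

definition is_ranked_poset :: "'a ranked_poset \<Rightarrow> bool" where
  "is_ranked_poset P \<longleftrightarrow> partial_order_on (elems P) (leq P) \<and>
    (\<forall>x \<in> elems P. rk P x \<in> {0, 1, 2}) \<and>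
    (\<forall>x y. (x, y) \<in> leq P \<and> x \<noteq> y \<longrightarrow> rk P x < rk P y)"

definition incident :: "'a ranked_poset \<Rightarrow> 'a \<Rightarrow> 'a \<Rightarrow> bool" where
  "incident P x y \<longleftrightarrow> (x, y) \<in> leq P \<or> (y, x) \<in> leq P"

definition flags :: "'a ranked_poset \<Rightarrow> 'a set set" where
  "flags P = {\<Phi>. pred_on.maxchain (elems P) (\<lambda>x y. (x, y) \<in> leq P) \<Phi>}"

definition skeleton :: "'a ranked_poset \<Rightarrow> ('a, 'a) multigraph" where
  "skeleton P = \<lparr>mverts = vertices P, medges = edges P,
    mends = (\<lambda>e. {v \<in> vertices P. incident P v e})\<rparr>"

definition strictly_above :: "'a ranked_poset \<Rightarrow> 'a \<Rightarrow> 'a rel" where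
  "strictly_above P x = Restr (leq P) {y. (x, y) \<in> leq P \<and> y \<noteq> x}"

definition strictly_below :: "'a ranked_poset \<Rightarrow> 'a \<Rightarrow> 'a rel" where
  "strictly_below P x = Restr (leq P) {y. (y, x) \<in> leq P \<and> y \<noteq> x}"

text \<open>
  The last condition, that faces are polygons, belongs to the usual notion of an abstract polyhedron
  (strong connectedness) and does not follow from the others: identifying opposite faces of
  the cube, while keeping its vertices and edges, gives a poset with 48 flags satisfying all the
  other conditions, with 8 edges on each of its 3 faces and 3 edges at each of its 8 vertices. It
  would be ``tight regular of type \<open>{8,3}\<close>'', although its faces are pairs of disjoint squares.
\<close>

definition polyhedron :: "'a ranked_poset \<Rightarrow> bool" where
  "polyhedron P \<longleftrightarrow> is_ranked_poset P \<and>
    (\<forall>\<Phi> \<in> flags P. \<exists>v \<in> vertices P. \<exists>e \<in> edges P. \<exists>f \<in> faces P.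
      \<Phi> = {v, e, f} \<and> incident P v e \<and> incident P e f \<and> incident P v f) \<and>
    (\<forall>e \<in> edges P. card {v \<in> vertices P. incident P v e} = 2 \<and>
      card {f \<in> faces P. incident P e f} = 2) \<and>
    connected_multigraph (skeleton P) \<and>
    (\<forall>v \<in> vertices P. polygonal (strictly_above P v)) \<and>
    (\<forall>f \<in> faces P. polygonal (strictly_below P f))"

definition has_type :: "'a ranked_poset \<Rightarrow> nat \<Rightarrow> nat \<Rightarrow> bool" where
  "has_type P p q \<longleftrightarrow>
    (\<forall>f \<in> faces P. card {e \<in> edges P. incident P e f} = p) \<and>
    (\<forall>v \<in> vertices P. card {e \<in> edges P. incident P v e} = q)"

definition poly_iso_map :: "'a ranked_poset \<Rightarrow> 'b ranked_poset \<Rightarrow> ('a \<Rightarrow> 'b) \<Rightarrow> bool" where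
  "poly_iso_map P Q \<phi> \<longleftrightarrow> bij_betw \<phi> (elems P) (elems Q) \<and>
    (\<forall>x \<in> elems P. rk Q (\<phi> x) = rk P x) \<and>
    (\<forall>x \<in> elems P. \<forall>y \<in> elems P. incident P x y \<longleftrightarrow> incident Q (\<phi> x) (\<phi> y))"

definition poly_isomorphic :: "'a ranked_poset \<Rightarrow> 'b ranked_poset \<Rightarrow> bool" where
  "poly_isomorphic P Q \<longleftrightarrow> (\<exists>\<phi>. poly_iso_map P Q \<phi>)"

definition aut_group :: "'a ranked_poset \<Rightarrow> ('a \<Rightarrow> 'a) monoid" where
  "aut_group P = (BijGroup (elems P))
    \<lparr>carrier := {\<gamma> \<in> Bij (elems P). poly_iso_map P P \<gamma>}\<rparr>"

definition regular_poly :: "'a ranked_poset \<Rightarrow> bool" where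
  "regular_poly P \<longleftrightarrow> polyhedron P \<and>
    (\<forall>\<Phi> \<in> flags P. \<forall>\<Psi> \<in> flags P. \<exists>\<gamma> \<in> carrier (aut_group P). \<gamma> ` \<Phi> = \<Psi>)"

text \<open>\<open>adj_flag P \<Phi> i\<close> is the flag \<open>\<Phi>\<^sup>i\<close>.\<close>

definition adj_flag :: "'a ranked_poset \<Rightarrow> 'a set \<Rightarrow> nat \<Rightarrow> 'a set" where
  "adj_flag P \<Phi> i =
    (THE \<Psi>. \<Psi> \<in> flags P \<and> \<Psi> \<noteq> \<Phi> \<and> {x \<in> \<Psi>. rk P x \<noteq> i} = {x \<in> \<Phi>. rk P x \<noteq> i})"

definition rho :: "'a ranked_poset \<Rightarrow> 'a set \<Rightarrow> nat \<Rightarrow> ('a \<Rightarrow> 'a)" where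
  "rho P \<Phi> i = (THE \<gamma>. \<gamma> \<in> carrier (aut_group P) \<and> \<gamma> ` \<Phi> = adj_flag P \<Phi> i)"

text \<open>
  The generated subgroup does not depend on whether products are read from left to right or from
  right to left, as the \<open>\<rho>\<^sub>i\<close> are involutions.
\<close>

definition rotation_subgroup :: "'a ranked_poset \<Rightarrow> 'a set \<Rightarrow> ('a \<Rightarrow> 'a) set" where
  "rotation_subgroup P \<Phi> = generate (aut_group P)
    {rho P \<Phi> 0 \<otimes>\<^bsub>aut_group P\<^esub> rho P \<Phi> 1, rho P \<Phi> 1 \<otimes>\<^bsub>aut_group P\<^esub> rho P \<Phi> 2}"

text \<open>
  The choice of the base flag is immaterial: by regularity, different base flags give
  conjugate rotation subgroups.
\<close>

definition orientably_regular :: "'a ranked_poset \<Rightarrow> bool" where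
  "orientably_regular P \<longleftrightarrow> regular_poly P \<and>
    (\<forall>\<Phi> \<in> flags P. card (rcosets\<^bsub>aut_group P\<^esub> (rotation_subgroup P \<Phi>)) = 2)"

definition non_orientably_regular :: "'a ranked_poset \<Rightarrow> bool" where
  "non_orientably_regular P \<longleftrightarrow> regular_poly P \<and>
    (\<forall>\<Phi> \<in> flags P. rotation_subgroup P \<Phi> = carrier (aut_group P))"

text \<open>
  These are finite, so each is isomorphic to one with carrier in \<open>nat\<close>; existence statements over
  the type \<open>nat ranked_poset\<close> therefore lose no generality.
\<close>

definition tight_regular :: "nat \<Rightarrow> nat \<Rightarrow> 'a ranked_poset \<Rightarrow> bool" where
  "tight_regular p q P \<longleftrightarrow> regular_poly P \<and> finite (elems P) \<and> has_type P p q \<and>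
    card (flags P) = 2 * p * q"

end

theory Submission
  imports Defs
begin

text \<open>
  The automorphism group of a tight regular polyhedron of type \<open>{p,q}\<close>, with its distinguished generators
  \<open>a\<close>, \<open>b\<close>, \<open>c\<close>, is a product \<open>\<langle>ab\<rangle>\<langle>b\<rangle>\<langle>bc\<rangle>\<close> in which every element has a unique normal form, and conversely
  the cosets of the vertex, edge and face stabilisers in such a group form a tight regular polyhedron.

  Let \<open>p\<close> be odd. The core \<open>\<langle>ab\<rangle> \<inter> c\<langle>ab\<rangle>c\<close> of \<open>\<langle>ab\<rangle>\<close> can be factored out. If it is trivial, the face stabiliser
  \<open>\<langle>a,b\<rangle>\<close> and its translates by \<open>c\<close> and the powers of \<open>ab\<close> give \<open>p + 1\<close> distinct faces, so \<open>p < q\<close>. As there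
  are only \<open>p\<close> vertices, some nontrivial power of \<open>bc\<close> then fixes an edge and both its vertices. Either
  this gives a nontrivial core of \<open>\<langle>bc\<rangle>\<close>, which can be factored out as well, or \<open>z = (bc)\<^bsup>q/2\<^esup>\<close> satisfies
  \<open>aza = cz\<close>; the conjugates of \<open>z\<close> then form a Klein four-group, which forces \<open>q = 4\<close>. By induction,
  either \<open>a\<close> inverts \<open>(bc)\<^sup>2\<close>, or \<open>q = 4\<close> and \<open>a(bc)\<^sup>2a = c(bc)\<^sup>2\<close>. In both cases the products \<open>c(ab)\<^sup>n\<close> have
  normal forms that depend on \<open>p\<close> and \<open>q\<close> alone; this gives the arithmetic conditions, the uniqueness and the
  index of the rotation subgroup. If \<open>q\<close> is odd, the same applies to the reversed triple \<open>c\<close>, \<open>b\<close>, \<open>a\<close>.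
\<close>

section \<open>Groups generated by three involutions\<close>

text \<open>All computations take place in a \<open>monoid_mult\<close> type with integer exponents
  modulo the orders of \<open>a * b\<close> and \<open>b * c\<close>; a group is a set
  \<open>G\<close> of normal forms there. The oddness of \<open>p\<close> does its work at three
  places. It leaves no involution among the powers of \<open>a * b\<close>: a defect
  \<open>U k\<close>, picked up when the dichotomy is lifted from a quotient, vanishes as soon as
  \<open>U (2 * k) = 1\<close>, and a nontrivial power of \<open>a * b\<close> that \<open>c\<close>
  conjugates into the group of \<open>a\<close> and \<open>b\<close> goes to a power of
  \<open>a * b\<close>, not to a reflection. It makes \<open>a * b\<close> a power of its square, so
  that \<open>a\<close> inverts the core of the group of \<open>b * c\<close>. And it rules out
  \<open>p dvd 2\<close> when \<open>q\<close> is shown to be even. The value \<open>q = 4\<close>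
  arises as follows. A power of \<open>a * b\<close> permutes \<open>z\<close>, \<open>c\<close> and
  \<open>c * z\<close> cyclically by conjugation. As \<open>b\<close> inverts this power and
  commutes with \<open>z\<close>, it must exchange \<open>c\<close> and \<open>c * z\<close>; but
  \<open>b * c * b = c * z\<close> means that \<open>(b * c)^2 = z\<close>, and \<open>z\<close> is
  the power of \<open>b * c\<close> with exponent \<open>q / 2\<close>.\<close>

datatype 'a endo = Endo (app: "'a \<Rightarrow> 'a")

instantiation endo :: (type) monoid_mult
begin
definition one_endo :: "'a endo" where "1 = Endo id"
definition times_endo :: "'a endo \<Rightarrow> 'a endo \<Rightarrow> 'a endo" where "f * g = Endo (app f \<circ> app g)"
instance by standard (auto simp: one_endo_def times_endo_def endo.expand fun_eq_iff)
end

lemma app_one [simp]: "app 1 = id"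
  by (simp add: one_endo_def)

lemma app_times [simp]: "app (f * g) = app f \<circ> app g"
  by (simp add: times_endo_def)

lemma endo_eqI: "(\<And>x. app f x = app g x) \<Longrightarrow> f = g"
  by (rule endo.expand) auto

text \<open>Quotients are represented in a fixed type, so that an induction on the order of a group can pass to them.\<close>

lemma quotient_hom:
  fixes G N :: "'g::monoid_mult set"
  assumes fin: "finite G" and one: "1 \<in> G" and closed: "\<And>g h. g \<in> G \<Longrightarrow> h \<in> G \<Longrightarrow> g * h \<in> G"
    and N: "N \<subseteq> G" "1 \<in> N" "\<And>m n. m \<in> N \<Longrightarrow> n \<in> N \<Longrightarrow> m * n \<in> N"
    and inv: "\<And>n. n \<in> N \<Longrightarrow> \<exists>m\<in>N. n * m = 1"
    and normal: "\<And>g n. g \<in> G \<Longrightarrow> n \<in> N \<Longrightarrow> \<exists>m\<in>N. n * g = g * m"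
  shows "\<exists>\<phi> :: 'g \<Rightarrow> nat endo. \<phi> 1 = 1 \<and> (\<forall>g\<in>G. \<forall>h\<in>G. \<phi> (g * h) = \<phi> g * \<phi> h) \<and>
    (\<forall>g\<in>G. \<phi> g = 1 \<longleftrightarrow> g \<in> N)"
proof -
  define act where "act g C = (\<lambda>z. g * z) ` C" for g :: 'g and C
  define K where "K = (\<lambda>h. act h N) ` G"
  have "finite K" using fin by (simp add: K_def)
  then obtain e :: "'g set \<Rightarrow> nat" where e: "inj_on e K"
    using finite_imp_inj_to_nat_seg by blast
  \<comment> \<open>Left multiplication on the cosets of \<open>N\<close>, transported to numbers by
    \<open>e\<close>. Numbers that encode no coset stay fixed, so that the unit acts as the unit of
    \<open>nat endo\<close>.\<close>
  define \<phi> where "\<phi> g = Endo (\<lambda>n. if n \<in> e ` K then e (act g (inv_into K e n)) else n)" for g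
  have act_act: "act g (act h C) = act (g * h) C" for g h C
    by (auto simp: act_def image_image mult.assoc)
  have act1: "act 1 C = C" for C by (simp add: act_def)
  have actK: "act g C \<in> K" if "g \<in> G" "C \<in> K" for g C
    using that closed by (auto simp: K_def act_act)
  have app: "app (\<phi> g) (e C) = e (act g C)" if "C \<in> K" for g C
    using that e by (simp add: \<phi>_def)
  have app': "app (\<phi> g) n = n" if "n \<notin> e ` K" for g n
    using that by (simp add: \<phi>_def)
  have eqI: "\<phi> g = f" if "\<And>C. C \<in> K \<Longrightarrow> e (act g C) = app f (e C)" "\<And>n. n \<notin> e ` K \<Longrightarrow> app f n = n" for g f
  proof (rule endo_eqI)
    fix n
    show "app (\<phi> g) n = app f n"
    proof (cases "n \<in> e ` K")
      case True
      then obtain C where C: "C \<in> K" "n = e C" by blast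
      show ?thesis unfolding C(2) app[OF C(1)] by (rule that(1)[OF C(1)])
    next
      case False
      then show ?thesis unfolding app'[OF False] by (simp add: that(2))
    qed
  qed
  have NK: "N \<in> K" unfolding K_def using image_eqI[of N "\<lambda>h. act h N" 1 G] act1[of N] one by simp
  have "\<phi> 1 = 1"
  proof (rule eqI)
    show "e (act 1 C) = app 1 (e C)" for C unfolding act1 app_one id_apply ..
    show "app 1 n = n" for n :: nat unfolding app_one id_apply ..
  qed
  moreover have "\<phi> (g * h) = \<phi> g * \<phi> h" if "g \<in> G" "h \<in> G" for g h
    by (rule eqI) (use that in \<open>simp_all add: app app' actK act_act\<close>)
  moreover have "\<phi> g = 1 \<longleftrightarrow> g \<in> N" if g: "g \<in> G" for g
  proof
    assume "\<phi> g = 1"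
    then have "e (act g N) = e N" using app[OF NK, of g] by simp
    then have "act g N = N" using e NK actK[OF g NK] by (auto dest: inj_onD)
    then show "g \<in> N" using N(2) unfolding act_def by (metis imageI mult.right_neutral)
  next
    assume gN: "g \<in> N"
    \<comment> \<open>Normality moves \<open>g\<close> past the representative:
      \<open>g h N = h m N = h N\<close>.\<close>
    have "act g C = C" if CK: "C \<in> K" for C
    proof -
      obtain h where h: "h \<in> G" "C = act h N" using CK unfolding K_def by blast
      obtain m where m: "m \<in> N" "g * h = h * m" using normal[OF h(1) gN] by auto
      obtain m' where m': "m' \<in> N" "m * m' = 1" using inv[OF m(1)] by auto
      have "act m N = N"
      proof
        show "act m N \<subseteq> N" using m N by (auto simp: act_def)
        show "N \<subseteq> act m N"
        proof
          fix n assume "n \<in> N"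
          then have "m' * n \<in> N" "n = m * (m' * n)" using m' N by (auto simp flip: mult.assoc)
          then show "n \<in> act m N" unfolding act_def by blast
        qed
      qed
      then show ?thesis by (metis h(2) m(2) act_act)
    qed
    then show "\<phi> g = 1" by (intro eqI) simp_all
  qed
  ultimately show ?thesis by blast
qed

text \<open>Applied to the exponents \<open>k\<close> for which \<open>U k\<close> or
  \<open>V k\<close> lies in a core. The generator \<open>d\<close> becomes the order of the
  rotation in the quotient, and \<open>d dvd n\<close> makes it a divisor of the old order.\<close>

lemma additive_subgroup_int:
  fixes J :: "int set"
  assumes "int n \<in> J" "n > 0" and add: "\<And>i j. i \<in> J \<Longrightarrow> j \<in> J \<Longrightarrow> i + j \<in> J"
    and neg: "\<And>i. i \<in> J \<Longrightarrow> - i \<in> J"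
  obtains d where "d > 0" "d dvd n" "\<And>i. i \<in> J \<longleftrightarrow> int d dvd i"
proof -
  define d where "d = (LEAST d. d > 0 \<and> int d \<in> J)"
  have d: "d > 0" "int d \<in> J" and least: "\<And>m. m > 0 \<Longrightarrow> int m \<in> J \<Longrightarrow> d \<le> m"
    using LeastI[of "\<lambda>d. d > 0 \<and> int d \<in> J" n] Least_le[of "\<lambda>d. d > 0 \<and> int d \<in> J"] assms(1,2)
    by (auto simp: d_def)
  have mult_nat: "int m * int d \<in> J" for m
  proof (induction m)
    case 0
    have "int d + - int d \<in> J" using add neg d by blast
    then show ?case by simp
  next
    case (Suc m)
    then show ?case using add[OF d(2) Suc] by (simp add: algebra_simps)
  qed
  have mult: "k * int d \<in> J" for k
    using mult_nat[of "nat k"] neg[OF mult_nat[of "nat (-k)"]] by (cases "k \<ge> 0") auto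
  have iff: "i \<in> J \<longleftrightarrow> int d dvd i" for i
  proof
    assume i: "i \<in> J"
    have "i + - (i div int d * int d) \<in> J" using i mult neg add by blast
    then have "int (nat (i mod int d)) \<in> J"
      using d(1) by (simp add: minus_div_mult_eq_mod)
    moreover have "nat (i mod int d) < d"
      using d(1) by (simp add: nat_less_iff)
    ultimately have "nat (i mod int d) = 0" using least by (metis gr0I not_less)
    then have "i mod int d = 0" using d(1) pos_mod_sign[of "int d" i] by linarith
    then show "int d dvd i" by (simp add: dvd_eq_mod_eq_0)
  next
    assume "int d dvd i"
    then show "i \<in> J" using mult by (metis dvd_def mult.commute)
  qed
  show ?thesis using that[OF d(1) _ iff] iff[of "int n"] assms(1) by simp
qed

text \<open>Integral powers, meaningful if \<open>x ^ n = 1\<close>.\<close>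

definition zp :: "'g::monoid_mult \<Rightarrow> nat \<Rightarrow> int \<Rightarrow> 'g" where
  "zp x n k = x ^ nat (k mod int n)"

context
  fixes x :: "'g::monoid_mult" and n :: nat
  assumes xn: "x ^ n = 1" and n: "n > 0"
begin

lemma pow_cong: "int k mod int n = int l mod int n \<Longrightarrow> x ^ k = x ^ l"
proof -
  have *: "x ^ k = x ^ (k mod n)" for k
  proof -
    have "x ^ k = (x ^ n) ^ (k div n) * x ^ (k mod n)"
      by (simp flip: power_mult power_add)
    then show ?thesis by (simp add: xn)
  qed
  assume "int k mod int n = int l mod int n"
  then have "k mod n = l mod n" by (simp flip: of_nat_mod)
  then show ?thesis using *[of k] *[of l] by simp
qed

lemma zp_of_nat: "zp x n (int m) = x ^ m"
  unfolding zp_def by (rule pow_cong) (use n in simp)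

lemma zp_cong: "k mod int n = l mod int n \<Longrightarrow> zp x n k = zp x n l"
  by (simp add: zp_def)

lemma zp_nat_ex: obtains m where "zp x n k = x ^ m" "int n dvd k - int m"
proof
  show "zp x n k = x ^ nat (k mod int n)" by (simp add: zp_def)
  show "int n dvd k - int (nat (k mod int n))"
    using n by (simp add: mod_eq_dvd_iff[symmetric])
qed

lemma zp_add: "zp x n (k + l) = zp x n k * zp x n l"
  unfolding zp_def power_add[symmetric]
  by (rule pow_cong) (use n in \<open>simp add: mod_simps\<close>)

lemma zp_conj:
  assumes "s * x = zp x n (-1) * s"
  shows "s * zp x n k = zp x n (- k) * s"
proof -
  have *: "s * x ^ m = zp x n (- int m) * s" for m
  proof (induction m)
    case 0
    then show ?case by (simp add: zp_def)
  next
    case (Suc m)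
    have "s * x ^ Suc m = s * x ^ m * x" by (simp add: power_commutes mult.assoc)
    also have "\<dots> = zp x n (- int m) * (s * x)" by (simp add: Suc mult.assoc)
    also have "\<dots> = zp x n (- int m + -1) * s" by (simp only: assms zp_add mult.assoc)
    finally show ?case by (simp add: algebra_simps)
  qed
  obtain m where m: "zp x n k = x ^ m" "int n dvd k - int m" by (rule zp_nat_ex)
  have "zp x n (- int m) = zp x n (- k)"
    using m(2) by (intro zp_cong) (simp add: mod_eq_dvd_iff)
  then show ?thesis using * m by simp
qed

end

text \<open>Only relations are required here: the true orders of \<open>a * b\<close> and
  \<open>b * c\<close> may be proper divisors of \<open>p\<close> and \<open>q\<close>. This much is
  available before freeness is known, and it also covers a plain dihedral group with
  \<open>c = 1\<close>.\<close>

locale coxeter_pair =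
  fixes a b c :: "'g::monoid_mult" and p q :: nat
  assumes aa: "a * a = 1" and bb: "b * b = 1" and cc: "c * c = 1" and ac: "a * c = c * a"
    and p0: "p > 0" and q0: "q > 0" and xp: "(a * b) ^ p = 1" and yq: "(b * c) ^ q = 1"
begin

definition U :: "int \<Rightarrow> 'g" where "U = zp (a * b) p"
definition V :: "int \<Rightarrow> 'g" where "V = zp (b * c) q"
definition B :: "bool \<Rightarrow> 'g" where "B e = (if e then b else 1)"

lemma aa' [simp]: "a * a = 1" "a * (a * z) = z" by (simp_all add: aa flip: mult.assoc)
lemma bb' [simp]: "b * b = 1" "b * (b * z) = z" by (simp_all add: bb flip: mult.assoc)
lemma cc' [simp]: "c * c = 1" "c * (c * z) = z" by (simp_all add: cc flip: mult.assoc)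

lemma U0 [simp]: "U 0 = 1" and V0 [simp]: "V 0 = 1"
  by (simp_all add: U_def V_def zp_def)
lemma UU [simp]: "U i * U j = U (i + j)" "U i * (U j * z) = U (i + j) * z"
  by (simp_all add: U_def zp_add[OF xp p0] mult.assoc)
lemma VV [simp]: "V i * V j = V (i + j)" "V i * (V j * z) = V (i + j) * z"
  by (simp_all add: V_def zp_add[OF yq q0] mult.assoc)
lemma U1: "U 1 = a * b" using zp_of_nat[OF xp p0, of 1] by (simp add: U_def)
lemma V1: "V 1 = b * c" using zp_of_nat[OF yq q0, of 1] by (simp add: V_def)
lemma U_cong: "int p dvd i - j \<Longrightarrow> U i = U j" unfolding U_def zp_def mod_eq_dvd_iff[symmetric] by simp
lemma V_cong: "int q dvd i - j \<Longrightarrow> V i = V j" unfolding V_def zp_def mod_eq_dvd_iff[symmetric] by simp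

lemma Um1: "U (-1) = b * a"
proof -
  have "U (-1) = U (-1) * (U 1 * (b * a))" by (simp add: U1 mult.assoc)
  then show ?thesis by (simp add: mult.assoc del: aa' bb' add: UU(2))
qed
lemma Vm1: "V (-1) = c * b"
proof -
  have "V (-1) = V (-1) * (V 1 * (c * b))" by (simp add: V1 mult.assoc)
  then show ?thesis by (simp add: mult.assoc del: cc' bb' add: VV(2))
qed

lemma bU: "b * U k = U (-k) * b" "b * (U k * z) = U (-k) * (b * z)"
proof -
  show *: "b * U k = U (-k) * b"
    using zp_conj[OF xp p0, of b] Um1 by (simp add: U_def mult.assoc)
  then show "b * (U k * z) = U (-k) * (b * z)" by (simp flip: mult.assoc)
qed
lemma aU: "a * U k = U (-k) * a" "a * (U k * z) = U (-k) * (a * z)"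
proof -
  show *: "a * U k = U (-k) * a"
    using zp_conj[OF xp p0, of a] Um1 by (simp add: U_def mult.assoc)
  then show "a * (U k * z) = U (-k) * (a * z)" by (simp flip: mult.assoc)
qed
lemma bV: "b * V k = V (-k) * b" "b * (V k * z) = V (-k) * (b * z)"
proof -
  show *: "b * V k = V (-k) * b"
    using zp_conj[OF yq q0, of b] Vm1 by (simp add: V_def mult.assoc)
  then show "b * (V k * z) = V (-k) * (b * z)" by (simp flip: mult.assoc)
qed
lemma cV: "c * V k = V (-k) * c" "c * (V k * z) = V (-k) * (c * z)"
proof -
  show *: "c * V k = V (-k) * c"
    using zp_conj[OF yq q0, of c] Vm1 by (simp add: V_def mult.assoc)
  then show "c * (V k * z) = V (-k) * (c * z)" by (simp flip: mult.assoc)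
qed
lemma Vb: "V k * b = b * V (-k)" "V k * (b * z) = b * (V (-k) * z)"
  by (simp_all add: bV)
lemma a_nf: "a = U 1 * b" and c_nf: "c = b * V 1"
  by (simp_all add: U1 V1 mult.assoc)

lemma V2: "(b * c)^2 = V 2"
  using VV(1)[of 1 1] by (simp add: V1 power2_eq_square)

lemma aca: "a * (c * a) = c" "a * (c * (a * z)) = c * z"
  by (metis aa'(2) ac) (metis aa'(2) ac mult.assoc)

lemma cV_nf: "c * V i = b * V (i + 1)"
proof -
  have "c * V i = (b * V 1) * V i" by (simp only: c_nf[symmetric])
  then show ?thesis by (simp add: mult.assoc add.commute)
qed

lemma Ub: "U k * b = b * U (- k)" "U k * (b * z) = b * (U (- k) * z)"
  by (simp_all add: bU)

lemma BB [simp]: "B e * B f = B (e \<noteq> f)" "B e * (B f * z) = B (e \<noteq> f) * z"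
  by (auto simp: B_def)
lemma B_simps [simp]: "B True = b" "B False = 1"
  by (auto simp: B_def)
lemma bB [simp]: "b * B e = B (\<not> e)" "b * (B e * z) = B (\<not> e) * z" "B e * b = B (\<not> e)" "B e * (b * z) = B (\<not> e) * z"
  by (auto simp: B_def)
lemma BU: "\<exists>j. \<forall>z. B e * (U i * z) = U j * (B e * z)"
  by (cases e) (auto simp: B_def bU)
lemma VB: "V i * (B e * z) = B e * (V (if e then - i else i) * z)"
  by (auto simp: B_def Vb)

text \<open>\<open>D\<close> and \<open>E\<close> are the groups generated by \<open>a\<close>,
  \<open>b\<close> and by \<open>b\<close>, \<open>c\<close>, that is, the stabilisers of a face and
  of a vertex. \<open>G\<close> is the product \<open>D E\<close>, at this stage merely a
  set.\<close>

definition G :: "'g set" where "G = {U i * (B e * V j) | i e j. True}"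
definition D :: "'g set" where "D = {U i * B e | i e. True}"
definition E :: "'g set" where "E = {B e * V j | e j. True}"

lemma GI [intro]: "U i * (B e * V j) \<in> G" by (auto simp: G_def)
lemma EI [intro]: "B e * V j \<in> E" by (auto simp: E_def)
lemma DI [intro]: "U i * B e \<in> D" by (auto simp: D_def)

lemma finite_G: "finite G"
proof -
  have "G \<subseteq> (\<lambda>(i, e, j). U i * (B e * V j)) ` ({0..<int p} \<times> UNIV \<times> {0..<int q})"
  proof
    fix g assume "g \<in> G"
    then obtain i e j where g: "g = U i * (B e * V j)" by (auto simp: G_def)
    have "g = U (i mod int p) * (B e * V (j mod int q))"
      unfolding g using U_cong[of i "i mod int p"] V_cong[of j "j mod int q"] by auto
    then show "g \<in> (\<lambda>(i, e, j). U i * (B e * V j)) ` ({0..<int p} \<times> UNIV \<times> {0..<int q})"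
      by (intro image_eqI[of _ _ "(i mod int p, e, j mod int q)"]) (use p0 q0 in auto)
  qed
  then show ?thesis by (rule finite_subset) auto
qed

end

text \<open>One condition for three facts: the orders of \<open>a * b\<close> and
  \<open>b * c\<close> are exactly \<open>p\<close> and \<open>q\<close>, \<open>b\<close> is not a
  product of powers of the two, and \<open>D\<close> and \<open>E\<close> meet only in 1 and
  \<open>b\<close>.\<close>

locale factorized_pair = coxeter_pair a b c p q for a b c :: "'g::monoid_mult" and p q +
  assumes distinct: "U i * (B e * V j) = 1 \<Longrightarrow> int p dvd i \<and> \<not> e \<and> int q dvd j"
begin

lemma nf_eq: "U i * (B e * V j) = U i' * (B e' * V j') \<longleftrightarrow>
  int p dvd i - i' \<and> e = e' \<and> int q dvd j - j'" (is "?l \<longleftrightarrow> ?r")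
proof
  assume ?l
  then have "U (-i') * (U i * (B e * V j)) * (V (-j') * B e') = U (-i') * (U i' * (B e' * V j')) * (V (-j') * B e')"
    by simp
  then have "U (i - i') * (B e * (V (j - j') * B e')) = 1"
    by (simp add: mult.assoc)
  then have "U (i - i') * (B (e \<noteq> e') * V (if e' then - (j - j') else j - j')) = 1"
    using VB[of "j - j'" e' 1] by simp
  from distinct[OF this] show ?r by (auto split: if_splits simp: dvd_diff_commute)
next
  assume ?r
  then show ?l using U_cong[of i i'] V_cong[of j j'] by simp
qed

lemma U_eq_iff: "U i = U j \<longleftrightarrow> int p dvd i - j"
  using nf_eq[of i False 0 j False 0] by simp
lemma V_eq_iff: "V i = V j \<longleftrightarrow> int q dvd i - j"
  using nf_eq[of 0 False i 0 False j] by simp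
lemma U_eq_1: "U i = 1 \<longleftrightarrow> int p dvd i" using U_eq_iff[of i 0] by simp
lemma V_eq_1: "V i = 1 \<longleftrightarrow> int q dvd i" using V_eq_iff[of i 0] by simp
lemma E_eq_iff: "B e * V j = B e' * V j' \<longleftrightarrow> e = e' \<and> int q dvd j - j'"
  using nf_eq[of 0 e j 0 e' j'] by simp

text \<open>Proved before \<open>closed\<close> is available, because for automorphism groups
  \<open>closed\<close> is deduced from this count.\<close>

lemma card_G: "card G = 2 * p * q"
proof -
  let ?f = "\<lambda>(i, e, j). U i * (B e * V j)" and ?A = "{0..<int p} \<times> (UNIV :: bool set) \<times> {0..<int q}"
  have inj: "inj_on ?f ?A"
  proof (rule inj_onI, simp only: split_paired_all mem_Sigma_iff split prod.inject)
    fix i e j i' e' j'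
    assume "i \<in> {0..<int p} \<and> e \<in> UNIV \<and> j \<in> {0..<int q}"
      "i' \<in> {0..<int p} \<and> e' \<in> UNIV \<and> j' \<in> {0..<int q}"
      and eq: "U i * (B e * V j) = U i' * (B e' * V j')"
    moreover have "i mod int p = i' mod int p" "e = e'" "j mod int q = j' mod int q"
      using eq[unfolded nf_eq] unfolding mod_eq_dvd_iff by blast+
    ultimately show "i = i' \<and> e = e' \<and> j = j'" by simp
  qed
  have "G = ?f ` ?A"
  proof
    show "?f ` ?A \<subseteq> G" by auto
    show "G \<subseteq> ?f ` ?A"
    proof
      fix g assume "g \<in> G"
      then obtain i e j where g: "g = U i * (B e * V j)" by (auto simp: G_def)
      have "g = U (i mod int p) * (B e * V (j mod int q))"
        unfolding g nf_eq by auto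
      then show "g \<in> ?f ` ?A"
        by (intro image_eqI[of _ _ "(i mod int p, e, j mod int q)"]) (use p0 q0 in auto)
    qed
  qed
  then show ?thesis using card_image[OF inj] by (simp add: card_cartesian_product)
qed

end

text \<open>The shape of \<open>G\<close> makes it stable under left multiplication by
  \<open>U i\<close> and \<open>b\<close> and right multiplication by \<open>V j\<close> and
  \<open>B e\<close>. Stability under left multiplication by \<open>c\<close> reduces to
  \<open>closed\<close>, and then \<open>G\<close> is a group.\<close>

locale tight_triple = factorized_pair a b c p q for a b c :: "'g::monoid_mult" and p q +
  assumes closed: "c * U i \<in> G"
begin

lemma G_U: "g \<in> G \<Longrightarrow> U i * g \<in> G" by (auto simp: G_def) blast
lemma G_b: "g \<in> G \<Longrightarrow> b * g \<in> G"
  by (auto simp: G_def bU) blast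
lemma G_V: "g \<in> G \<Longrightarrow> g * V i \<in> G" by (auto simp: G_def mult.assoc) blast
lemma G_B: "g \<in> G \<Longrightarrow> g * B e \<in> G"
proof -
  assume "g \<in> G"
  then obtain i f j where g: "g = U i * (B f * V j)" by (auto simp: G_def)
  have "g * B e = U i * (B (f \<noteq> e) * V (if e then - j else j))"
    using VB[of j e 1] by (simp add: g mult.assoc)
  then show ?thesis by auto
qed
lemma G_c: "g \<in> G \<Longrightarrow> c * g \<in> G"
proof -
  assume "g \<in> G"
  then obtain i e j where g: "g = U i * (B e * V j)" by (auto simp: G_def)
  have "c * g = c * U i * B e * V j" by (simp add: g mult.assoc)
  then show ?thesis using G_V[OF G_B[OF closed]] by simp
qed
lemma G_a: "g \<in> G \<Longrightarrow> a * g \<in> G"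
  using G_U[OF G_b, of g 1] by (simp add: U1 mult.assoc)

lemma one_G [simp]: "1 \<in> G" using GI[of 0 False 0] by simp

text \<open>Positive words in the three generators suffice because \<open>zp\<close> reduces every
  exponent to a natural number.\<close>

lemma G_induct [consumes 1, case_names one a b c]:
  assumes "g \<in> G" "P 1" "\<And>h. h \<in> G \<Longrightarrow> P h \<Longrightarrow> P (a * h)" "\<And>h. h \<in> G \<Longrightarrow> P h \<Longrightarrow> P (b * h)"
    "\<And>h. h \<in> G \<Longrightarrow> P h \<Longrightarrow> P (c * h)"
  shows "P g"
proof -
  have y: "P ((b * c) ^ n * h) \<and> (b * c) ^ n * h \<in> G" if "P h" "h \<in> G" for n h
    by (induction n) (use that assms G_b G_c in \<open>auto simp: mult.assoc\<close>)
  have x: "P ((a * b) ^ n * h) \<and> (a * b) ^ n * h \<in> G" if "P h" "h \<in> G" for n h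
    by (induction n) (use that assms G_b G_a in \<open>auto simp: mult.assoc\<close>)
  obtain i e j where g: "g = U i * (B e * V j)" using assms(1) by (auto simp: G_def)
  have 1: "P (V j) \<and> V j \<in> G" using y[of 1] assms(2) by (simp add: V_def zp_def)
  then have 2: "P (B e * V j) \<and> B e * V j \<in> G" using assms(4) G_b by (auto simp: B_def)
  show ?thesis unfolding g using x[of "B e * V j"] 2 by (simp add: U_def zp_def)
qed

lemma G_mult: assumes "g \<in> G" "h \<in> G" shows "g * h \<in> G"
  using assms(1) by (induction rule: G_induct) (auto simp: assms(2) G_a G_b G_c mult.assoc)

lemma a_G: "a \<in> G" and b_G: "b \<in> G" and c_G: "c \<in> G"
  using G_a[of 1] G_b[of 1] G_c[of 1] by auto
lemma U_G: "U i \<in> G" and V_G: "V j \<in> G" and B_G: "B e \<in> G"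
  using GI[of i False 0] GI[of 0 False j] GI[of 0 e 0] by auto
lemma E_G: "E \<subseteq> G" and D_G: "D \<subseteq> G"
  using GI[of 0] GI[of _ _ 0] by (auto simp: E_def D_def)

lemma G_inv: assumes "g \<in> G" shows "\<exists>h\<in>G. g * h = 1 \<and> h * g = 1"
proof -
  obtain i e j where g: "g = U i * (B e * V j)" using assms(1) by (auto simp: G_def)
  show ?thesis
  proof (intro bexI conjI)
    show "V (-j) * (B e * U (-i)) \<in> G" by (intro G_mult U_G V_G B_G)
  qed (simp_all add: g mult.assoc)
qed

end

section \<open>Tight triples with odd face size\<close>

text \<open>Written without \<open>U\<close>, \<open>V\<close> and the locale, so that it can be
  stated for the image triples in \<open>nat endo\<close> through the whole induction.\<close>

definition dichotomy :: "'g::monoid_mult \<Rightarrow> 'g \<Rightarrow> 'g \<Rightarrow> nat \<Rightarrow> bool" where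
  "dichotomy a b c q \<longleftrightarrow> a * (b * c)^2 * a * (b * c)^2 = 1 \<or> (q = 4 \<and> a * (b * c)^2 * a = c * (b * c)^2)"

section \<open>Quotients of tight triples and lifting of the dichotomy\<close>

context tight_triple begin

lemma dichotomyI1: "a * V 2 * a * V 2 = 1 \<Longrightarrow> dichotomy a b c q"
  unfolding dichotomy_def V2 by (rule disjI1)

lemma dichotomyI2: "q = 4 \<Longrightarrow> a * V 2 * a = c * V 2 \<Longrightarrow> dichotomy a b c q"
  unfolding dichotomy_def V2 by (intro disjI2 conjI)

text \<open>Induction on a word for \<open>g\<close>, pushing \<open>n\<close> through one generator
  at a time. The form \<open>n * g = g * m\<close> is the one that \<open>quotient_hom\<close>
  expects and avoids inverses.\<close>

lemma normalI:
  assumes "\<And>n. n \<in> N \<Longrightarrow> a * n * a \<in> N" "\<And>n. n \<in> N \<Longrightarrow> b * n * b \<in> N" "\<And>n. n \<in> N \<Longrightarrow> c * n * c \<in> N"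
    and "g \<in> G" "n \<in> N"
  shows "\<exists>m\<in>N. n * g = g * m"
  using assms(4,5)
proof (induction arbitrary: n rule: G_induct)
  case one
  then show ?case by auto
next
  case (a h)
  obtain m where m: "m \<in> N" "a * n * a * h = h * m" using a.IH[OF assms(1)[OF a.prems]] by auto
  have "n * (a * h) = a * (a * n * a * h)" by (simp add: mult.assoc)
  then show ?case unfolding m(2) using m(1) by (auto simp: mult.assoc)
next
  case (b h)
  obtain m where m: "m \<in> N" "b * n * b * h = h * m" using b.IH[OF assms(2)[OF b.prems]] by auto
  have "n * (b * h) = b * (b * n * b * h)" by (simp add: mult.assoc)
  then show ?case unfolding m(2) using m(1) by (auto simp: mult.assoc)
next
  case (c h)
  obtain m where m: "m \<in> N" "c * n * c * h = h * m" using c.IH[OF assms(3)[OF c.prems]] by auto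
  have "n * (c * h) = c * (c * n * c * h)" by (simp add: mult.assoc)
  then show ?case unfolding m(2) using m(1) by (auto simp: mult.assoc)
qed

text \<open>By \<open>char\<close>, the normal form of an element of \<open>N\<close> has trivial
  \<open>b\<close>-part and exponents divisible by \<open>d\<close> and \<open>l\<close>. Hence
  normal forms in the quotient are the old ones with exponents modulo \<open>d\<close> and
  \<open>l\<close>, and uniqueness and closure are inherited.\<close>

lemma quotient_triple:
  assumes N: "N \<subseteq> G" "1 \<in> N" "\<And>m n. m \<in> N \<Longrightarrow> n \<in> N \<Longrightarrow> m * n \<in> N"
    "\<And>n. n \<in> N \<Longrightarrow> \<exists>m\<in>N. n * m = 1"
    and conj: "\<And>n. n \<in> N \<Longrightarrow> a * n * a \<in> N" "\<And>n. n \<in> N \<Longrightarrow> b * n * b \<in> N" "\<And>n. n \<in> N \<Longrightarrow> c * n * c \<in> N"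
    and d: "d dvd p" "l dvd q" "U (int d) \<in> N" "V (int l) \<in> N"
    and char: "\<And>i e j. U i * (B e * V j) \<in> N \<Longrightarrow> int d dvd i \<and> \<not> e \<and> int l dvd j"
  shows "\<exists>\<phi> :: 'g \<Rightarrow> nat endo. \<phi> 1 = 1 \<and> (\<forall>g\<in>G. \<forall>h\<in>G. \<phi> (g * h) = \<phi> g * \<phi> h) \<and>
    (\<forall>g\<in>G. \<phi> g = 1 \<longleftrightarrow> g \<in> N) \<and> tight_triple (\<phi> a) (\<phi> b) (\<phi> c) d l"
proof -
  obtain \<phi> :: "'g \<Rightarrow> nat endo" where \<phi>1: "\<phi> 1 = 1"
    and hom: "\<And>g h. g \<in> G \<Longrightarrow> h \<in> G \<Longrightarrow> \<phi> (g * h) = \<phi> g * \<phi> h"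
    and ker: "\<And>g. g \<in> G \<Longrightarrow> \<phi> g = 1 \<longleftrightarrow> g \<in> N"
    using quotient_hom[OF finite_G one_G G_mult N normalI[OF conj]] by blast
  have d0: "d > 0" "l > 0" using d p0 q0 by (auto intro: Nat.gr0I)
  have pow: "\<phi> (g ^ n) = \<phi> g ^ n \<and> g ^ n \<in> G" if "g \<in> G" for g n
    by (induction n) (use that in \<open>auto simp: \<phi>1 hom G_mult\<close>)
  have ab: "a * b \<in> G" "b * c \<in> G" using U_G[of 1] V_G[of 1] by (simp_all add: U1 V1)
  have \<phi>ab: "\<phi> (a * b) = \<phi> a * \<phi> b" "\<phi> (b * c) = \<phi> b * \<phi> c"
    by (simp_all add: hom a_G b_G c_G)
  have Ud: "(a * b) ^ d = U (int d)" using zp_of_nat[OF xp p0] by (simp add: U_def)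
  have Vl: "(b * c) ^ l = V (int l)" using zp_of_nat[OF yq q0] by (simp add: V_def)
  interpret Q: coxeter_pair "\<phi> a" "\<phi> b" "\<phi> c" d l
  proof
    show "\<phi> a * \<phi> a = 1" "\<phi> b * \<phi> b = 1" "\<phi> c * \<phi> c = 1"
      by (simp_all add: \<phi>1 flip: hom[OF a_G a_G] hom[OF b_G b_G] hom[OF c_G c_G])
    show "\<phi> a * \<phi> c = \<phi> c * \<phi> a"
      by (simp add: ac flip: hom[OF a_G c_G] hom[OF c_G a_G])
    show "(\<phi> a * \<phi> b) ^ d = 1" using d(3) pow[OF ab(1), of d] ker[OF U_G] by (metis \<phi>ab(1) Ud)
    show "(\<phi> b * \<phi> c) ^ l = 1" using d(4) pow[OF ab(2), of l] ker[OF V_G] by (metis \<phi>ab(2) Vl)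
  qed (rule d0)+
  have \<phi>U: "\<phi> (U i) = Q.U i" for i
  proof -
    have "\<phi> (U i) = (\<phi> a * \<phi> b) ^ nat (i mod int p)"
      using pow[OF ab(1)] by (simp add: U_def zp_def \<phi>ab)
    also have "\<dots> = Q.U (int (nat (i mod int p)))" unfolding Q.U_def by (rule zp_of_nat[OF Q.xp d0(1), symmetric])
    also have "\<dots> = Q.U i"
    proof (rule Q.U_cong)
      have "int p dvd int (nat (i mod int p)) - i" using p0 by (simp add: mod_eq_dvd_iff[symmetric])
      then show "int d dvd int (nat (i mod int p)) - i" using d(1) by (meson dvd_trans int_dvd_int_iff)
    qed
    finally show ?thesis .
  qed
  have \<phi>V: "\<phi> (V i) = Q.V i" for i
  proof -
    have "\<phi> (V i) = (\<phi> b * \<phi> c) ^ nat (i mod int q)"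
      using pow[OF ab(2)] by (simp add: V_def zp_def \<phi>ab)
    also have "\<dots> = Q.V (int (nat (i mod int q)))" unfolding Q.V_def by (rule zp_of_nat[OF Q.yq d0(2), symmetric])
    also have "\<dots> = Q.V i"
    proof (rule Q.V_cong)
      have "int q dvd int (nat (i mod int q)) - i" using q0 by (simp add: mod_eq_dvd_iff[symmetric])
      then show "int l dvd int (nat (i mod int q)) - i" using d(2) by (meson dvd_trans int_dvd_int_iff)
    qed
    finally show ?thesis .
  qed
  have \<phi>B: "\<phi> (B e) = Q.B e" for e by (auto simp: B_def Q.B_def \<phi>1)
  have \<phi>nf: "\<phi> (U i * (B e * V j)) = Q.U i * (Q.B e * Q.V j)" for i e j
    by (simp add: hom U_G V_G B_G G_mult \<phi>U \<phi>V \<phi>B)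
  have "tight_triple (\<phi> a) (\<phi> b) (\<phi> c) d l"
  proof (unfold_locales)
    fix i e j
    assume "Q.U i * (Q.B e * Q.V j) = 1"
    then have "U i * (B e * V j) \<in> N" using ker[OF GI] by (simp flip: \<phi>nf)
    then show "int d dvd i \<and> \<not> e \<and> int l dvd j" by (rule char)
  next
    fix i
    obtain i' e j where "c * U i = U i' * (B e * V j)" using closed[of i] by (auto simp: G_def)
    then have "\<phi> c * Q.U i = Q.U i' * (Q.B e * Q.V j)"
      by (metis \<phi>U \<phi>nf hom c_G U_G)
    then show "\<phi> c * Q.U i \<in> Q.G" by auto
  qed
  then show ?thesis using \<phi>1 hom ker by blast
qed

text \<open>The pulled back equations hold up to a factor in \<open>N\<close>. Removing this defect
  is the task of the two reduction lemmas.\<close>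

lemma dichotomy_quotient:
  assumes hom: "\<forall>g\<in>G. \<forall>h\<in>G. \<phi> (g * h) = \<phi> g * \<phi> h" and \<phi>1: "\<phi> 1 = 1"
    and ker: "\<forall>g\<in>G. \<phi> g = 1 \<longleftrightarrow> g \<in> N"
    and di: "dichotomy (\<phi> a) (\<phi> b) (\<phi> c) l"
  shows "a * V 2 * a * V 2 \<in> N \<or> (l = 4 \<and> V (-2) * c * a * V 2 * a \<in> N)"
proof -
  have hom': "\<phi> (g * h) = \<phi> g * \<phi> h" if "g \<in> G" "h \<in> G" for g h using hom that by blast
  have \<phi>2: "(\<phi> b * \<phi> c)^2 = \<phi> (V 2)"
    unfolding V2[symmetric] power2_eq_square
    by (simp add: hom' b_G c_G G_mult)
  show ?thesis
    using di[unfolded dichotomy_def \<phi>2]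
  proof (elim disjE conjE)
    assume "\<phi> a * \<phi> (V 2) * \<phi> a * \<phi> (V 2) = 1"
    then have "\<phi> (a * V 2 * a * V 2) = 1"
      by (simp add: hom' a_G V_G G_mult)
    then show ?thesis using ker by (simp add: a_G V_G G_mult)
  next
    assume l: "l = 4" and eq: "\<phi> a * \<phi> (V 2) * \<phi> a = \<phi> c * \<phi> (V 2)"
    have "\<phi> (V (-2) * c * a * V 2 * a) = \<phi> (V (-2)) * \<phi> c * (\<phi> a * \<phi> (V 2) * \<phi> a)"
      by (simp add: hom' a_G c_G V_G G_mult mult.assoc)
    also have "\<dots> = \<phi> (V (-2) * c * (c * V 2))"
      unfolding eq by (simp add: hom' a_G c_G V_G G_mult del: cc')
    also have "\<dots> = 1" by (simp add: \<phi>1 mult.assoc)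
    finally show ?thesis using ker l by (simp add: a_G c_G V_G G_mult)
  qed
qed

lemma odd_dvd_double: "odd n \<Longrightarrow> int n dvd 2 * k \<Longrightarrow> int n dvd k"
  by (simp add: coprime_dvd_mult_right_iff)

text \<open>The core of \<open>\<langle>ab\<rangle>\<close> is \<open>\<langle>ab\<rangle> \<inter> c\<langle>ab\<rangle>c\<close>, as \<open>a\<close> and \<open>b\<close> invert \<open>ab\<close>.\<close>

lemma reduce_core_ab:
  assumes odd: "odd p" and k: "c * U k * c \<in> range U" "\<not> int p dvd k"
  shows "\<exists>(a' :: nat endo) b' c' d. d < p \<and> odd d \<and> tight_triple a' b' c' d q \<and>
    (dichotomy a' b' c' q \<longrightarrow> dichotomy a b c q)"
proof -
  define J where "J = {k. c * U k * c \<in> range U}"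
  have JI: "k \<in> J" if "c * U k = U m * c" for k m
    unfolding J_def that mem_Collect_eq by (simp add: mult.assoc)
  have JE: "\<exists>m\<in>J. c * U k = U m * c" if k: "k \<in> J" for k
  proof -
    obtain m where m: "c * U k * c = U m" using k by (auto simp: J_def)
    have "c * U k = U m * c" "c * U m = U k * c" by (simp_all add: m[symmetric] mult.assoc)
    then show ?thesis using JI by blast
  qed
  have neg: "c * U (-k) = U (-m) * c" if "c * U k = U m * c" for k m
  proof -
    have "U (-m) * (c * U k) * U (-k) = U (-m) * (U m * c) * U (-k)" by (simp only: that)
    then show ?thesis by (simp add: mult.assoc)
  qed
  have pJ: "int p \<in> J" using U_cong[of "int p" 0] by (intro JI[of _ 0]) simp
  have addJ: "i + j \<in> J" if "i \<in> J" "j \<in> J" for i j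
  proof -
    obtain m n where mn: "c * U i = U m * c" "c * U j = U n * c" using JE \<open>i \<in> J\<close> \<open>j \<in> J\<close> by blast
    have "c * U (i + j) = (c * U i) * U j" by (simp add: mult.assoc)
    also have "\<dots> = U m * (c * U j)" by (simp only: mn mult.assoc)
    also have "\<dots> = U (m + n) * c" by (simp only: mn UU mult.assoc)
    finally show ?thesis by (rule JI)
  qed
  obtain d where d: "d > 0" "d dvd p" "\<And>i. i \<in> J \<longleftrightarrow> int d dvd i"
    using additive_subgroup_int[OF pJ p0 addJ] neg JI JE by metis
  have "\<exists>\<phi> :: 'g \<Rightarrow> nat endo. \<phi> 1 = 1 \<and> (\<forall>g\<in>G. \<forall>h\<in>G. \<phi> (g * h) = \<phi> g * \<phi> h) \<and>
    (\<forall>g\<in>G. \<phi> g = 1 \<longleftrightarrow> g \<in> U ` J) \<and> tight_triple (\<phi> a) (\<phi> b) (\<phi> c) d q"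
  proof (rule quotient_triple)
    show "U ` J \<subseteq> G" using U_G by auto
    show "1 \<in> U ` J" using d(3)[of 0] by (intro image_eqI[of _ _ 0]) auto
    show "m * n \<in> U ` J" if "m \<in> U ` J" "n \<in> U ` J" for m n using that addJ by auto
    show "\<exists>m\<in>U ` J. n * m = 1" if n: "n \<in> U ` J" for n
    proof -
      obtain k where "n = U k" "k \<in> J" using n by auto
      then show ?thesis using d(3) by (intro bexI[of _ "U (-k)"]) auto
    qed
    show "a * n * a \<in> U ` J" if "n \<in> U ` J" for n using that d(3) by (auto simp: aU mult.assoc)
    show "b * n * b \<in> U ` J" if "n \<in> U ` J" for n using that d(3) by (auto simp: bU mult.assoc)
    show "c * n * c \<in> U ` J" if n: "n \<in> U ` J" for n
    proof -
      obtain k where k: "n = U k" "k \<in> J" using n by auto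
      obtain m where "m \<in> J" "c * U k = U m * c" using JE[OF k(2)] by auto
      then show ?thesis by (simp add: k(1) mult.assoc)
    qed
    show "U (int d) \<in> U ` J" using d(3) by auto
    show "V (int q) \<in> U ` J" using d(3)[of 0] V_cong[of "int q" 0] by (intro image_eqI[of _ _ 0]) auto
    show "int d dvd i \<and> \<not> e \<and> int q dvd j" if m: "U i * (B e * V j) \<in> U ` J" for i e j
    proof -
      obtain k where k: "U i * (B e * V j) = U k" "k \<in> J" using m by auto
      then have "int p dvd i - k \<and> \<not> e \<and> int q dvd j" using nf_eq[of i e j k False 0] by simp
      moreover have "int d dvd k" using d k by auto
      moreover have "int d dvd int p" using d(2) by simp
      ultimately show ?thesis using dvd_trans[of "int d" "int p" "i - k"] dvd_add[of "int d" "i - k" k] by auto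
    qed
  qed (use d in auto)
  then obtain \<phi> :: "'g \<Rightarrow> nat endo" where \<phi>: "\<phi> 1 = 1" "\<forall>g\<in>G. \<forall>h\<in>G. \<phi> (g * h) = \<phi> g * \<phi> h"
    "\<forall>g\<in>G. \<phi> g = 1 \<longleftrightarrow> g \<in> U ` J" and tt: "tight_triple (\<phi> a) (\<phi> b) (\<phi> c) d q" by blast
  \<comment> \<open>\<open>c\<close> maps the core to itself by an exchange of \<open>k\<close> and
    \<open>m\<close>, and \<open>b\<close> inverts it. In \<open>V 2 = b * c * b * c\<close> each of
    these occurs twice and cancels.\<close>
  have comm: "V 2 * U k = U k * V 2" if k: "k \<in> J" for k
  proof -
    obtain m where m: "c * U k = U m * c" "m \<in> J" using JE k by auto
    have m': "c * U m = U k * c" using arg_cong[OF m(1), of "\<lambda>z. c * z * c"] by (simp add: mult.assoc)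
    have V2: "V 2 = b * (c * (b * c))" using V2 by (simp add: power2_eq_square mult.assoc)
    have "V 2 * U k = b * (c * (b * (c * U k)))" by (simp only: V2 mult.assoc)
    also have "\<dots> = b * (c * (U (-m) * (b * c)))" by (simp only: m bU)
    also have "\<dots> = b * ((c * U (-m)) * (b * c))" by (simp only: mult.assoc)
    also have "\<dots> = U k * V 2" by (simp only: neg[OF m'] V2) (simp add: mult.assoc bU)
    finally show ?thesis .
  qed
  have triv: "U k = 1" if "U (2 * k) = 1" for k
    using that unfolding U_eq_1 by (rule odd_dvd_double[OF odd])
  have "dichotomy a b c q" if di: "dichotomy (\<phi> a) (\<phi> b) (\<phi> c) q"
    using dichotomy_quotient[OF \<phi>(2,1,3) di]
  proof (elim disjE conjE)
    assume "a * V 2 * a * V 2 \<in> U ` J"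
    then obtain k where k: "k \<in> J" "a * V 2 * a * V 2 = U k" by auto
    have "a * V 2 * a = U k * V (-2)" using arg_cong[OF k(2), of "\<lambda>z. z * V (-2)"] by (simp add: mult.assoc)
    \<comment> \<open>The factors \<open>a * V 2 * a\<close> and \<open>V 2\<close> in the other
      order: their product is the conjugate of \<open>U k\<close> by \<open>a\<close>, hence
      \<open>U (-k)\<close>; but it is also the conjugate by \<open>V 2\<close>, hence
      \<open>U k\<close>.\<close>
    then have "V 2 * (a * V 2 * a) = V 2 * U k * V (-2)" by (simp add: mult.assoc)
    also have "\<dots> = U k" by (simp add: comm[OF k(1)] mult.assoc)
    finally have 1: "V 2 * (a * V 2 * a) = U k" .
    have "a * U k * a = V 2 * (a * V 2 * a)" unfolding k(2)[symmetric] by (simp add: mult.assoc)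
    then have inv: "U (-k) = U k" using 1 by (simp add: aU mult.assoc)
    have "U (2 * k) = U k * U k" by (simp only: UU mult_2)
    also have "\<dots> = U (- k) * U k" by (simp only: inv)
    also have "\<dots> = 1" by simp
    finally have "U (2 * k) = 1" .
    then have "U k = 1" by (rule triv)
    with k(2) show ?thesis by (intro dichotomyI1) (simp only:)
  next
    assume q4: "q = 4" and "V (-2) * c * a * V 2 * a \<in> U ` J"
    then obtain k where k: "k \<in> J" "V (-2) * c * a * V 2 * a = U k" by auto
    have eq: "a * V 2 * a = c * V 2 * U k"
      using arg_cong[OF k(2), of "\<lambda>z. c * (V 2 * z)"] by (simp add: mult.assoc)
    have V4: "V 4 = 1" using q4 V_eq_1[of 4] by simp
    have cm: "V 2 * U (-k) = U (-k) * V 2"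
    proof -
      have "V 2 * U (-k) = U (-k) * (U k * V 2) * U (-k)" by (simp add: mult.assoc)
      also have "\<dots> = U (-k) * V 2" unfolding comm[OF k(1), symmetric] by (simp add: mult.assoc)
      finally show ?thesis .
    qed
    \<comment> \<open>\<open>a\<close> inverts \<open>U k\<close> and \<open>V 2\<close> commutes
      with \<open>U (-k)\<close>, so \<open>a * V 2 * a\<close> commutes with \<open>U k\<close>.
      Substituting \<open>eq\<close> shows that \<open>c\<close> does so too.\<close>
    have "a * V 2 * a * U k = a * (V 2 * U (-k)) * a" by (simp add: aU mult.assoc)
    also have "\<dots> = U k * (a * V 2 * a)" unfolding cm by (simp add: aU mult.assoc)
    finally have "c * V 2 * U k * U k * U (-k) * V (-2) = U k * c * (V 2 * U k) * U (-k) * V (-2)"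
      unfolding eq by (simp add: mult.assoc)
    then have "c * (V 2 * U k) * V (-2) = U k * c" by (simp add: mult.assoc)
    then have cU: "c * U k = U k * c" unfolding comm[OF k(1)] by (simp add: mult.assoc)
    \<comment> \<open>Both sides of \<open>eq\<close> are squared. On the left remains
      \<open>a * V 4 * a = 1\<close>. On the right \<open>U k\<close> commutes with the involution
      \<open>c * V 2\<close>, so \<open>U (2 * k)\<close> remains.\<close>
    have "1 = a * V 2 * a * (a * V 2 * a)" by (simp add: mult.assoc V4)
    also have "\<dots> = (c * V 2 * U k) * (c * V 2 * U k)" by (simp only: eq)
    also have "\<dots> = c * (V 2 * U k) * c * (V 2 * U k)" by (simp only: mult.assoc)
    also have "\<dots> = (c * U k) * V 2 * c * V 2 * U k"
      by (subst comm[OF k(1)]) (simp only: mult.assoc)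
    also have "\<dots> = U k * (c * V 2 * c * V 2) * U k" unfolding cU by (simp only: mult.assoc)
    also have "\<dots> = U (2 * k)" by (simp add: mult.assoc cV)
    finally have "U (2 * k) = 1" by (rule sym)
    then have "U k = 1" by (rule triv)
    with eq q4 show ?thesis by (intro dichotomyI2) (simp_all only: mult_1_right)
  qed
  moreover have "d < p" using d k p0 by (metis J_def dvd_imp_le le_neq_implies_less mem_Collect_eq)
  moreover have "odd d" using odd d(2) by auto
  ultimately show ?thesis using tt by blast
qed

text \<open>As \<open>a\<close> normalises the core of \<open>\<langle>bc\<rangle>\<close> and \<open>b\<close> inverts it, \<open>(ab)\<^sup>2\<close> centralises it, and \<open>ab\<close> is a power
  of \<open>(ab)\<^sup>2\<close>.\<close>

lemma core_bc_inverted: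
  assumes odd: "odd p" and k: "a * V k * a \<in> range V"
  shows "a * V k * a = V (-k)"
proof -
  obtain m where m: "a * V k * a = V m" using k by auto
  have m': "a * V m * a = V k" unfolding m[symmetric] by (simp add: mult.assoc)
  have neg: "a * V (-i) * a = V (-j)" if "a * V i * a = V j" for i j
  proof -
    have "V (-j) * (a * V i * a) * (a * V (-i) * a) = a * V (-i) * a" by (simp add: that)
    then show ?thesis by (simp add: mult.assoc)
  qed
  \<comment> \<open>Conjugation by \<open>a * b\<close> is the inversion by \<open>b\<close>
    followed by conjugation by \<open>a\<close>. Applied twice, the sign changes cancel and
    \<open>k\<close>, \<open>m\<close> are exchanged twice.\<close>
  have step: "U 1 * V i = V (-j) * U 1" if "a * V i * a = V j" for i j
  proof -
    have "U 1 * V i = a * V (-i) * b" by (simp add: U1 bV mult.assoc)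
    also have "\<dots> = (a * V (-i) * a) * U 1" by (simp add: U1 mult.assoc)
    finally show ?thesis by (simp add: neg[OF that])
  qed
  have "U 2 * V k = U 1 * (U 1 * V k)" by simp
  also have "\<dots> = (U 1 * V (-m)) * U 1" by (simp only: step[OF m] mult.assoc)
  also have "\<dots> = V k * U 2" by (simp add: step[OF neg[OF m']] mult.assoc)
  finally have 2: "U 2 * V k = V k * U 2" .
  have pow: "U (2 * int t) * V k = V k * U (2 * int t)" for t
  proof (induction t)
    case (Suc t)
    have "U (2 * int (Suc t)) * V k = U 2 * (U (2 * int t) * V k)" by (simp add: algebra_simps)
    also have "\<dots> = (U 2 * V k) * U (2 * int t)" by (simp only: Suc mult.assoc)
    also have "\<dots> = V k * U (2 * int (Suc t))" by (simp add: 2 mult.assoc algebra_simps)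
    finally show ?case .
  qed simp
  obtain t where t: "p = 2 * t + 1" using odd by (rule oddE)
  have "U (2 * int (t + 1)) = U 1" by (rule U_cong) (simp add: t)
  then have "U 1 * V k = V k * U 1" using pow[of "t + 1"] by simp
  then have "V (-m) * U 1 * U (-1) = V k * U 1 * U (-1)" using step[OF m] by simp
  then have "V (-m) = V k" by (simp add: mult.assoc)
  then have "int q dvd - m - k" by (simp add: V_eq_iff)
  then have "int q dvd m - (-k)" using dvd_minus_iff[of "int q" "- m - k"] by (simp add: add.commute)
  then show ?thesis using m V_cong by simp
qed

text \<open>Here lifting is immediate. If the defect in the first alternative is a power of
  \<open>b * c\<close>, then so is \<open>a * V 2 * a\<close>, and \<open>core_bc_inverted\<close>
  makes it \<open>V (-2)\<close>. The second alternative would have \<open>l = 4\<close>, but it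
  also gives \<open>V 4 = 1\<close>, hence \<open>q dvd 4\<close>, against
  \<open>l < q\<close>.\<close>

lemma reduce_core_bc:
  assumes odd: "odd p" and k: "a * V k * a \<in> range V" "\<not> int q dvd k"
  shows "\<exists>(a' :: nat endo) b' c' l. l < q \<and> tight_triple a' b' c' p l \<and>
    (dichotomy a' b' c' l \<longrightarrow> dichotomy a b c q)"
proof -
  define J where "J = {k. a * V k * a \<in> range V}"
  have JE: "a * V k * a = V (-k)" if "k \<in> J" for k
    using that core_bc_inverted[OF odd] by (simp add: J_def)
  have JI: "k \<in> J" if "a * V k * a = V m" for k m
    using that by (simp add: J_def)
  have negJ: "-k \<in> J" if "k \<in> J" for k
  proof -
    have "a * V (-k) * a = a * (a * V k * a) * a" by (simp only: JE[OF that])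
    also have "\<dots> = V k" by (simp add: mult.assoc)
    finally show ?thesis by (rule JI)
  qed
  have qJ: "int q \<in> J" using V_cong[of "int q" 0] by (intro JI[of _ 0]) simp
  have addJ: "i + j \<in> J" if "i \<in> J" "j \<in> J" for i j
  proof -
    have "a * V (i + j) * a = (a * V i * a) * (a * V j * a)" by (simp add: mult.assoc)
    also have "\<dots> = V (-i + -j)" by (simp only: JE that VV)
    finally show ?thesis by (rule JI)
  qed
  obtain l where l: "l > 0" "l dvd q" "\<And>i. i \<in> J \<longleftrightarrow> int l dvd i"
    using additive_subgroup_int[OF qJ q0 addJ negJ] by metis
  have "\<exists>\<phi> :: 'g \<Rightarrow> nat endo. \<phi> 1 = 1 \<and> (\<forall>g\<in>G. \<forall>h\<in>G. \<phi> (g * h) = \<phi> g * \<phi> h) \<and>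
    (\<forall>g\<in>G. \<phi> g = 1 \<longleftrightarrow> g \<in> V ` J) \<and> tight_triple (\<phi> a) (\<phi> b) (\<phi> c) p l"
  proof (rule quotient_triple)
    show "V ` J \<subseteq> G" using V_G by auto
    show "1 \<in> V ` J" using l(3)[of 0] by (intro image_eqI[of _ _ 0]) auto
    show "m * n \<in> V ` J" if "m \<in> V ` J" "n \<in> V ` J" for m n using that addJ by auto
    show "\<exists>m\<in>V ` J. n * m = 1" if n: "n \<in> V ` J" for n
    proof -
      obtain k where "n = V k" "k \<in> J" using n by auto
      then show ?thesis using l(3) by (intro bexI[of _ "V (-k)"]) auto
    qed
    show "a * n * a \<in> V ` J" if "n \<in> V ` J" for n using that JE negJ by auto
    show "b * n * b \<in> V ` J" if "n \<in> V ` J" for n using that negJ by (auto simp: bV mult.assoc)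
    show "c * n * c \<in> V ` J" if "n \<in> V ` J" for n using that negJ by (auto simp: cV mult.assoc)
    show "V (int l) \<in> V ` J" using l(3) by auto
    show "U (int p) \<in> V ` J" using l(3)[of 0] U_cong[of "int p" 0] by (intro image_eqI[of _ _ 0]) auto
    show "int p dvd i \<and> \<not> e \<and> int l dvd j" if m: "U i * (B e * V j) \<in> V ` J" for i e j
    proof -
      obtain k where k: "U i * (B e * V j) = V k" "k \<in> J" using m by auto
      then have "int p dvd i \<and> \<not> e \<and> int q dvd j - k" using nf_eq[of i e j 0 False k] by simp
      moreover have "int l dvd k" using l k by auto
      moreover have "int l dvd int q" using l(2) by simp
      ultimately show ?thesis using dvd_trans[of "int l" "int q" "j - k"] dvd_add[of "int l" "j - k" k] by auto
    qed
  qed (use l in auto)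
  then obtain \<phi> :: "'g \<Rightarrow> nat endo" where \<phi>: "\<phi> 1 = 1" "\<forall>g\<in>G. \<forall>h\<in>G. \<phi> (g * h) = \<phi> g * \<phi> h"
    "\<forall>g\<in>G. \<phi> g = 1 \<longleftrightarrow> g \<in> V ` J" and tt: "tight_triple (\<phi> a) (\<phi> b) (\<phi> c) p l" by blast
  have lq: "l < q" using l k q0 by (metis J_def dvd_imp_le le_neq_implies_less mem_Collect_eq)
  have "dichotomy a b c q" if di: "dichotomy (\<phi> a) (\<phi> b) (\<phi> c) l"
    using dichotomy_quotient[OF \<phi>(2,1,3) di]
  proof (elim disjE conjE)
    assume "a * V 2 * a * V 2 \<in> V ` J"
    then obtain k where k: "k \<in> J" "a * V 2 * a * V 2 = V k" by auto
    have "a * V 2 * a = V (k - 2)" using arg_cong[OF k(2), of "\<lambda>z. z * V (-2)"] by (simp add: mult.assoc)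
    then have "a * V 2 * a = V (-2)" using JE[OF JI] by auto
    then show ?thesis by (intro dichotomyI1) (simp add: mult.assoc)
  next
    assume l4: "l = 4" and "V (-2) * c * a * V 2 * a \<in> V ` J"
    then obtain k where k: "k \<in> J" "V (-2) * c * a * V 2 * a = V k" by auto
    have eq: "a * V 2 * a = c * V (2 + k)"
      using arg_cong[OF k(2), of "\<lambda>z. c * (V 2 * z)"] by (simp add: mult.assoc)
    have "V 4 = a * V 2 * a * (a * V 2 * a)"
    proof -
      have "a * V 4 * a = (a * V 2 * a) * (a * V 2 * a)" by (simp add: mult.assoc)
      also have "\<dots> = 1" unfolding eq by (simp add: cV mult.assoc)
      finally have "a * (a * V 4 * a) * a = 1" by simp
      then have "V 4 = 1" by (simp add: mult.assoc)
      then show ?thesis by (simp add: mult.assoc)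
    qed
    also have "\<dots> = 1" unfolding eq by (simp add: cV mult.assoc)
    finally have "q dvd 4" using V_eq_1[of 4] by (metis int_dvd_int_iff of_nat_numeral)
    then show ?thesis using lq l4 by (auto dest: dvd_imp_le)
  qed
  then show ?thesis using lq tt by blast
qed

text \<open>The exponent of \<open>V\<close> modulo \<open>q\<close> in the normal form of
  \<open>g\<close> labels the coset \<open>D g\<close>, with label 0 for \<open>D\<close> itself.
  The elements \<open>c * U i\<close> for \<open>i < p\<close> have distinct nonzero labels: equal
  labels give \<open>c * U (i - j) * c\<close> in \<open>D\<close>, which forces
  \<open>i = j\<close>.\<close>

lemma p_less_q:
  assumes odd: "odd p" and core: "\<And>k. c * U k * c \<in> range U \<Longrightarrow> int p dvd k" and q: "\<not> q dvd 2"
  shows "p < q"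
proof -
  have "\<exists>j s e. c * U (int i) = U s * (B e * V j) \<and> j \<in> {0..<int q}" for i
  proof -
    obtain s e j where "c * U (int i) = U s * (B e * V j)"
      using closed[of "int i"] unfolding G_def by blast
    moreover have "V j = V (j mod int q)" by (rule V_cong) simp
    ultimately show ?thesis using q0 by (intro exI[of _ "j mod int q"] exI[of _ s] exI[of _ e]) auto
  qed
  then obtain f s e where f: "\<And>i. c * U (int i) = U (s i) * (B (e i) * V (f i))" "\<And>i. f i \<in> {0..<int q}"
    by metis
  \<comment> \<open>If the conjugate is a reflection, its square is 1, so
    \<open>U (2 * k) = 1\<close> and oddness applies; otherwise \<open>U k\<close> is in the
    core.\<close>
  have D: "int p dvd k" if ck: "c * U k * c = U i * B e" for k i e
  proof (cases e)
    case True
    have "U (2 * k) = c * (c * U k * c * (c * U k * c)) * c" by (simp add: mult.assoc)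
    also have "\<dots> = 1" unfolding ck using True by (simp add: mult.assoc bU)
    finally have "int p dvd 2 * k" unfolding U_eq_1 .
    then show ?thesis by (rule odd_dvd_double[OF odd])
  qed (use ck core in auto)
  have inj: "inj_on f {..<p}"
  proof (rule inj_onI)
    fix i j assume ij: "i \<in> {..<p}" "j \<in> {..<p}" "f i = f j"
    have inv: "U (- int j) * c = V (- f j) * (B (e j) * U (- s j))"
    proof -
      have "U (- int j) * c = (U (- int j) * c) * (c * U (int j)) * (V (- f j) * (B (e j) * U (- s j)))"
        unfolding f(1)[of j] by (simp add: mult.assoc)
      then show ?thesis by (simp add: mult.assoc)
    qed
    have "c * U (int i - int j) * c = (c * U (int i)) * (U (- int j) * c)" by (simp add: mult.assoc)
    also have "\<dots> = U (s i) * (B (e i \<noteq> e j) * U (- s j))"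
      unfolding f(1)[of i] inv ij(3) by (simp add: mult.assoc)
    also have "\<exists>t. \<dots> = U (s i + t) * B (e i \<noteq> e j)"
      using BU[of "e i \<noteq> e j" "- s j"] by (metis UU(2) mult.right_neutral)
    finally have "int p dvd int i - int j" using D by blast
    then have "int i mod int p = int j mod int p" by (simp add: mod_eq_dvd_iff)
    then show "i = j" using ij by simp
  qed
  \<comment> \<open>Label 0 would put \<open>c = (c * U i) * U (-i)\<close> into
    \<open>D\<close>.\<close>
  have "f i \<noteq> 0" for i
  proof
    assume 0: "f i = 0"
    have "c = (c * U (int i)) * U (- int i)" by (simp add: mult.assoc)
    also have "\<dots> = U (s i) * (B (e i) * U (- int i))" by (simp add: f 0 mult.assoc)
    also have "\<exists>t. \<dots> = U t * (B (e i) * V 0)"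
      using BU[of "e i" "- int i"] by (metis UU(2) mult.right_neutral V0)
    finally obtain t where "c = U t * (B (e i) * V 0)" by auto
    moreover have "U 0 * (B True * V 1) = c" by (simp add: c_nf[symmetric])
    ultimately have "U 0 * (B True * V 1) = U t * (B (e i) * V 0)" by (simp only:)
    then have "int q dvd 1" unfolding nf_eq by simp
    then show False using q by simp
  qed
  have "f ` {..<p} \<subseteq> {1..<int q}"
  proof (rule image_subsetI)
    show "f i \<in> {1..<int q}" for i using f(2)[of i] \<open>f i \<noteq> 0\<close> by simp
  qed
  then have "card (f ` {..<p}) \<le> card {1..<int q}" by (intro card_mono) auto
  then show ?thesis using q0 by (simp add: card_image[OF inj])
qed

text \<open>The exponent of \<open>U\<close> modulo \<open>p\<close> labels the vertex
  \<open>g E\<close>. The \<open>q\<close> elements \<open>V j * a\<close> represent vertices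
  adjacent to \<open>E\<close>, and label 0 would put \<open>a\<close> into \<open>E\<close>. So
  \<open>q\<close> indices share \<open>p - 1\<close> labels, and two indices with the same vertex
  differ by the required \<open>k\<close>.\<close>

lemma vertex_pigeonhole:
  assumes "p < q" "p > 1"
  obtains k where "\<not> int q dvd k" "a * V k * a \<in> E"
proof -
  have "\<exists>i e t. V (int j) * a = U i * (B e * V t) \<and> i \<in> {0..<int p}" for j
  proof -
    obtain i e t where "V (int j) * a = U i * (B e * V t)"
      using G_mult[OF V_G[of "int j"] a_G] unfolding G_def by blast
    moreover have "U i = U (i mod int p)" by (rule U_cong) simp
    ultimately show ?thesis using p0 by (intro exI[of _ "i mod int p"] exI[of _ e] exI[of _ t]) auto
  qed
  then obtain f e t where f: "\<And>j. V (int j) * a = U (f j) * (B (e j) * V (t j))" "\<And>j. f j \<in> {0..<int p}"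
    by metis
  have "f j \<noteq> 0" for j
  proof
    assume 0: "f j = 0"
    have "a = V (- int j) * (V (int j) * a)" by simp
    also have "\<dots> = V (- int j) * (B (e j) * V (t j))" by (simp add: f 0)
    finally have "a = U 0 * (B (e j) * V ((if e j then - (- int j) else - int j) + t j))"
      unfolding VB VV U0 mult_1_left .
    moreover have "U 1 * (B True * V 0) = a" by (simp add: a_nf[symmetric])
    ultimately have "U 1 * (B True * V 0) = U 0 * (B (e j) * V ((if e j then - (- int j) else - int j) + t j))"
      by (simp only:)
    then have "int p dvd 1" unfolding nf_eq by simp
    then show False using assms by simp
  qed
  have "f ` {..<q} \<subseteq> {1..<int p}"
  proof (rule image_subsetI)
    show "f i \<in> {1..<int p}" for i using f(2)[of i] \<open>f i \<noteq> 0\<close> by simp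
  qed
  then have le: "card (f ` {..<q}) \<le> card {1..<int p}" by (intro card_mono) auto
  have "\<not> inj_on f {..<q}"
  proof
    assume inj: "inj_on f {..<q}"
    have "card (f ` {..<q}) = q" unfolding card_image[OF inj] by simp
    moreover have "card {1..<int p} = p - 1" by simp
    ultimately show False using le assms by linarith
  qed
  then obtain i j where ij: "i < q" "j < q" "i \<noteq> j" "f i = f j" unfolding inj_on_def by blast
  have inv: "a * V (- int i) = V (- t i) * (B (e i) * U (- f i))"
  proof -
    have "a * V (- int i) = (a * V (- int i)) * (V (int i) * a) * (V (- t i) * (B (e i) * U (- f i)))"
      unfolding f(1)[of i] by (simp add: mult.assoc)
    then show ?thesis by (simp add: mult.assoc)
  qed
  have "a * V (int j - int i) * a = (a * V (- int i)) * (V (int j) * a)" by (simp add: mult.assoc)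
  also have "\<dots> = V (- t i) * (B (e i \<noteq> e j) * V (t j))"
    unfolding inv f(1)[of j] ij(4) by (simp add: mult.assoc)
  also have "\<dots> \<in> E" unfolding VB VV by (rule EI)
  finally have "a * V (int j - int i) * a \<in> E" .
  moreover have "\<not> int q dvd int j - int i"
    using ij by (simp add: mod_eq_dvd_iff[symmetric])
  ultimately show ?thesis using that by blast
qed

text \<open>As the core is trivial, \<open>V k\<close> is conjugated by \<open>a\<close> to a
  reflection of \<open>E\<close>, so it is an involution, namely the half turn \<open>z\<close>,
  which commutes with \<open>b\<close> and \<open>c\<close>. The proof identifies the reflection as
  \<open>c * z\<close> and then examines to which generator this is conjugate in
  \<open>E\<close>.\<close>

lemma reflection_case:
  assumes q2: "\<not> q dvd 2" and core: "\<And>k. a * V k * a \<in> range V \<Longrightarrow> int q dvd k"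
    and k: "\<not> int q dvd k" "a * V k * a \<in> E"
  shows "dichotomy a b c q"
proof -
  obtain e m where em: "a * V k * a = B e * V m" using k by (auto simp: E_def)
  have e using em core[of k] k(1) by (cases e) auto
  then have em: "a * V k * a = b * V m" using em by simp
  have "a * V (2 * k) * a = (a * V k * a) * (a * V k * a)" by (simp add: mult.assoc)
  also have "\<dots> = 1" unfolding em by (simp add: Vb mult.assoc)
  finally have "a * (a * V (2 * k) * a) * a = 1" by simp
  then have "V (2 * k) = 1" by (simp add: mult.assoc)
  then have q2k: "int q dvd 2 * k" by (simp add: V_eq_1)
  have "even q" using q2k k(1) odd_dvd_double by blast
  then obtain h where h: "q = 2 * h" by (rule evenE)
  define z where "z = V (int h)"
  \<comment> \<open>\<open>q\<close> divides \<open>2 * k\<close> but not \<open>k\<close>, so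
    \<open>k\<close> is an odd multiple of \<open>h\<close>.\<close>
  have "V k = z" unfolding z_def
  proof (rule V_cong)
    obtain s where "2 * k = int q * s" using q2k by (auto elim: dvdE)
    then have s: "k = int h * s" by (simp add: h)
    then have "odd s" using k(1) h by (auto simp: mult.assoc elim: evenE)
    then obtain r where "s = 2 * r + 1" by (rule oddE)
    then have "k - int h = int q * r" by (simp add: s h algebra_simps)
    then show "int q dvd k - int h" by simp
  qed
  then have azb: "a * z * a = b * V m" using em by simp
  have Vq: "V (i + int q) = V i" for i by (rule V_cong) simp
  have hh: "V (- int h) = z" using Vq[of "- int h"] by (simp add: z_def h)
  have Vh2: "V (2 * int h) = 1" "V (int h + int h) = 1" unfolding V_eq_1 by (simp_all add: h)
  have zz: "z * z = 1" "z * (z * w) = w" for w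
    by (simp_all add: z_def Vh2)
  have zc: "z * c = c * z" "z * b = b * z" by (simp_all add: z_def cV bV hh[unfolded z_def])
  have zct: "z * (c * w) = c * (z * w)" "z * (b * w) = b * (z * w)" for w
    using zc by (simp_all flip: mult.assoc)
  \<comment> \<open>\<open>c\<close> commutes with \<open>a\<close> and \<open>z\<close>, hence with
    \<open>a * z * a = c * V (m - 1)\<close>. Since \<open>c\<close> inverts powers of
    \<open>b * c\<close>, the factor \<open>V (m - 1)\<close> is 1 or \<open>z\<close>. The value 1
    would give \<open>a * z * a = c\<close> and then \<open>z = c\<close>.\<close>
  have azc: "a * z * a = c * z"
  proof -
    have 1: "b * V m = c * V (m - 1)" by (simp add: cV_nf)
    have "c * (a * z * a) * c = (c * a) * z * (a * c)" by (simp only: mult.assoc)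
    also have "\<dots> = (a * c) * z * (c * a)"
      by (rule arg_cong2[where f = "\<lambda>u v. u * z * v", OF ac[symmetric] ac])
    also have "\<dots> = a * (c * z * c) * a" by (simp only: mult.assoc)
    also have "\<dots> = a * z * a" by (simp add: zc(1)[symmetric] mult.assoc)
    finally have "V (m - 1) * c * c = c * V (m - 1) * c" unfolding azb 1 by (simp add: mult.assoc)
    then have "V (m - 1) = V (1 - m)" by (simp add: cV mult.assoc)
    then have "int q dvd 2 * (m - 1)" by (simp add: V_eq_iff algebra_simps)
    then have "2 * int h dvd 2 * (m - 1)" by (simp only: h of_nat_mult of_nat_numeral)
    then have hm: "int h dvd m - 1" by (simp only: dvd_mult_cancel_left) simp
    have "\<not> int q dvd m - 1"
    proof
      assume "int q dvd m - 1"
      then have "V (m - 1) = 1" by (simp add: V_eq_1)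
      then have "a * z * a = c" using azb 1 by simp
      then have "z = a * c * a" by (metis aa'(1) mult.assoc mult_1_left mult.right_neutral)
      then have "z = c" by (simp add: aca mult.assoc)
      then have "B True * V 1 = B False * V (int h)" by (simp add: z_def V1 mult.assoc)
      then show False unfolding E_eq_iff by simp
    qed
    then have "V (m - 1) = z" unfolding z_def
    proof (intro V_cong)
      assume nq: "\<not> int q dvd m - 1"
      obtain s where s: "m - 1 = int h * s" using hm by (auto elim: dvdE)
      then have "odd s" using nq h by (auto simp: mult.assoc elim: evenE)
      then obtain r where "s = 2 * r + 1" by (rule oddE)
      then have "m - 1 - int h = int q * r" by (simp add: s h algebra_simps)
      then show "int q dvd m - 1 - int h" by simp
    qed
    then show ?thesis using azb 1 by simp
  qed
  \<comment> \<open>In the dihedral group \<open>E\<close> the reflection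
    \<open>c * z = b * V (1 + h)\<close> is conjugate, by a power \<open>V t\<close>, to
    \<open>b\<close> if \<open>h\<close> is odd and to \<open>c\<close> if \<open>h\<close> is
    even.\<close>
  show ?thesis
  proof (cases "even h")
    case False
    then obtain t0 where t0: "h = 2 * t0 + 1" by (rule oddE)
    define t where "t = int t0 + 1"
    have "c * z = b * V (1 + int h)" by (simp add: z_def cV_nf add.commute)
    also have "1 + int h = 2 * t" by (simp add: t_def t0)
    finally have aza: "a * z * a = b * V (2 * t)" using azc by simp
    obtain i e s where g: "V t * a = U i * (B e * V s)" using G_mult[OF V_G[of "t"] a_G] unfolding G_def by blast
    have g': "a * V (- t) = V (- s) * (B e * U (- i))"
    proof -
      have "a * V (- t) = (a * V (- t)) * (V t * a) * (V (- s) * (B e * U (- i)))"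
        unfolding g by (simp add: mult.assoc)
      then show ?thesis by (simp add: mult.assoc)
    qed
    \<comment> \<open>\<open>z\<close> is a conjugate of \<open>b\<close> by
      \<open>U i * (B e * V s)\<close>. The factor \<open>V s\<close> disappears because it commutes
      with \<open>z\<close>, so the rotation \<open>z\<close> of \<open>E\<close> would be a
      reflection of \<open>D\<close>, against uniqueness of normal forms.\<close>
    have "z = a * (a * z * a) * a" by (simp add: mult.assoc)
    also have "\<dots> = (a * V (- t)) * b * (V t * a)" unfolding aza by (simp add: mult.assoc Vb)
    also have "\<dots> = V (- s) * (B e * (U (- i) * (b * (U i * (B e * V s)))))"
      unfolding g g' by (simp add: mult.assoc)
    finally have "V s * z * V (- s) = B e * (U (- i) * (b * (U i * B e)))" by (simp add: mult.assoc)
    then have "z = B e * (U (- 2 * i) * b * B e)" by (simp add: z_def bU mult.assoc)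
    also have "\<dots> = U (if e then 2 * i else - 2 * i) * b" by (cases e) (simp_all add: bU mult.assoc)
    finally have "U 0 * (B False * V (int h)) = U (if e then 2 * i else - 2 * i) * (B True * V 0)"
      by (simp add: z_def)
    then show ?thesis unfolding nf_eq by simp
  next
    case True
    then obtain t where t: "h = 2 * t" by (rule evenE)
    have "c * z = b * V (1 + 2 * int t)" by (simp add: z_def cV_nf t add.commute)
    then have "V (int t) * (a * z * a) * V (- int t) = V (int t) * (b * V (1 + 2 * int t)) * V (- int t)"
      by (simp only: azc)
    also have "\<dots> = c" by (simp add: Vb c_nf[symmetric] mult.assoc)
    finally have cz: "(V (int t) * a) * z * (a * V (- int t)) = c" by (simp only: mult.assoc)
    obtain i e s where g: "V (int t) * a = U i * (B e * V s)" using G_mult[OF V_G[of "int t"] a_G] unfolding G_def by blast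
    have g': "a * V (- int t) = V (- s) * (B e * U (- i))"
    proof -
      have "a * V (- int t) = (a * V (- int t)) * (V (int t) * a) * (V (- s) * (B e * U (- i)))"
        unfolding g by (simp add: mult.assoc)
      then show ?thesis by (simp add: mult.assoc)
    qed
    have zB: "B e * z = z * B e" by (cases e) (simp_all add: zc)
    have "U i * z * U (- i) = U i * (B e * z) * (B e * U (- i))" unfolding zB by (simp add: mult.assoc)
    also have "\<dots> = (V (int t) * a) * z * (a * V (- int t))" unfolding g g' by (simp add: z_def mult.assoc)
    also have "\<dots> = c" by (rule cz)
    \<comment> \<open>The rest establishes that conjugation by \<open>U i\<close> takes
      \<open>z\<close> to \<open>c\<close>, \<open>c\<close> to \<open>c * z\<close> and
      \<open>c * z\<close> to \<open>z\<close>. The comparison of \<open>i\<close> with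
      \<open>1 - i\<close> comes from conjugating this equation by \<open>a\<close>, which fixes
      \<open>c\<close> and inverts \<open>U i\<close>.\<close>
    finally have c: "U i * z * U (- i) = c" .
    have U1z: "U 1 * z * U (-1) = a * z * a" by (simp add: U1 Um1 zct mult.assoc)
    have "U i * z * U (- i) = a * (U i * z * U (- i)) * a" unfolding c by (simp add: aca mult.assoc)
    also have "\<dots> = U (- i) * (a * z * a) * U i" by (simp add: aU mult.assoc)
    also have "\<dots> = U (1 - i) * z * U (i - 1)" unfolding U1z[symmetric] by (simp add: mult.assoc)
    finally have i1: "U i * z * U (- i) = U (1 - i) * z * U (i - 1)" .
    have "U i * (U i * z * U (- i)) * U (- i) = U 1 * z * U (- 1)" unfolding i1 by (simp add: mult.assoc)
    then have Ucz: "U i * c * U (- i) = c * z" by (simp only: c U1z azc)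
    have "U i * (c * z) * U (- i) = (U i * c * U (- i)) * (U i * z * U (- i))" by (simp add: mult.assoc)
    also have "\<dots> = z" unfolding Ucz c by (simp add: mult.assoc zc)
    finally have "U (- i) * (U i * (c * z) * U (- i)) * U i = U (- i) * z * U i" by (simp only:)
    then have Uz: "U (- i) * z * U i = c * z" by (simp add: mult.assoc)
    \<comment> \<open>\<open>b\<close> inverts \<open>U i\<close> and fixes \<open>z\<close>, so it
      takes \<open>c\<close> to the image of \<open>z\<close> under the inverse of the 3-cycle,
      which is \<open>c * z\<close>.\<close>
    have "b * (U i * z * U (- i)) * b = U (- i) * z * U i" by (simp add: Ub zct mult.assoc)
    then have "b * c * b = c * z" by (simp only: c Uz)
    then have "b * c * b * c = c * z * c" by (simp only:)
    then have V2z: "V 2 = z" by (simp add: V2[symmetric] power2_eq_square mult.assoc zc)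
    then have "int q dvd 2 - int h" unfolding z_def V_eq_iff .
    then have dvd: "int q dvd int h - 2" by (simp only: dvd_diff_commute)
    have "h \<noteq> 0" using h q0 by simp
    then have "h \<ge> 2" using t by simp
    moreover have "\<not> h > 2" using zdvd_imp_le[OF dvd] h by auto
    ultimately have "q = 4" using h by simp
    then show ?thesis by (rule dichotomyI2) (simp only: V2z azc)
  qed
qed

lemma dichotomy_step:
  assumes odd: "odd p"
  shows "dichotomy a b c q \<or> (\<exists>(a' :: nat endo) b' c' d l. d * l < p * q \<and> odd d \<and> tight_triple a' b' c' d l \<and>
    (dichotomy a' b' c' l \<longrightarrow> dichotomy a b c q))"
proof (cases "p = 1 \<or> q dvd 2")
  case True
  then show ?thesis
  proof
    assume "p = 1"
    then have "a * b = 1" using xp by simp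
    then have "a = b" by (metis bb' mult.assoc mult_1_left mult.right_neutral)
    then have "a * V 2 * a * V 2 = 1" using bV(1)[of 2] by (simp add: mult.assoc)
    then show ?thesis by (intro disjI1 dichotomyI1) (simp add: mult.assoc)
  next
    assume "q dvd 2"
    then have "V 2 = 1" using V_eq_1[of 2] by (metis int_dvd_int_iff of_nat_numeral)
    then show ?thesis by (intro disjI1 dichotomyI1) (simp add: mult.assoc)
  qed
next
  case False
  show ?thesis
  proof (cases "\<exists>k. c * U k * c \<in> range U \<and> \<not> int p dvd k")
    case True
    then show ?thesis using reduce_core_ab[OF odd] q0 by (meson mult_less_mono1)
  next
    case no_core: False
    then have "p < q" using p_less_q[OF odd] False by blast
    moreover have "p > 1" using False p0 by auto
    ultimately obtain k where k: "\<not> int q dvd k" "a * V k * a \<in> E" using vertex_pigeonhole by blast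
    show ?thesis
    proof (cases "\<exists>k. a * V k * a \<in> range V \<and> \<not> int q dvd k")
      case True
      then show ?thesis using reduce_core_bc[OF odd] p0 odd by (meson mult_less_mono2)
    next
      case no: False
      then show ?thesis using reflection_case k False by blast
    qed
  qed
qed

end

text \<open>An induction hypothesis cannot change its type. \<open>dichotomy_step\<close> goes from
  any type to \<open>nat endo\<close>, and all later quotients stay there; the measure
  \<open>p * q\<close> drops in both reductions.\<close>

lemma dichotomy_endo:
  fixes a b c :: "nat endo"
  assumes "tight_triple a b c p q" "odd p"
  shows "dichotomy a b c q"
  using assms
proof (induction "p * q" arbitrary: a b c p q rule: less_induct)
  case less
  then show ?case using tight_triple.dichotomy_step[OF less.prems] by blast
qed

theorem (in tight_triple) dichotomy: "odd p \<Longrightarrow> dichotomy a b c q"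
  using dichotomy_step dichotomy_endo by blast

section \<open>Normal forms and rotations\<close>

text \<open>Left multiplications alone already give the generated subgroup, since
  \<open>a * b\<close> and \<open>b * c\<close> have finite order.\<close>

inductive_set rotations :: "'g::monoid_mult \<Rightarrow> 'g \<Rightarrow> 'g \<Rightarrow> 'g set" for a b c where
  one: "1 \<in> rotations a b c"
| ab: "h \<in> rotations a b c \<Longrightarrow> a * b * h \<in> rotations a b c"
| bc: "h \<in> rotations a b c \<Longrightarrow> b * c * h \<in> rotations a b c"

section \<open>Reversal of the generators and the two multiplication laws\<close>

context coxeter_pair begin

lemma rotations_U: "h \<in> rotations a b c \<Longrightarrow> U i * h \<in> rotations a b c"
proof -
  assume h: "h \<in> rotations a b c"
  have "(a * b) ^ n * h \<in> rotations a b c" for n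
    by (induction n) (use h rotations.ab in \<open>auto simp: mult.assoc\<close>)
  then show ?thesis by (simp add: U_def zp_def)
qed

lemma rotations_V: "h \<in> rotations a b c \<Longrightarrow> V i * h \<in> rotations a b c"
proof -
  assume h: "h \<in> rotations a b c"
  have "(b * c) ^ n * h \<in> rotations a b c" for n
    by (induction n) (use h rotations.bc in \<open>auto simp: mult.assoc\<close>)
  then show ?thesis by (simp add: V_def zp_def)
qed

lemma rotations_mult: "g \<in> rotations a b c \<Longrightarrow> h \<in> rotations a b c \<Longrightarrow> g * h \<in> rotations a b c"
  by (induction g rule: rotations.induct) (auto simp: mult.assoc intro: rotations.intros(2,3)[unfolded mult.assoc])

lemma rotations_rev_subset: "rotations c b a \<subseteq> rotations a b c"
proof
  fix h assume "h \<in> rotations c b a"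
  then show "h \<in> rotations a b c"
    by induction (use rotations_U[of _ "-1"] rotations_V[of _ "-1"] in \<open>auto simp: Um1 Vm1 intro: rotations.one\<close>)
qed

lemma coxeter_pair_rev: "coxeter_pair c b a q p"
proof
  have "zp (a * b) p (-1) ^ p = (1 :: 'g)"
  proof -
    have "U (-1) ^ n = U (- int n)" for n
      by (induction n) (simp_all add: algebra_simps)
    then show ?thesis using U_cong[of "- int p" 0] by (simp add: U_def[symmetric])
  qed
  then show "(b * a) ^ p = 1" by (simp add: U_def[symmetric] Um1)
  have "zp (b * c) q (-1) ^ q = (1 :: 'g)"
  proof -
    have "V (-1) ^ n = V (- int n)" for n
      by (induction n) (simp_all add: algebra_simps)
    then show ?thesis using V_cong[of "- int q" 0] by (simp add: V_def[symmetric])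
  qed
  then show "(c * b) ^ q = 1" by (simp add: V_def[symmetric] Vm1)
qed (use ac p0 q0 in auto)

lemma rotations_rev: "rotations c b a = rotations a b c"
  using rotations_rev_subset coxeter_pair.rotations_rev_subset[OF coxeter_pair_rev] by blast

lemma U_rev: "coxeter_pair.U c b q i = V (- i)"
proof -
  interpret R: coxeter_pair c b a q p by (rule coxeter_pair_rev)
  have "R.U (int n) = V (- int n)" for n
  proof (induction n)
    case (Suc n)
    have "R.U (int (Suc n)) = R.U 1 * R.U (int n)" by (simp add: algebra_simps)
    also have "\<dots> = V (-1) * V (- int n)" by (simp only: Suc R.U1 Vm1)
    finally show ?case by (simp add: algebra_simps)
  qed simp
  from this[of "nat (i mod int q)"] have "R.U (i mod int q) = V (- (i mod int q))" using q0 by simp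
  moreover have "R.U i = R.U (i mod int q)" by (rule R.U_cong) simp
  moreover have "V (- i) = V (- (i mod int q))"
    by (rule V_cong) (unfold mod_eq_dvd_iff[symmetric], simp add: mod_minus_eq)
  ultimately show ?thesis by simp
qed

lemma V_rev: "coxeter_pair.V b a p i = U (- i)"
proof -
  interpret R: coxeter_pair c b a q p by (rule coxeter_pair_rev)
  have "R.V i = U (- i)" using R.U_rev[of "- i"] by simp
  then show ?thesis .
qed

text \<open>Left multiplication by \<open>a\<close> and \<open>b\<close> on normal forms only depends on \<open>p\<close>, so the exponents \<open>\<epsilon>\<close> and \<open>\<tau>\<close>
  determine the group up to isomorphism.\<close>

definition law :: "(nat \<Rightarrow> bool) \<Rightarrow> (nat \<Rightarrow> int) \<Rightarrow> bool" where
  "law \<epsilon> \<tau> \<longleftrightarrow> (\<forall>n. c * U (int n) = U (int n) * (B (\<epsilon> n) * V (\<tau> n)))"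

lemma U_nat: obtains n where "U i = U (int n)"
proof
  show "U i = U (int (nat (i mod int p)))" by (rule U_cong) (use p0 in simp)
qed

lemma mult_nf:
  assumes "law \<epsilon> \<tau>"
  shows "a * (U i * (B e * V j)) = U (1 - i) * (B (\<not> e) * V j)"
    and "b * (U i * (B e * V j)) = U (- i) * (B (\<not> e) * V j)"
    and "c * (U (int n) * (B e * V j)) = U (int n) * (B (\<epsilon> n \<noteq> e) * V ((if e then - \<tau> n else \<tau> n) + j))"
proof -
  show b: "b * (U i * (B e * V j)) = U (- i) * (B (\<not> e) * V j)" for i by (simp add: bU)
  have "a * (U i * (B e * V j)) = U 1 * (b * (U i * (B e * V j)))" by (simp add: U1 mult.assoc)
  then show "a * (U i * (B e * V j)) = U (1 - i) * (B (\<not> e) * V j)" unfolding b by simp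
  have "c * (U (int n) * (B e * V j)) = (c * U (int n)) * (B e * V j)" by (simp only: mult.assoc)
  also have "\<dots> = U (int n) * (B (\<epsilon> n) * (V (\<tau> n) * (B e * V j)))"
    using assms by (simp add: law_def mult.assoc)
  finally show "c * (U (int n) * (B e * V j)) = U (int n) * (B (\<epsilon> n \<noteq> e) * V ((if e then - \<tau> n else \<tau> n) + j))"
    unfolding VB by simp
qed

text \<open>\<open>a\<close> and \<open>b\<close> both invert \<open>V 2\<close>, so
  \<open>U 1\<close> commutes with it. Commutation of \<open>a\<close> and \<open>c\<close> reads
  \<open>c * U 1 = U 1 * V 2 * c\<close>, and iterating this collects
  \<open>V (2 * n)\<close>.\<close>

lemma orientable_law:
  assumes di: "a * V 2 * a * V 2 = 1"
  shows "law (\<lambda>_. True) (\<lambda>n. 1 - 2 * int n)" "a * V (2 * int n) * a = V (- 2 * int n)"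
    "c * U (int n) = U (int n) * V (2 * int n) * c"
proof -
  have aV: "a * V 2 * a = V (-2)"
    using arg_cong[OF di, of "\<lambda>z. z * V (-2)"] by (simp add: mult.assoc)
  have aV': "a * V (-2) * a = V 2" unfolding aV[symmetric] by (simp add: mult.assoc)
  have aVn: "a * V (2 * int n) * a = V (- 2 * int n)" for n
  proof (induction n)
    case (Suc n)
    have "a * V (2 * int (Suc n)) * a = (a * V 2 * a) * (a * V (2 * int n) * a)"
      by (simp add: mult.assoc algebra_simps)
    then show ?case unfolding aV Suc by (simp add: algebra_simps)
  qed simp
  have UV: "U 1 * V 2 = V 2 * U 1"
  proof -
    have "U 1 * V 2 = (a * V (-2) * a) * (a * b)" by (simp add: U1 bV mult.assoc)
    then show ?thesis by (simp only: aV' U1)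
  qed
  have UnV: "U (int n) * V 2 = V 2 * U (int n)" for n
  proof (induction n)
    case (Suc n)
    have "U (int (Suc n)) * V 2 = U 1 * (U (int n) * V 2)" by (simp add: mult.assoc)
    also have "\<dots> = (U 1 * V 2) * U (int n)" by (simp only: Suc mult.assoc)
    also have "\<dots> = V 2 * U (int (Suc n))" by (simp add: UV mult.assoc)
    finally show ?case .
  qed simp
  have cU1: "c * U 1 = U 1 * V 2 * c"
  proof -
    have "c * U 1 = (c * a) * b" by (simp only: U1 mult.assoc)
    also have "\<dots> = (a * c) * b" by (simp only: ac[symmetric])
    also have "\<dots> = U 1 * V 2 * c" by (simp add: U1 V2[symmetric] power2_eq_square mult.assoc)
    finally show ?thesis .
  qed
  have cUn: "c * U (int n) = U (int n) * V (2 * int n) * c" for n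
  proof (induction n)
    case (Suc n)
    have "c * U (int (Suc n)) = (c * U 1) * U (int n)" by (simp add: mult.assoc)
    also have "\<dots> = U 1 * V 2 * (c * U (int n))" unfolding cU1 by (simp only: mult.assoc)
    also have "\<dots> = U 1 * (V 2 * U (int n)) * V (2 * int n) * c" unfolding Suc by (simp only: mult.assoc)
    also have "\<dots> = U (int (Suc n)) * V (2 * int (Suc n)) * c"
      unfolding UnV[symmetric] by (simp add: mult.assoc algebra_simps)
    finally show ?case .
  qed simp
  have Vc: "V i * c = b * V (1 - i)" for i
  proof -
    have "V i * c = V i * (b * V 1)" by (simp only: c_nf[symmetric])
    then show ?thesis by (simp add: Vb)
  qed
  show "law (\<lambda>_. True) (\<lambda>n. 1 - 2 * int n)"
    unfolding law_def by (simp add: cUn Vc mult.assoc)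
  show "a * V (2 * int n) * a = V (- 2 * int n)" "c * U (int n) = U (int n) * V (2 * int n) * c"
    by (rule aVn, rule cUn)
qed

text \<open>With \<open>z = V 2\<close>, the elements 1, \<open>z\<close>, \<open>c\<close>,
  \<open>c * z\<close> form a Klein four-group that \<open>U 1\<close> normalises, permuting the
  involutions in a 3-cycle. Since \<open>c * U n = U n * w n\<close>, the element \<open>w n\<close>
  is a conjugate of \<open>c\<close>, which explains the period 3. The second equation expresses
  \<open>c\<close> by rotations.\<close>

lemma nonorientable_law:
  assumes q4: "q = 4" and di: "a * V 2 * a = c * V 2"
  shows "law (\<lambda>n. n mod 3 \<noteq> 2) (\<lambda>n. if n mod 3 = 0 then 1 else if n mod 3 = 1 then 3 else 2)"
    "U 1 * V 2 * U (-1) * V 2 = c"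
proof -
  define z where "z = V 2"
  have "V 4 = V 0" by (rule V_cong) (simp add: q4)
  then have V4: "V 4 = 1" unfolding V0 .
  have zz: "z * z = 1" "z * (z * w) = w" for w
    by (simp_all add: z_def V4)
  have V_2: "V (-2) = z" unfolding z_def by (rule V_cong) (simp add: q4)
  have zc: "z * c = c * z" "z * (c * w) = c * (z * w)" "z * b = b * z" "z * (b * w) = b * (z * w)" for w
    using cV[of "2"] bV[of 2] unfolding V_2 by (simp_all add: z_def[symmetric] flip: mult.assoc)
  have az: "a * z * a = c * z" using di by (simp add: z_def)
  have bcb: "b * c * b = c * z"
  proof -
    have "b * c * b = V 1 * b" by (simp add: V1)
    also have "\<dots> = b * V (-1)" by (simp add: Vb)
    also have "V (-1) = V 3" by (rule V_cong) (simp add: q4)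
    also have "b * V 3 = c * V 2" by (simp add: cV_nf)
    finally show ?thesis by (simp add: z_def)
  qed
  have za: "a * z = c * (z * a)"
  proof -
    have "a * z = (a * z * a) * a" by (simp add: mult.assoc)
    also have "\<dots> = (c * z) * a" by (simp only: az)
    finally show ?thesis by (simp only: mult.assoc)
  qed
  have U1c: "U 1 * c = z * U 1"
  proof -
    have "U 1 * c = a * (b * c * b) * b" by (simp add: U1 mult.assoc)
    also have "\<dots> = (a * c) * z * b" unfolding bcb by (simp only: mult.assoc)
    also have "\<dots> = c * (a * z) * b" by (simp only: ac[symmetric] mult.assoc) (simp only: ac mult.assoc[symmetric])
    also have "\<dots> = z * U 1" unfolding za by (simp add: U1 mult.assoc)
    finally show ?thesis .
  qed
  have U1z: "U 1 * z = c * z * U 1"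
  proof -
    have "U 1 * z = (a * z) * b" by (simp add: U1 zc mult.assoc)
    then show ?thesis unfolding za by (simp add: U1 mult.assoc)
  qed
  have cU: "c * U 1 = U 1 * (c * z)"
  proof -
    have "U 1 * (c * z) = z * (U 1 * z)" using U1c by (simp flip: mult.assoc)
    then show ?thesis unfolding U1z by (simp add: zc zz mult.assoc)
  qed
  define w where "w n = (if n mod 3 = 0 then c else if n mod 3 = 1 then c * z else z)" for n :: nat
  have w1: "w n * U 1 = U 1 * w (Suc n)" for n
  proof -
    have "c * z * U 1 = U 1 * z" by (rule U1z[symmetric])
    then show ?thesis using cU U1c by (auto simp: w_def mod_Suc)
  qed
  have cUn: "c * U (int n) = U (int n) * w n" for n
  proof (induction n)
    case (Suc n)
    have "c * U (int (Suc n)) = (c * U (int n)) * U 1" by (simp add: mult.assoc add.commute)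
    also have "\<dots> = U (int n) * (w n * U 1)" by (simp only: Suc mult.assoc)
    also have "\<dots> = U (int (Suc n)) * w (Suc n)" by (simp add: w1 add.commute)
    finally show ?case .
  qed (simp add: w_def)
  have w_nf: "w n = B (n mod 3 \<noteq> 2) * V (if n mod 3 = 0 then 1 else if n mod 3 = 1 then 3 else 2)" for n
  proof -
    have "n mod 3 < 3" by simp
    then consider "n mod 3 = 0" | "n mod 3 = 1" | "n mod 3 = 2" by linarith
    then show ?thesis by cases (simp_all add: w_def z_def cV_nf c_nf[symmetric])
  qed
  show "law (\<lambda>n. n mod 3 \<noteq> 2) (\<lambda>n. if n mod 3 = 0 then 1 else if n mod 3 = 1 then 3 else 2)"
    unfolding law_def by (simp only: cUn w_nf simp_thms)
  show "U 1 * V 2 * U (-1) * V 2 = c" using U1z by (simp add: mult.assoc zz flip: z_def)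
qed

end

section \<open>The reversed triple\<close>

context tight_triple begin

text \<open>Inverting a normal form reverses its factors, and \<open>G\<close> is closed under
  inverses.\<close>

lemma G_rev: "g \<in> G \<Longrightarrow> \<exists>i e j. g = V i * (B e * U j)"
proof -
  assume "g \<in> G"
  then obtain h where h: "h \<in> G" "g * h = 1" "h * g = 1" using G_inv by blast
  obtain i e j where ij: "h = U i * (B e * V j)" using h(1) by (auto simp: G_def)
  have "g = g * (h * (V (-j) * (B e * U (-i))))" by (simp add: ij mult.assoc)
  also have "\<dots> = (g * h) * (V (-j) * (B e * U (-i)))" by (simp only: mult.assoc)
  finally show ?thesis unfolding h(2) by auto
qed

lemma tight_triple_rev: "tight_triple c b a q p"
proof -
  interpret R: coxeter_pair c b a q p by (rule coxeter_pair_rev)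
  show ?thesis
  proof
    fix i e j
    assume "R.U i * (R.B e * R.V j) = 1"
    then have eq: "V (-i) * (B e * U (-j)) = 1" by (simp add: U_rev V_rev)
    have "U j * (B e * V i) = U j * (B e * V i) * (V (-i) * (B e * U (-j)))" by (simp add: eq)
    also have "\<dots> = 1" by (simp add: mult.assoc)
    finally show "int q dvd i \<and> \<not> e \<and> int p dvd j" using distinct by blast
  next
    fix i
    have "a * R.U i \<in> G" by (simp add: U_rev G_a V_G)
    then obtain k e j where "a * R.U i = V k * (B e * U j)" using G_rev by blast
    then have "a * R.U i = R.U (-k) * (R.B e * R.V (-j))" by (simp add: U_rev V_rev)
    then show "a * R.U i \<in> R.G" by auto
  qed
qed

lemma G_rev_eq: "coxeter_pair.G c b a q p = G"
proof -
  interpret R: tight_triple c b a q p by (rule tight_triple_rev)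
  show ?thesis
  proof
    show "G \<subseteq> R.G"
    proof
      fix g assume "g \<in> G"
      then obtain k e j where "g = V k * (B e * U j)" using G_rev by blast
      then have "g = R.U (-k) * (R.B e * R.V (-j))" by (simp add: U_rev V_rev)
      then show "g \<in> R.G" by auto
    qed
    show "R.G \<subseteq> G"
      by (auto simp: R.G_def U_rev V_rev intro!: G_mult U_G V_G B_G)
  qed
qed

end

text \<open>Multiplicativity of \<open>\<theta>\<close> follows, as \<open>a\<close>, \<open>b\<close> and \<open>c\<close> generate.\<close>

definition cayley_iso ::
  "'g::monoid_mult set \<Rightarrow> 'g \<Rightarrow> 'g \<Rightarrow> 'g \<Rightarrow> 'h::monoid_mult set \<Rightarrow> 'h \<Rightarrow> 'h \<Rightarrow> 'h \<Rightarrow> ('g \<Rightarrow> 'h) \<Rightarrow> bool" where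
  "cayley_iso G a b c G' a' b' c' \<theta> \<longleftrightarrow> bij_betw \<theta> G G' \<and> \<theta> 1 = 1 \<and>
    (\<forall>g\<in>G. \<theta> (a * g) = a' * \<theta> g \<and> \<theta> (b * g) = b' * \<theta> g \<and> \<theta> (c * g) = c' * \<theta> g)"

text \<open>When two normal forms are equal depends only on \<open>p\<close> and \<open>q\<close>,
  so matching them is a well-defined bijection. By \<open>mult_nf\<close> the generators act on both
  sides by the same formulas.\<close>

lemma law_cayley_iso:
  fixes a b c :: "'g::monoid_mult" and a' b' c' :: "'h::monoid_mult"
  assumes "tight_triple a b c p q" "coxeter_pair.law a b c p q \<epsilon> \<tau>"
    and "tight_triple a' b' c' p q" "coxeter_pair.law a' b' c' p q \<epsilon> \<tau>"
  shows "\<exists>\<theta>. cayley_iso (coxeter_pair.G a b c p q) a b c (coxeter_pair.G a' b' c' p q) a' b' c' \<theta>"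
proof -
  interpret L: tight_triple a b c p q by fact
  interpret R: tight_triple a' b' c' p q by fact
  have "\<exists>y. \<forall>i e j. x = L.U i * (L.B e * L.V j) \<longrightarrow> y = R.U i * (R.B e * R.V j)" for x
  proof (cases "x \<in> L.G")
    case True
    then obtain i e j where x: "x = L.U i * (L.B e * L.V j)" by (auto simp: L.G_def)
    show ?thesis
      by (rule exI[of _ "R.U i * (R.B e * R.V j)"]) (simp add: x L.nf_eq R.nf_eq)
  next
    case False
    then show ?thesis using L.GI by blast
  qed
  then obtain \<theta> where \<theta>: "\<And>i e j. \<theta> (L.U i * (L.B e * L.V j)) = R.U i * (R.B e * R.V j)" by metis
  have "bij_betw \<theta> L.G R.G"
    unfolding bij_betw_def
  proof
    show "inj_on \<theta> L.G" by (rule inj_onI) (auto simp: L.G_def \<theta> L.nf_eq R.nf_eq)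
    show "\<theta> ` L.G = R.G"
    proof
      show "\<theta> ` L.G \<subseteq> R.G" by (auto simp: L.G_def \<theta>)
      show "R.G \<subseteq> \<theta> ` L.G" unfolding R.G_def using L.GI by (auto simp flip: \<theta>)
    qed
  qed
  moreover have "\<theta> 1 = 1" using \<theta>[of 0 False 0] by simp
  moreover have "\<theta> (a * g) = a' * \<theta> g \<and> \<theta> (b * g) = b' * \<theta> g \<and> \<theta> (c * g) = c' * \<theta> g" if "g \<in> L.G" for g
  proof -
    obtain i e j where g: "g = L.U i * (L.B e * L.V j)" using \<open>g \<in> L.G\<close> by (auto simp: L.G_def)
    obtain n where n: "L.U i = L.U (int n)" by (rule L.U_nat)
    show ?thesis unfolding g n \<theta> L.mult_nf[OF assms(2)] R.mult_nf[OF assms(4)] by simp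
  qed
  ultimately show ?thesis unfolding cayley_iso_def by blast
qed

section \<open>Arithmetic conditions and rotation subgroups\<close>

context tight_triple begin

lemma orientable_case:
  assumes odd: "odd p" and p2: "p \<ge> 2" and di: "a * V 2 * a * V 2 = 1"
  shows "even q" "q dvd 2 * p" "law (\<lambda>_. True) (\<lambda>n. 1 - 2 * int n)" "card (rotations a b c) = p * q"
proof -
  note aVn = orientable_law(2)[OF di] and cUn = orientable_law(3)[OF di]
  show law: "law (\<lambda>_. True) (\<lambda>n. 1 - 2 * int n)" by (rule orientable_law(1)[OF di])
  have Vc: "V i * c = b * V (1 - i)" for i
  proof -
    have "V i * c = V i * (b * V 1)" by (simp only: c_nf[symmetric])
    then show ?thesis by (simp add: Vb)
  qed
  have Up: "U (int p) = 1" using U_cong[of "int p" 0] by simp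
  have "V (2 * int p) * c * c = c * c" using cUn[of p] unfolding Up by simp
  then have "V (2 * int p) = 1" by (simp add: mult.assoc)
  then have "int q dvd int (2 * p)" by (simp add: V_eq_1)
  then show "q dvd 2 * p" unfolding int_dvd_int_iff .
  \<comment> \<open>If \<open>q\<close> is odd, then \<open>b * c\<close> is a power of
    \<open>V 2\<close>, so \<open>a\<close> inverts it. Together with \<open>a * c = c * a\<close>
    this gives \<open>U 2 * b = b * V 2\<close>, hence \<open>p dvd 2\<close>.\<close>
  show "even q"
  proof (rule ccontr)
    assume "odd q"
    then obtain t where t: "q = 2 * t + 1" by (rule oddE)
    have V1: "V (2 * int (t + 1)) = V 1" by (rule V_cong) (simp add: t)
    have V1m: "V (- 2 * int (t + 1)) = V (-1)"
    proof (rule V_cong)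
      have "- 2 * int (t + 1) - (-1) = - int q" by (simp add: t)
      then show "int q dvd - 2 * int (t + 1) - (-1)" by simp
    qed
    have "a * V 1 * a = V (-1)" using aVn[of "t + 1"] unfolding V1 V1m .
    then have "U 1 * c * a = c * b" by (simp add: coxeter_pair.V1[OF coxeter_pair_axioms] U1 Vm1 mult.assoc)
    then have "U 1 * (c * a) * c = c * b * c" by (simp add: mult.assoc)
    then have "U 1 * a = c * b * c" by (simp add: ac[symmetric] mult.assoc)
    moreover have "c * b * c = b * V 2"
      by (simp add: V2[symmetric] power2_eq_square mult.assoc)
    moreover have "U 1 * a = U 2 * b"
    proof -
      have "U 1 * a = U 1 * (U 1 * b)" by (simp only: a_nf[symmetric])
      then show ?thesis by simp
    qed
    ultimately have "U 2 * (B True * V 0) = U 0 * (B True * V 2)" by simp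
    then have "int p dvd 2" unfolding nf_eq by simp
    then have "p \<le> 2" using zdvd_imp_le[of "int p" 2] by simp
    then show False using p2 odd by auto
  qed
  \<comment> \<open>The normal forms without \<open>b\<close>. In this law \<open>c\<close> always
    changes the \<open>b\<close>-part, so \<open>b * c\<close> preserves \<open>S\<close>.\<close>
  define S where "S = {U i * V j | i j. True}"
  have "rotations a b c = S"
  proof
    show "S \<subseteq> rotations a b c"
      using rotations_U[OF rotations_V[OF rotations.one]] by (auto simp: S_def)
    show "rotations a b c \<subseteq> S"
    proof
      fix g assume "g \<in> rotations a b c"
      then show "g \<in> S"
      proof induction
        case one
        show ?case unfolding S_def using U0 V0 by (metis (mono_tags, lifting) mem_Collect_eq mult_1_left)
      next
        case (ab h)
        then obtain i j where "h = U i * V j" by (auto simp: S_def)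
        then have "a * b * h = U (1 + i) * V j" unfolding U1[symmetric] by simp
        then show ?case unfolding S_def by blast
      next
        case (bc h)
        then obtain i j where h: "h = U i * V j" by (auto simp: S_def)
        obtain n where n: "U i = U (int n)" by (rule U_nat)
        have "b * c * h = b * (c * U (int n)) * V j" by (simp add: h n mult.assoc)
        also have "\<dots> = U (- int n) * V (1 - 2 * int n + j)"
          unfolding cUn by (simp add: bU Vc mult.assoc)
        finally show ?case unfolding S_def by blast
      qed
    qed
  qed
  moreover have "card S = p * q"
  proof -
    have "S = (\<lambda>(i, j). U (int i) * V (int j)) ` ({..<p} \<times> {..<q})"
    proof
      show "S \<subseteq> (\<lambda>(i, j). U (int i) * V (int j)) ` ({..<p} \<times> {..<q})"
      proof
        fix g assume "g \<in> S"
        then obtain i j where g: "g = U i * V j" by (auto simp: S_def)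
        have "g = U (int (nat (i mod int p))) * V (int (nat (j mod int q)))"
          unfolding g using p0 q0 U_cong[of i "i mod int p"] V_cong[of j "j mod int q"] by simp
        then show "g \<in> (\<lambda>(i, j). U (int i) * V (int j)) ` ({..<p} \<times> {..<q})"
          using p0 q0 by (intro image_eqI[of _ _ "(nat (i mod int p), nat (j mod int q))"]) (auto simp: nat_less_iff)
      qed
    qed (auto simp: S_def)
    moreover have "inj_on (\<lambda>(i, j). U (int i) * V (int j)) ({..<p} \<times> {..<q})"
    proof (rule inj_onI, simp only: split_paired_all mem_Sigma_iff split prod.inject)
      fix i j i' j'
      assume ij: "i \<in> {..<p} \<and> j \<in> {..<q}" "i' \<in> {..<p} \<and> j' \<in> {..<q}"
        and eq: "U (int i) * V (int j) = U (int i') * V (int j')"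
      have "int p dvd int i - int i' \<and> int q dvd int j - int j'"
        using eq nf_eq[of "int i" False "int j" "int i'" False "int j'"] by simp
      then have "int i mod int p = int i' mod int p" "int j mod int q = int j' mod int q"
        by (simp_all only: mod_eq_dvd_iff)
      then show "i = i' \<and> j = j'" using ij by simp
    qed
    ultimately show ?thesis by (simp add: card_image)
  qed
  ultimately show "card (rotations a b c) = p * q" by simp
qed

text \<open>As \<open>U p = 1\<close>, the law at \<open>n = p\<close> must give back
  \<open>c\<close> itself, and among the residues modulo 3 only 0 does so. The rotations contain
  \<open>c\<close>, hence also \<open>b = V 1 * c\<close>, hence all normal forms.\<close>

lemma nonorientable_case:
  assumes q4: "q = 4" and di: "a * V 2 * a = c * V 2"
  shows "3 dvd p" "law (\<lambda>n. n mod 3 \<noteq> 2) (\<lambda>n. if n mod 3 = 0 then 1 else if n mod 3 = 1 then 3 else 2)"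
    "rotations a b c = G"
proof -
  show law: "law (\<lambda>n. n mod 3 \<noteq> 2) (\<lambda>n. if n mod 3 = 0 then 1 else if n mod 3 = 1 then 3 else 2)"
    by (rule nonorientable_law(1)[OF assms])
  have Up: "U (int p) = 1" using U_cong[of "int p" 0] by simp
  have "c * U (int p) = U (int p) * (B (p mod 3 \<noteq> 2) * V (if p mod 3 = 0 then 1 else if p mod 3 = 1 then 3 else 2))"
    using law unfolding law_def by blast
  moreover have "B True * V 1 = c" by (simp add: c_nf[symmetric])
  ultimately have eq: "B True * V 1 = B (p mod 3 \<noteq> 2) * V (if p mod 3 = 0 then 1 else if p mod 3 = 1 then 3 else 2)"
    unfolding Up by simp
  have "p mod 3 \<noteq> 1" using eq unfolding E_eq_iff using q4 by (auto split: if_splits)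
  moreover have "p mod 3 \<noteq> 2" using eq unfolding E_eq_iff by auto
  moreover have "p mod 3 < 3" by simp
  ultimately have "p mod 3 = 0" by linarith
  then show "3 dvd p" by (rule mod_0_imp_dvd)
  show "rotations a b c = G"
  proof
    show "rotations a b c \<subseteq> G"
    proof
      fix g assume "g \<in> rotations a b c"
      then show "g \<in> G" by induction (auto simp: G_a G_b G_c mult.assoc)
    qed
    let ?R = "rotations a b c"
    have UR: "U i \<in> ?R" and VR: "V j \<in> ?R" for i j
      using rotations_U[OF rotations.one, of i] rotations_V[OF rotations.one, of j] by simp_all
    have "U 1 * V 2 * U (-1) * V 2 \<in> ?R" by (intro rotations_mult UR VR)
    then have c: "c \<in> ?R" unfolding nonorientable_law(2)[OF assms] .
    have b: "b \<in> ?R" using rotations_mult[OF VR[of 1] c] by (simp add: V1 mult.assoc)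
    have "U i * (B e * V j) \<in> ?R" for i e j
      using rotations_mult[OF UR rotations_mult[OF b VR]] rotations_mult[OF UR VR] by (cases e) auto
    then show "G \<subseteq> ?R" by (auto simp: G_def)
  qed
qed

theorem classification:
  assumes "odd p" "p \<ge> 2"
  shows "(even q \<and> q dvd 2 * p \<and> law (\<lambda>_. True) (\<lambda>n. 1 - 2 * int n) \<and> card (rotations a b c) = p * q) \<or>
    (q = 4 \<and> 3 dvd p \<and> rotations a b c = G \<and>
      law (\<lambda>n. n mod 3 \<noteq> 2) (\<lambda>n. if n mod 3 = 0 then 1 else if n mod 3 = 1 then 3 else 2))"
  using dichotomy[OF assms(1)] orientable_case[OF assms] nonorientable_case
  unfolding dichotomy_def V2 by blast

end

section \<open>Flags of finite polyhedra\<close>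

text \<open>\<open>dom\<close> and \<open>ran\<close> put every element into a pair of
  \<open>R\<close>. A pair of \<open>R\<close> can only go to a vertex followed by an edge of the
  graph, so the isomorphism respects the two levels: \<open>L\<close> becomes the vertices and
  \<open>H\<close> the edges.\<close>

lemma polygonalD:
  assumes poly: "polygonal r" and r: "r = Id_on (L \<union> H) \<union> R" and R: "R \<subseteq> L \<times> H" "L \<inter> H = {}"
    and dom: "L \<subseteq> Domain R" and ran: "H \<subseteq> Range R"
  shows "\<And>h. h \<in> H \<Longrightarrow> card {l. (l, h) \<in> R} = 2"
    and "\<And>l l'. l \<in> L \<Longrightarrow> l' \<in> L \<Longrightarrow> (l, l') \<in> {(x, y). \<exists>h. (x, h) \<in> R \<and> (y, h) \<in> R}\<^sup>*"
proof -
  obtain G :: "('a, 'a) multigraph" where G: "is_multigraph G" "connected_multigraph G"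
    and iso: "poset_iso r (incidence_poset G)"
    using poly unfolding polygonal_def by blast
  obtain f :: "'a \<Rightarrow> 'a + 'a" where f: "bij_betw f (Field r) (Field (incidence_poset G))"
    and fr: "\<And>x y. x \<in> Field r \<Longrightarrow> y \<in> Field r \<Longrightarrow> (x, y) \<in> r \<longleftrightarrow> (f x, f y) \<in> incidence_poset G"
    using iso unfolding poset_iso_def by blast
  have Fid: "Field (Id_on A \<union> R) = A" if "R \<subseteq> A \<times> A" for A and R :: "'c rel"
    unfolding Field_def using that by auto
  have Fr: "Field r = L \<union> H" using R unfolding r Field_def by auto
  have FG: "Field (incidence_poset G) = Inl ` mverts G \<union> Inr ` medges G"
    unfolding incidence_poset_def by (rule Fid) auto
  have inj: "inj_on f (L \<union> H)" and img: "f ` (L \<union> H) = Inl ` mverts G \<union> Inr ` medges G"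
    using f unfolding Fr FG bij_betw_def by auto
  have RI: "(l, h) \<in> R \<longleftrightarrow> (f l, f h) \<in> incidence_poset G" if "l \<in> L" "h \<in> H" for l h
  proof -
    have "(l, h) \<in> r \<longleftrightarrow> (l, h) \<in> R" using that R unfolding r by auto
    then show ?thesis using fr[of l h] that Fr by auto
  qed
  have Rf: "\<exists>v e. f l = Inl v \<and> f h = Inr e" if "(l, h) \<in> R" for l h
  proof -
    have "l \<in> L" "h \<in> H" "l \<noteq> h" using that R by auto
    then have "f l \<noteq> f h" using inj by (auto dest: inj_onD)
    moreover have "(f l, f h) \<in> incidence_poset G" using RI that \<open>l \<in> L\<close> \<open>h \<in> H\<close> by blast
    ultimately show ?thesis unfolding incidence_poset_def by auto
  qed
  have fL: "\<exists>v. f l = Inl v" if "l \<in> L" for l using dom Rf that by blast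
  have fH: "\<exists>e. f h = Inr e" if "h \<in> H" for h using ran Rf that by blast
  have surjL: "\<exists>l\<in>L. f l = Inl v" if "v \<in> mverts G" for v
  proof -
    have "Inl v \<in> f ` (L \<union> H)" using that img by auto
    then show ?thesis using fH by force
  qed
  have surjH: "\<exists>h\<in>H. f h = Inr e" if "e \<in> medges G" for e
  proof -
    have "Inr e \<in> f ` (L \<union> H)" using that img by auto
    then show ?thesis using fL by force
  qed
  have verts: "v \<in> mverts G" if "f l = Inl v" "l \<in> L" for l v
    using that img by (metis (no_types, lifting) Inl_inject UnE UnI1 image_iff sum.distinct(1))
  have inc: "(Inl v, Inr e) \<in> incidence_poset G \<longleftrightarrow> e \<in> medges G \<and> v \<in> mends G e" for v e
    using G(1) unfolding incidence_poset_def is_multigraph_def by auto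
  show "card {l. (l, h) \<in> R} = 2" if h: "h \<in> H" for h
  proof -
    obtain e where e: "f h = Inr e" using fH h by blast
    have eG: "e \<in> medges G"
    proof -
      have "Inr e \<in> Inl ` mverts G \<union> Inr ` medges G" using h e img by (metis UnI2 image_eqI)
      then show ?thesis by auto
    qed
    have "f ` {l. (l, h) \<in> R} = (Inl ` mends G e :: ('a + 'a) set)"
    proof
      show "f ` {l. (l, h) \<in> R} \<subseteq> (Inl ` mends G e :: ('a + 'a) set)"
      proof
        fix y :: "'a + 'a" assume "y \<in> f ` {l. (l, h) \<in> R}"
        then obtain l where l: "(l, h) \<in> R" "y = f l" by auto
        then have lL: "l \<in> L" using R by auto
        obtain v where "f l = Inl v" using fL lL by blast
        then show "y \<in> Inl ` mends G e" using RI[OF lL h] l e inc by auto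
      qed
      show "(Inl ` mends G e :: ('a + 'a) set) \<subseteq> f ` {l. (l, h) \<in> R}"
      proof
        fix y :: "'a + 'a" assume "y \<in> Inl ` mends G e"
        then obtain v where v: "v \<in> mends G e" "y = Inl v" by auto
        then obtain l where l: "l \<in> L" "f l = Inl v" using surjL eG G(1) unfolding is_multigraph_def by blast
        then have "(l, h) \<in> R" using RI[OF l(1) h] l e inc eG v by auto
        then show "y \<in> f ` {l. (l, h) \<in> R}" using l v by (metis image_eqI mem_Collect_eq)
      qed
    qed
    moreover have "inj_on f {l. (l, h) \<in> R}" by (rule inj_on_subset[OF inj]) (use R in auto)
    ultimately have "card {l. (l, h) \<in> R} = card (Inl ` mends G e :: ('a + 'a) set)" by (metis card_image)
    then show ?thesis using eG G(1) by (simp add: card_image is_multigraph_def)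
  qed
  let ?C = "{(x, y). \<exists>h. (x, h) \<in> R \<and> (y, h) \<in> R}"
  have path: "\<exists>l'\<in>L. f l' = Inl v \<and> (l, l') \<in> ?C\<^sup>*"
    if "(u, v) \<in> {(x, y). \<exists>e \<in> medges G. mends G e = {x, y}}\<^sup>*" "l \<in> L" "f l = Inl u" for u v l
    using that(1)
  proof induction
    case base
    then show ?case using that by auto
  next
    case (step v w)
    then obtain l' e where l': "l' \<in> L" "f l' = Inl v" "(l, l') \<in> ?C\<^sup>*" and e: "e \<in> medges G" "mends G e = {v, w}"
      by auto
    obtain h where h: "h \<in> H" "f h = Inr e" using surjH e by blast
    have "w \<in> mverts G" using e G(1) unfolding is_multigraph_def by auto
    then obtain l'' where l'': "l'' \<in> L" "f l'' = Inl w" using surjL by blast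
    have "(l', h) \<in> R" "(l'', h) \<in> R"
      using RI[OF l'(1) h(1)] RI[OF l''(1) h(1)] l' l'' h inc e by auto
    then have "(l', l'') \<in> ?C" by blast
    then show ?case using l'(3) l'' by (meson rtrancl.rtrancl_into_rtrancl)
  qed
  show "(l, l') \<in> ?C\<^sup>*" if l: "l \<in> L" "l' \<in> L" for l l'
  proof -
    obtain u v where uv: "f l = Inl u" "f l' = Inl v" using fL l by metis
    have "(u, v) \<in> {(x, y). \<exists>e \<in> medges G. mends G e = {x, y}}\<^sup>*"
      using G(2) verts uv l unfolding connected_multigraph_def by blast
    then obtain l'' where l'': "l'' \<in> L" "f l'' = Inl v" "(l, l'') \<in> ?C\<^sup>*" using path l(1) uv(1) by blast
    have "l'' = l'" using inj l'' uv l by (metis UnI1 inj_onD)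
    then show ?thesis using l'' by simp
  qed
qed

section \<open>Flags as triples and their connectedness\<close>

locale finite_polyhedron =
  fixes P :: "'a ranked_poset"
  assumes poly: "polyhedron P" and fin: "finite (elems P)"
begin

lemma ranked: "is_ranked_poset P" using poly unfolding polyhedron_def by simp

lemma leq_elems: "(x, y) \<in> leq P \<Longrightarrow> x \<in> elems P \<and> y \<in> elems P"
  using ranked partial_order_onD(4) unfolding is_ranked_poset_def by blast

lemma leq_refl: "x \<in> elems P \<Longrightarrow> (x, x) \<in> leq P"
  using ranked partial_order_onD(1) unfolding is_ranked_poset_def refl_on_def by blast

lemma leq_trans: "(x, y) \<in> leq P \<Longrightarrow> (y, z) \<in> leq P \<Longrightarrow> (x, z) \<in> leq P"
  using ranked partial_order_onD(2) unfolding is_ranked_poset_def by (meson transD)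

lemma leq_rk: "(x, y) \<in> leq P \<Longrightarrow> x \<noteq> y \<Longrightarrow> rk P x < rk P y"
  using ranked unfolding is_ranked_poset_def by blast

lemma rk_cases: "x \<in> elems P \<Longrightarrow> x \<in> vertices P \<or> x \<in> edges P \<or> x \<in> faces P"
  using ranked unfolding is_ranked_poset_def of_rank_def by auto

lemma incident_iff: "rk P x < rk P y \<Longrightarrow> incident P x y \<longleftrightarrow> (x, y) \<in> leq P"
  unfolding incident_def using leq_rk[of y x] by auto

lemma incident_leq:
  "v \<in> vertices P \<Longrightarrow> e \<in> edges P \<Longrightarrow> incident P v e \<longleftrightarrow> (v, e) \<in> leq P"
  "e \<in> edges P \<Longrightarrow> f \<in> faces P \<Longrightarrow> incident P e f \<longleftrightarrow> (e, f) \<in> leq P"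
  "v \<in> vertices P \<Longrightarrow> f \<in> faces P \<Longrightarrow> incident P v f \<longleftrightarrow> (v, f) \<in> leq P"
  by (rule incident_iff; simp add: of_rank_def)+

text \<open>A flag as a triple gives access to its element of each rank; incidence of vertex and
  face follows by transitivity. \<open>flags_eq\<close> and \<open>fset_inj\<close> link the triples
  to the sets in \<open>flags P\<close>.\<close>

definition FL :: "('a \<times> 'a \<times> 'a) set" where
  "FL = {(v, e, f). v \<in> vertices P \<and> e \<in> edges P \<and> f \<in> faces P \<and> (v, e) \<in> leq P \<and> (e, f) \<in> leq P}"

definition fset :: "'a \<times> 'a \<times> 'a \<Rightarrow> 'a set" where "fset = (\<lambda>(v, e, f). {v, e, f})"

lemma chain_extends:
  assumes "pred_on.chain (elems P) (\<lambda>x y. (x, y) \<in> leq P) C"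
  shows "\<exists>\<Phi>\<in>flags P. C \<subseteq> \<Phi>"
proof -
  let ?A = "{D. pred_on.chain (elems P) (\<lambda>x y. (x, y) \<in> leq P) D \<and> C \<subseteq> D}"
  have "?A \<subseteq> Pow (elems P)" unfolding pred_on.chain_def by auto
  then have "finite ?A" using fin by (meson finite_Pow_iff finite_subset)
  moreover have "C \<in> ?A" using assms by auto
  ultimately obtain M where M: "M \<in> ?A" "\<forall>D\<in>?A. M \<subseteq> D \<longrightarrow> M = D"
    using finite_has_maximal2[of ?A C] by blast
  then have "pred_on.maxchain (elems P) (\<lambda>x y. (x, y) \<in> leq P) M"
    unfolding pred_on.maxchain_def by blast
  then show ?thesis using M(1) unfolding flags_def by blast
qed

lemma flag_elems:
  "\<Phi> \<in> flags P \<Longrightarrow> \<exists>v\<in>vertices P. \<exists>e\<in>edges P. \<exists>f\<in>faces P.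
    \<Phi> = {v, e, f} \<and> incident P v e \<and> incident P e f \<and> incident P v f"
  using poly unfolding polyhedron_def by (elim conjE) (erule bspec)

lemma flags_eq: "flags P = fset ` FL"
proof
  show "flags P \<subseteq> fset ` FL"
  proof
    fix \<Phi> assume "\<Phi> \<in> flags P"
    then obtain v e f where "v \<in> vertices P" "e \<in> edges P" "f \<in> faces P" "\<Phi> = {v, e, f}"
      "incident P v e" "incident P e f"
      using flag_elems by blast
    then have "(v, e, f) \<in> FL" "\<Phi> = fset (v, e, f)" using incident_leq by (auto simp: FL_def fset_def)
    then show "\<Phi> \<in> fset ` FL" by blast
  qed
  show "fset ` FL \<subseteq> flags P"
  proof
    fix \<Phi> assume "\<Phi> \<in> fset ` FL"
    then obtain v e f where t: "v \<in> vertices P" "e \<in> edges P" "f \<in> faces P" "(v, e) \<in> leq P" "(e, f) \<in> leq P"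
      "\<Phi> = {v, e, f}" by (auto simp: FL_def fset_def)
    have "pred_on.chain (elems P) (\<lambda>x y. (x, y) \<in> leq P) \<Phi>"
      unfolding pred_on.chain_def using t leq_trans[OF t(4,5)] by (auto simp: of_rank_def)
    then obtain \<Psi> where \<Psi>: "\<Psi> \<in> flags P" "\<Phi> \<subseteq> \<Psi>" using chain_extends by blast
    then obtain v' e' f' where "v' \<in> vertices P" "e' \<in> edges P" "f' \<in> faces P" "\<Psi> = {v', e', f'}"
      using flag_elems by blast
    then have "\<Phi> = \<Psi>" using t \<Psi>(2) by (auto simp: of_rank_def)
    then show "\<Phi> \<in> flags P" using \<Psi> by simp
  qed
qed

lemma FL_rk: "(v, e, f) \<in> FL \<Longrightarrow> rk P v = 0 \<and> rk P e = 1 \<and> rk P f = 2 \<and> v \<in> elems P \<and> e \<in> elems P \<and> f \<in> elems P"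
  by (auto simp: FL_def of_rank_def)

lemma fset_inj: "inj_on fset FL"
proof (rule inj_onI)
  fix s t assume st: "s \<in> FL" "t \<in> FL" "fset s = fset t"
  obtain v e f v' e' f' where [simp]: "s = (v, e, f)" "t = (v', e', f')" by (metis prod_cases3)
  have "v \<in> fset t" "e \<in> fset t" "f \<in> fset t" using st(3)[symmetric] by (auto simp: fset_def)
  then show "s = t" using st(1,2) FL_rk[of v e f] FL_rk[of v' e' f'] by (auto simp: fset_def)
qed

text \<open>The chain \<open>{v, f}\<close> extends to a maximal chain, and every maximal chain
  contains an edge.\<close>

lemma ex_edge_between:
  assumes "v \<in> vertices P" "f \<in> faces P" "(v, f) \<in> leq P"
  shows "\<exists>e. (v, e, f) \<in> FL"
proof -
  have "pred_on.chain (elems P) (\<lambda>x y. (x, y) \<in> leq P) {v, f}"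
    unfolding pred_on.chain_def using assms by (auto simp: of_rank_def)
  from chain_extends[OF this] obtain t where "t \<in> FL" "{v, f} \<subseteq> fset t" using flags_eq by auto
  then show ?thesis using assms FL_rk by (cases t) (auto simp: fset_def of_rank_def)
qed

lemma edge_vertices: "e \<in> edges P \<Longrightarrow> card {v \<in> vertices P. (v, e) \<in> leq P} = 2"
  and edge_faces: "e \<in> edges P \<Longrightarrow> card {f \<in> faces P. (e, f) \<in> leq P} = 2"
proof -
  assume e: "e \<in> edges P"
  have "{v \<in> vertices P. (v, e) \<in> leq P} = {v \<in> vertices P. incident P v e}"
    "{f \<in> faces P. (e, f) \<in> leq P} = {f \<in> faces P. incident P e f}" using incident_leq e by auto
  then show "card {v \<in> vertices P. (v, e) \<in> leq P} = 2" "card {f \<in> faces P. (e, f) \<in> leq P} = 2"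
    using poly e unfolding polyhedron_def by auto
qed

lemma ex_vertex: "e \<in> edges P \<Longrightarrow> \<exists>v \<in> vertices P. (v, e) \<in> leq P"
  using edge_vertices[of e] by (metis (no_types, lifting) card.empty empty_Collect_eq zero_neq_numeral)

lemma ex_face: "e \<in> edges P \<Longrightarrow> \<exists>f \<in> faces P. (e, f) \<in> leq P"
  using edge_faces[of e] by (metis (no_types, lifting) card.empty empty_Collect_eq zero_neq_numeral)

text \<open>The first part yields the second flag with the same vertex and face; the second lets one
  walk among the edges at \<open>v\<close>.\<close>

lemma vertex_figure:
  assumes v: "v \<in> vertices P"
  shows "\<And>f. f \<in> faces P \<Longrightarrow> (v, f) \<in> leq P \<Longrightarrow> card {e. (v, e, f) \<in> FL} = 2"
    and "\<And>e e'. e \<in> edges P \<Longrightarrow> (v, e) \<in> leq P \<Longrightarrow> e' \<in> edges P \<Longrightarrow> (v, e') \<in> leq P \<Longrightarrow>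
      (e, e') \<in> {(e, e'). \<exists>f. (v, e, f) \<in> FL \<and> (v, e', f) \<in> FL}\<^sup>*"
proof -
  let ?L = "{e \<in> edges P. (v, e) \<in> leq P}" and ?H = "{f \<in> faces P. (v, f) \<in> leq P}"
  let ?R = "{(e, f). (v, e, f) \<in> FL}"
  have r: "strictly_above P v = Id_on (?L \<union> ?H) \<union> ?R"
  proof (intro equalityI subrelI)
    fix x y assume "(x, y) \<in> strictly_above P v"
    then have xy: "(x, y) \<in> leq P" "(v, x) \<in> leq P" "(v, y) \<in> leq P" "x \<noteq> v" "y \<noteq> v"
      unfolding strictly_above_def by auto
    then have "rk P x > 0" "rk P y > 0" using leq_rk by fastforce+
    then have "x \<in> edges P \<or> x \<in> faces P" "y \<in> edges P \<or> y \<in> faces P"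
      using rk_cases[of x] rk_cases[of y] leq_elems[OF xy(1)] by (auto simp: of_rank_def)
    moreover have "x \<noteq> y \<Longrightarrow> rk P x < rk P y" using leq_rk xy by blast
    ultimately show "(x, y) \<in> Id_on (?L \<union> ?H) \<union> ?R"
      using xy v by (cases "x = y") (auto simp: FL_def of_rank_def)
  next
    fix x y assume "(x, y) \<in> Id_on (?L \<union> ?H) \<union> ?R"
    then show "(x, y) \<in> strictly_above P v"
      unfolding strictly_above_def using v leq_refl[of x] leq_trans[of v x y] by (auto simp: FL_def of_rank_def)
  qed
  have pol: "polygonal (strictly_above P v)" using poly v unfolding polyhedron_def by auto
  note * = polygonalD[OF pol r]
  have 1: "?R \<subseteq> ?L \<times> ?H"
  proof (rule subrelI)
    show "(x, y) \<in> ?L \<times> ?H" if "(x, y) \<in> ?R" for x y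
      using that leq_trans[of v x y] by (auto simp: FL_def)
  qed
  have 2: "?L \<inter> ?H = {}" by (auto simp: of_rank_def)
  have 3: "?L \<subseteq> Domain ?R" using ex_face v by (fastforce simp: FL_def)
  have 4: "?H \<subseteq> Range ?R" using ex_edge_between v by fastforce
  show "card {e. (v, e, f) \<in> FL} = 2" if "f \<in> faces P" "(v, f) \<in> leq P" for f
    using *(1)[OF 1 2 3 4, of f] that by simp
  show "(e, e') \<in> {(e, e'). \<exists>f. (v, e, f) \<in> FL \<and> (v, e', f) \<in> FL}\<^sup>*"
    if "e \<in> edges P" "(v, e) \<in> leq P" "e' \<in> edges P" "(v, e') \<in> leq P" for e e'
    using *(2)[OF 1 2 3 4, of e e'] that by simp
qed

lemma face_polygon:
  assumes f: "f \<in> faces P"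
  shows "\<And>v v'. v \<in> vertices P \<Longrightarrow> (v, f) \<in> leq P \<Longrightarrow> v' \<in> vertices P \<Longrightarrow> (v', f) \<in> leq P \<Longrightarrow>
      (v, v') \<in> {(v, v'). \<exists>e. (v, e, f) \<in> FL \<and> (v', e, f) \<in> FL}\<^sup>*"
proof -
  let ?L = "{v \<in> vertices P. (v, f) \<in> leq P}" and ?H = "{e \<in> edges P. (e, f) \<in> leq P}"
  let ?R = "{(v, e). (v, e, f) \<in> FL}"
  have r: "strictly_below P f = Id_on (?L \<union> ?H) \<union> ?R"
  proof (intro equalityI subrelI)
    fix x y assume "(x, y) \<in> strictly_below P f"
    then have xy: "(x, y) \<in> leq P" "(x, f) \<in> leq P" "(y, f) \<in> leq P" "x \<noteq> f" "y \<noteq> f"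
      unfolding strictly_below_def by auto
    then have "rk P x < 2" "rk P y < 2" using leq_rk f by (fastforce simp: of_rank_def)+
    then have "x \<in> vertices P \<or> x \<in> edges P" "y \<in> vertices P \<or> y \<in> edges P"
      using rk_cases[of x] rk_cases[of y] leq_elems[OF xy(1)] by (auto simp: of_rank_def)
    moreover have "x \<noteq> y \<Longrightarrow> rk P x < rk P y" using leq_rk xy by blast
    ultimately show "(x, y) \<in> Id_on (?L \<union> ?H) \<union> ?R"
      using xy f by (cases "x = y") (auto simp: FL_def of_rank_def)
  next
    fix x y assume "(x, y) \<in> Id_on (?L \<union> ?H) \<union> ?R"
    then show "(x, y) \<in> strictly_below P f"
      unfolding strictly_below_def using f leq_refl[of x] leq_trans[of x y f] by (auto simp: FL_def of_rank_def)
  qed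
  have pol: "polygonal (strictly_below P f)" using poly f unfolding polyhedron_def by auto
  have 1: "?R \<subseteq> ?L \<times> ?H"
  proof (rule subrelI)
    show "(x, y) \<in> ?L \<times> ?H" if "(x, y) \<in> ?R" for x y
      using that leq_trans[of x y f] by (auto simp: FL_def)
  qed
  have 2: "?L \<inter> ?H = {}" by (auto simp: of_rank_def)
  have 3: "?L \<subseteq> Domain ?R" using ex_edge_between f by fastforce
  have 4: "?H \<subseteq> Range ?R" using ex_vertex f by (fastforce simp: FL_def)
  show "(v, v') \<in> {(v, v'). \<exists>e. (v, e, f) \<in> FL \<and> (v', e, f) \<in> FL}\<^sup>*"
    if "v \<in> vertices P" "(v, f) \<in> leq P" "v' \<in> vertices P" "(v', f) \<in> leq P" for v v'
    using polygonalD(2)[OF pol r 1 2 3 4, of v v'] that by simp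
qed

definition agree :: "nat \<Rightarrow> 'a \<times> 'a \<times> 'a \<Rightarrow> 'a \<times> 'a \<times> 'a \<Rightarrow> bool" where
  "agree i = (\<lambda>(v, e, f) (v', e', f'). (i \<noteq> 0 \<longrightarrow> v = v') \<and> (i \<noteq> 1 \<longrightarrow> e = e') \<and> (i \<noteq> 2 \<longrightarrow> f = f'))"

definition nb :: "nat \<Rightarrow> 'a \<times> 'a \<times> 'a \<Rightarrow> 'a \<times> 'a \<times> 'a" where
  "nb i t = (THE t'. t' \<in> FL \<and> t' \<noteq> t \<and> agree i t t')"

lemma card_2_ex1: "card A = 2 \<Longrightarrow> x \<in> A \<Longrightarrow> \<exists>!y. y \<in> A \<and> y \<noteq> x"
  unfolding card_2_iff by blast

lemma nb_ex1:
  assumes t: "t \<in> FL" and i: "i \<in> {0, 1, 2}"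
  shows "\<exists>!t'. t' \<in> FL \<and> t' \<noteq> t \<and> agree i t t'"
proof -
  obtain v e f where [simp]: "t = (v, e, f)" by (metis prod_cases3)
  have t': "v \<in> vertices P" "e \<in> edges P" "f \<in> faces P" "(v, e) \<in> leq P" "(e, f) \<in> leq P"
    using t by (auto simp: FL_def)
  consider "i = 0" | "i = 1" | "i = 2" using i by auto
  then show ?thesis
  proof cases
    case 1
    obtain v' where v': "v' \<in> {v \<in> vertices P. (v, e) \<in> leq P}" "v' \<noteq> v"
      "\<And>w. w \<in> {v \<in> vertices P. (v, e) \<in> leq P} \<Longrightarrow> w \<noteq> v \<Longrightarrow> w = v'"
      using card_2_ex1[OF edge_vertices[OF t'(2)], of v] t' by blast
    show ?thesis
    proof (rule ex1I[of _ "(v', e, f)"])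
      show "(v', e, f) \<in> FL \<and> (v', e, f) \<noteq> t \<and> agree i t (v', e, f)"
        using v'(1,2) t' by (auto simp: FL_def agree_def 1)
      fix s assume s: "s \<in> FL \<and> s \<noteq> t \<and> agree i t s"
      obtain x y z where [simp]: "s = (x, y, z)" by (metis prod_cases3)
      have eqs: "y = e" "z = f" using s by (auto simp: agree_def 1)
      then have "x = v'" using s by (intro v'(3)) (auto simp: FL_def)
      then show "s = (v', e, f)" using eqs by simp
    qed
  next
    case 2
    have "card {e. (v, e, f) \<in> FL} = 2" using vertex_figure(1)[OF t'(1,3)] leq_trans t' by blast
    then obtain e' where e': "e' \<in> {e. (v, e, f) \<in> FL}" "e' \<noteq> e"
      "\<And>w. w \<in> {e. (v, e, f) \<in> FL} \<Longrightarrow> w \<noteq> e \<Longrightarrow> w = e'"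
      using card_2_ex1[of "{e. (v, e, f) \<in> FL}" e] t by auto
    show ?thesis
    proof (rule ex1I[of _ "(v, e', f)"])
      show "(v, e', f) \<in> FL \<and> (v, e', f) \<noteq> t \<and> agree i t (v, e', f)"
        using e'(1,2) t' by (auto simp: FL_def agree_def 2)
      fix s assume s: "s \<in> FL \<and> s \<noteq> t \<and> agree i t s"
      obtain x y z where [simp]: "s = (x, y, z)" by (metis prod_cases3)
      have eqs: "x = v" "z = f" using s by (auto simp: agree_def 2)
      then have "y = e'" using s by (intro e'(3)) (auto simp: FL_def)
      then show "s = (v, e', f)" using eqs by simp
    qed
  next
    case 3
    obtain f' where f': "f' \<in> {f \<in> faces P. (e, f) \<in> leq P}" "f' \<noteq> f"
      "\<And>w. w \<in> {f \<in> faces P. (e, f) \<in> leq P} \<Longrightarrow> w \<noteq> f \<Longrightarrow> w = f'"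
      using card_2_ex1[OF edge_faces[OF t'(2)], of f] t' by blast
    show ?thesis
    proof (rule ex1I[of _ "(v, e, f')"])
      show "(v, e, f') \<in> FL \<and> (v, e, f') \<noteq> t \<and> agree i t (v, e, f')"
        using f'(1,2) t' by (auto simp: FL_def agree_def 3)
      fix s assume s: "s \<in> FL \<and> s \<noteq> t \<and> agree i t s"
      obtain x y z where [simp]: "s = (x, y, z)" by (metis prod_cases3)
      have eqs: "x = v" "y = e" using s by (auto simp: agree_def 3)
      then have "z = f'" using s by (intro f'(3)) (auto simp: FL_def)
      then show "s = (v, e, f')" using eqs by simp
    qed
  qed
qed

lemma nb: "t \<in> FL \<Longrightarrow> i \<in> {0, 1, 2} \<Longrightarrow> nb i t \<in> FL \<and> nb i t \<noteq> t \<and> agree i t (nb i t)"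
  unfolding nb_def by (rule theI') (rule nb_ex1)

lemma nb_eqI: "t \<in> FL \<Longrightarrow> i \<in> {0, 1, 2} \<Longrightarrow> t' \<in> FL \<Longrightarrow> t' \<noteq> t \<Longrightarrow> agree i t t' \<Longrightarrow> nb i t = t'"
  unfolding nb_def by (rule the1_equality[OF nb_ex1]) simp_all

lemma agree_sym: "agree i s t \<longleftrightarrow> agree i t s"
  unfolding agree_def by (auto split: prod.splits)

lemma nb_nb: "t \<in> FL \<Longrightarrow> i \<in> {0, 1, 2} \<Longrightarrow> nb i (nb i t) = t"
  using nb[of t i] by (intro nb_eqI) (auto simp: agree_sym)

lemma nb02: assumes t: "t \<in> FL" shows "nb 0 (nb 2 t) = nb 2 (nb 0 t)"
proof -
  obtain v e f where [simp]: "t = (v, e, f)" by (metis prod_cases3)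
  obtain v' where v': "nb 0 t = (v', e, f)" using nb[OF t, of 0] by (cases "nb 0 t") (auto simp: agree_def)
  obtain f' where f': "nb 2 t = (v, e, f')" using nb[OF t, of 2] by (cases "nb 2 t") (auto simp: agree_def)
  have FLs: "(v', e, f) \<in> FL" "(v, e, f') \<in> FL" "v' \<noteq> v" "f' \<noteq> f"
    using nb[OF t, of 0] nb[OF t, of 2] v' f' by auto
  then have s: "(v', e, f') \<in> FL" by (auto simp: FL_def)
  have "nb 0 (v, e, f') = (v', e, f')" "nb 2 (v', e, f) = (v', e, f')"
    by (rule nb_eqI; use FLs s in \<open>auto simp: agree_def\<close>)+
  then show ?thesis using v' f' by simp
qed

definition reach :: "nat set \<Rightarrow> (('a \<times> 'a \<times> 'a) \<times> ('a \<times> 'a \<times> 'a)) set" where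
  "reach I = {(t, nb i t) | t i. t \<in> FL \<and> i \<in> I}\<^sup>*"

lemma reach_refl: "(t, t) \<in> reach I" by (simp add: reach_def)
lemma reach_trans: "(s, t) \<in> reach I \<Longrightarrow> (t, u) \<in> reach I \<Longrightarrow> (s, u) \<in> reach I"
  unfolding reach_def by (rule rtrancl_trans)
lemma reach_mono: "I \<subseteq> J \<Longrightarrow> (s, t) \<in> reach I \<Longrightarrow> (s, t) \<in> reach J"
  unfolding reach_def by (erule rtrancl_mono[THEN subsetD, rotated]) blast
lemma reach_agree: "s \<in> FL \<Longrightarrow> t \<in> FL \<Longrightarrow> agree i s t \<Longrightarrow> i \<in> I \<Longrightarrow> I \<subseteq> {0, 1, 2} \<Longrightarrow> (s, t) \<in> reach I"
proof (cases "s = t")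
  case False
  assume a: "s \<in> FL" "t \<in> FL" "agree i s t" "i \<in> I" "I \<subseteq> {0, 1, 2}"
  then have "nb i s = t" using False by (intro nb_eqI) auto
  then have "(s, t) \<in> {(t, nb i t) |t i. t \<in> FL \<and> i \<in> I}" using a by blast
  then show ?thesis unfolding reach_def by (rule r_into_rtrancl)
qed (simp add: reach_refl)

text \<open>A step between edges at \<open>v\<close> changes the edge within a common face; before
  and after it the face is changed at a fixed edge. As the walk mentions edges only, the induction
  is over all final faces.\<close>

lemma reach_vertex:
  assumes "(v, e, f) \<in> FL" "(v, e', f') \<in> FL"
  shows "((v, e, f), (v, e', f')) \<in> reach {1, 2}"
proof -
  have v: "v \<in> vertices P" using assms by (auto simp: FL_def)
  have "(e, e') \<in> {(e, e'). \<exists>f. (v, e, f) \<in> FL \<and> (v, e', f) \<in> FL}\<^sup>*"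
    by (rule vertex_figure(2)[OF v]) (use assms in \<open>auto simp: FL_def\<close>)
  then have "\<forall>f'. (v, e', f') \<in> FL \<longrightarrow> ((v, e, f), (v, e', f')) \<in> reach {1, 2}"
  proof induction
    case base
    show ?case using assms(1) by (auto intro!: reach_agree[of _ _ 2] simp: agree_def)
  next
    case (step e' e'')
    then obtain h where h: "(v, e', h) \<in> FL" "(v, e'', h) \<in> FL" by auto
    have "((v, e, f), (v, e', h)) \<in> reach {1, 2}" using step h by auto
    moreover have "((v, e', h), (v, e'', h)) \<in> reach {1, 2}"
      using h by (auto intro!: reach_agree[of _ _ 1] simp: agree_def)
    moreover have "((v, e'', h), (v, e'', f')) \<in> reach {1, 2}" if "(v, e'', f') \<in> FL" for f'
      using h that by (auto intro!: reach_agree[of _ _ 2] simp: agree_def)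
    ultimately show ?case by (meson reach_trans)
  qed
  then show ?thesis using assms by blast
qed

lemma reach_face:
  assumes "(v, e, f) \<in> FL" "(v', e', f) \<in> FL"
  shows "((v, e, f), (v', e', f)) \<in> reach {0, 1}"
proof -
  have f: "f \<in> faces P" using assms by (auto simp: FL_def)
  have "(v, v') \<in> {(v, v'). \<exists>e. (v, e, f) \<in> FL \<and> (v', e, f) \<in> FL}\<^sup>*"
    by (rule face_polygon[OF f]) (use assms leq_trans in \<open>auto simp: FL_def\<close>)
  then have "\<forall>e'. (v', e', f) \<in> FL \<longrightarrow> ((v, e, f), (v', e', f)) \<in> reach {0, 1}"
  proof induction
    case base
    show ?case using assms(1) by (auto intro!: reach_agree[of _ _ 1] simp: agree_def)
  next
    case (step v' v'')
    then obtain h where h: "(v', h, f) \<in> FL" "(v'', h, f) \<in> FL" by auto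
    have "((v, e, f), (v', h, f)) \<in> reach {0, 1}" using step h by auto
    moreover have "((v', h, f), (v'', h, f)) \<in> reach {0, 1}"
      using h by (auto intro!: reach_agree[of _ _ 0] simp: agree_def)
    moreover have "((v'', h, f), (v'', e', f)) \<in> reach {0, 1}" if "(v'', e', f) \<in> FL" for e'
      using h that by (auto intro!: reach_agree[of _ _ 1] simp: agree_def)
    ultimately show ?case by (meson reach_trans)
  qed
  then show ?thesis using assms by blast
qed

lemma reach_edge:
  assumes "(v, e, f) \<in> FL" "(v', e, f') \<in> FL"
  shows "((v, e, f), (v', e, f')) \<in> reach {0, 2}"
proof -
  have "(v', e, f) \<in> FL" using assms by (auto simp: FL_def)
  then have "((v, e, f), (v', e, f)) \<in> reach {0, 2}" "((v', e, f), (v', e, f')) \<in> reach {0, 2}"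
    using assms reach_agree[of "(v, e, f)" "(v', e, f)" 0] reach_agree[of "(v', e, f)" "(v', e, f')" 2]
    by (auto simp: agree_def)
  then show ?thesis by (rule reach_trans)
qed

text \<open>The skeleton moves the vertex along an edge, by a change of rank 0; edge and face are
  then adjusted by \<open>reach_vertex\<close>.\<close>

lemma reach_all:
  assumes "s \<in> FL" "t \<in> FL"
  shows "(s, t) \<in> reach {0, 1, 2}"
proof -
  obtain v e f v' e' f' where [simp]: "s = (v, e, f)" "t = (v', e', f')" by (metis prod_cases3)
  have "v \<in> vertices P" "v' \<in> vertices P" using assms by (auto simp: FL_def)
  then have "(v, v') \<in> {(x, y). \<exists>e \<in> medges (skeleton P). mends (skeleton P) e = {x, y}}\<^sup>*"
    using poly unfolding polyhedron_def connected_multigraph_def by (auto simp: skeleton_def)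
  then have "\<forall>e' f'. (v', e', f') \<in> FL \<longrightarrow> ((v, e, f), (v', e', f')) \<in> reach {0, 1, 2}"
  proof induction
    case base
    show ?case using reach_vertex assms(1) reach_mono[of "{1, 2}" "{0, 1, 2}"] by simp
  next
    case (step v' v'')
    then obtain h where h: "h \<in> edges P" "{v \<in> vertices P. incident P v h} = {v', v''}"
      by (auto simp: skeleton_def)
    then have vs: "v' \<in> vertices P" "v'' \<in> vertices P" "(v', h) \<in> leq P" "(v'', h) \<in> leq P"
      using incident_leq(1) by auto
    obtain g where g: "g \<in> faces P" "(h, g) \<in> leq P" using ex_face h by blast
    have FLs: "(v', h, g) \<in> FL" "(v'', h, g) \<in> FL" using vs h g by (auto simp: FL_def)
    then have "((v, e, f), (v', h, g)) \<in> reach {0, 1, 2}" using step by auto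
    moreover have "((v', h, g), (v'', h, g)) \<in> reach {0, 1, 2}"
      using FLs by (auto intro!: reach_agree[of _ _ 0] simp: agree_def)
    moreover have "((v'', h, g), (v'', e', f')) \<in> reach {0, 1, 2}" if "(v'', e', f') \<in> FL" for e' f'
      using reach_vertex[OF FLs(2) that] reach_mono[of "{1, 2}" "{0, 1, 2}"] by simp
    ultimately show ?case by (meson reach_trans)
  qed
  then show ?thesis using assms by simp
qed

lemma in_flag: assumes "x \<in> elems P" shows "\<exists>t\<in>FL. x \<in> fset t"
proof -
  have "pred_on.chain (elems P) (\<lambda>x y. (x, y) \<in> leq P) {x}"
    unfolding pred_on.chain_def using assms by auto
  from chain_extends[OF this] show ?thesis using flags_eq by auto
qed

lemma adj_flag_eq:
  assumes t: "t \<in> FL" and i: "i \<in> {0, 1, 2}"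
  shows "adj_flag P (fset t) i = fset (nb i t)"
proof -
  have ag: "{x \<in> fset s. rk P x \<noteq> i} = {x \<in> fset t. rk P x \<noteq> i} \<longleftrightarrow> agree i t s" if s: "s \<in> FL" for s
  proof -
    obtain v e f v' e' f' where [simp]: "t = (v, e, f)" "s = (v', e', f')" by (metis prod_cases3)
    have rks: "rk P v = 0" "rk P e = 1" "rk P f = 2" "rk P v' = 0" "rk P e' = 1" "rk P f' = 2"
      using FL_rk t s by auto
    have ne: "v \<noteq> e" "v \<noteq> f" "e \<noteq> f" "v' \<noteq> e" "v' \<noteq> f" "e' \<noteq> f" "v \<noteq> e'" "v \<noteq> f'" "e \<noteq> f'" "v' \<noteq> e'" "v' \<noteq> f'" "e' \<noteq> f'"
      using rks by auto
    have S: "{x \<in> fset s. rk P x \<noteq> i} = (if i \<noteq> 0 then {v'} else {}) \<union> (if i \<noteq> 1 then {e'} else {}) \<union> (if i \<noteq> 2 then {f'} else {})"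
      "{x \<in> fset t. rk P x \<noteq> i} = (if i \<noteq> 0 then {v} else {}) \<union> (if i \<noteq> 1 then {e} else {}) \<union> (if i \<noteq> 2 then {f} else {})"
      using rks by (auto simp: fset_def)
    show ?thesis unfolding S using i ne by (auto simp: agree_def doubleton_eq_iff)
  qed
  show ?thesis unfolding adj_flag_def
  proof (rule the_equality)
    show "fset (nb i t) \<in> flags P \<and> fset (nb i t) \<noteq> fset t \<and>
      {x \<in> fset (nb i t). rk P x \<noteq> i} = {x \<in> fset t. rk P x \<noteq> i}"
      using nb[OF t i] ag[of "nb i t"] flags_eq fset_inj t by (auto dest: inj_onD)
  next
    fix \<Psi> assume "\<Psi> \<in> flags P \<and> \<Psi> \<noteq> fset t \<and> {x \<in> \<Psi>. rk P x \<noteq> i} = {x \<in> fset t. rk P x \<noteq> i}"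
    moreover from this obtain s where s: "s \<in> FL" "\<Psi> = fset s" unfolding flags_eq by blast
    ultimately have "s \<noteq> t" "agree i t s" using ag[OF s(1)] by auto
    with s show "\<Psi> = fset (nb i t)" using nb_eqI[OF t i] by simp
  qed
qed

end

section \<open>Automorphism groups of tight regular polyhedra\<close>

text \<open>For involutions this is the generated group. Letters are appended on the right because
  automorphisms commute with \<open>nb\<close>: \<open>w * \<rho> i\<close> sends the base flag to
  the \<open>i\<close>-neighbour of its image under \<open>w\<close>.\<close>

inductive_set mon :: "'g::monoid_mult set \<Rightarrow> 'g set" for S where
  one: "1 \<in> mon S"
| step: "w \<in> mon S \<Longrightarrow> s \<in> S \<Longrightarrow> w * s \<in> mon S"

lemma mon_mult: assumes "v \<in> mon S" "w \<in> mon S" shows "v * w \<in> mon S"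
  using assms(2) by induction (use assms(1) in \<open>auto intro: mon.step simp flip: mult.assoc\<close>)

lemma mon_gen: "s \<in> S \<Longrightarrow> s \<in> mon S"
  using mon.step[OF mon.one, of s S] by simp

lemma mon_pow: "w \<in> mon S \<Longrightarrow> w ^ n \<in> mon S"
  by (induction n) (auto intro: mon.one mon_mult)

lemma finite_order_ex:
  fixes x y :: "'g::monoid_mult"
  assumes "finite (range (\<lambda>n::nat. x ^ n))" and yx: "y * x = 1"
  shows "\<exists>n>0. x ^ n = 1"
proof -
  have "\<not> inj (\<lambda>n::nat. x ^ n)" using assms(1) finite_imageD by blast
  then obtain m n :: nat where mn: "x ^ m = x ^ n" "m < n" unfolding inj_def by (metis linorder_neqE_nat)
  have cancel: "u = v" if "x ^ k * u = x ^ k * v" for k u v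
    using that
  proof (induction k)
    case (Suc k)
    have "y * (x * (x ^ k * u)) = y * (x * (x ^ k * v))" using Suc.prems by (simp add: mult.assoc)
    then have "x ^ k * u = x ^ k * v" by (simp add: yx flip: mult.assoc)
    then show ?case by (rule Suc.IH)
  qed simp
  have "m + (n - m) = n" using mn by simp
  then have "x ^ m * x ^ (n - m) = x ^ m * 1" using mn(1) by (metis power_add mult.right_neutral)
  then have "x ^ (n - m) = 1" by (rule cancel)
  then show ?thesis using mn(2) by (metis zero_less_diff)
qed

text \<open>The last conclusion, that \<open>t\<close> is not a power of \<open>s * t\<close>, is
  needed beside the order: it separates rotations from reflections and so doubles the count.\<close>

lemma dihedral_order:
  fixes s t :: "'g::monoid_mult"
  assumes ss: "s * s = 1" and tt: "t * t = 1" and ne: "s \<noteq> 1" "t \<noteq> 1" and fin: "finite (mon {s, t})"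
  shows "\<exists>n>0. (s * t) ^ n = 1 \<and> card (mon {s, t}) = 2 * n \<and> (\<forall>i. zp (s * t) n i = 1 \<longleftrightarrow> int n dvd i) \<and>
    (\<forall>i. zp (s * t) n i \<noteq> t)"
proof -
  have st: "s * t \<in> mon {s, t}" by (intro mon_mult mon_gen) auto
  have "range (\<lambda>n. (s * t) ^ n) \<subseteq> mon {s, t}" using mon_pow[OF st] by blast
  then have "finite (range (\<lambda>n::nat. (s * t) ^ n))" using fin finite_subset by blast
  moreover have "(t * s) * (s * t) = 1" by (metis mult.assoc mult_1_left ss tt)
  ultimately have ex: "\<exists>n. n > 0 \<and> (s * t) ^ n = 1" using finite_order_ex by blast
  define n where "n = (LEAST n. n > 0 \<and> (s * t) ^ n = 1)"
  have n: "n > 0" "(s * t) ^ n = 1" and least: "\<And>m. m > 0 \<Longrightarrow> (s * t) ^ m = 1 \<Longrightarrow> n \<le> m"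
    using LeastI_ex[OF ex] Least_le[of "\<lambda>n. n > 0 \<and> (s * t) ^ n = 1"] by (auto simp: n_def)
  \<comment> \<open>The third generator 1 makes the calculus of \<open>U\<close> and
    \<open>B\<close> available; the exponent 2 is right since \<open>t * 1\<close> is an
    involution.\<close>
  interpret C: coxeter_pair s t 1 n 2
    by unfold_locales (use ss tt n in \<open>auto simp: power2_eq_square\<close>)
  have U1: "C.U i = 1 \<longleftrightarrow> int n dvd i" for i
  proof
    assume "C.U i = 1"
    then have "(s * t) ^ nat (i mod int n) = 1" by (simp add: C.U_def zp_def)
    moreover have "nat (i mod int n) < n" using n(1) by (simp add: nat_less_iff)
    ultimately have "nat (i mod int n) = 0" using least by (metis gr0I not_less)
    moreover have "i mod int n \<ge> 0" using n(1) by simp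
    ultimately have "i mod int n = 0" by linarith
    then show "int n dvd i" by (simp add: dvd_eq_mod_eq_0)
  next
    assume "int n dvd i"
    then show "C.U i = 1" using C.U_cong[of i 0] by simp
  qed
  \<comment> \<open>If \<open>t\<close> were \<open>U i\<close>, then \<open>s\<close> would be
    \<open>U (i + 1)\<close>. As both are involutions, \<open>n\<close> divides \<open>2 * i\<close>
    and \<open>2 * (i + 1)\<close>, hence 2. Then it divides whichever of \<open>i\<close> and
    \<open>i + 1\<close> is even, so \<open>t\<close> or \<open>s\<close> is 1.\<close>
  have nt: "C.U i \<noteq> t" for i
  proof
    assume t: "C.U i = t"
    have "C.U (2 * i) = C.U i * C.U i" by (simp only: C.UU mult_2)
    then have i1: "int n dvd 2 * i" using t tt U1 by metis
    have s: "C.U (i + 1) = s"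
    proof -
      have "C.U (i + 1) = C.U 1 * C.U i" by (simp add: add.commute)
      also have "\<dots> = s * (t * t)" unfolding t C.U1 by (rule mult.assoc)
      finally show ?thesis using tt by simp
    qed
    have "C.U (2 * (i + 1)) = C.U (i + 1) * C.U (i + 1)" by (simp only: C.UU mult_2)
    then have i2: "int n dvd 2 * (i + 1)" using s ss U1 by metis
    have n2: "int n dvd 2" using dvd_diff[OF i2 i1] by (simp add: algebra_simps)
    show False
    proof (cases "even i")
      case True
      then have "int n dvd i" using n2 dvd_trans by blast
      then show False using U1 t ne by metis
    next
      case False
      then have "int n dvd i + 1" using n2 dvd_trans even_plus_one_iff[of i] by blast
      then show False using U1 s ne by metis
    qed
  qed
  have D: "mon {s, t} = C.D"
  proof
    show "mon {s, t} \<subseteq> C.D"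
    proof
      fix w assume "w \<in> mon {s, t}"
      then show "w \<in> C.D"
      proof induction
        case one
        show ?case using C.DI[of 0 False] by simp
      next
        case (step w u)
        then obtain i e where w: "w = C.U i * C.B e" by (auto simp: C.D_def)
        consider "u = s" | "u = t" using step by auto
        then show ?case
        proof cases
          case 1
          have "C.B e * s = C.B e * (C.U 1 * t)" by (simp only: C.a_nf[symmetric])
          also have "\<exists>j. \<dots> = C.U j * C.B (\<not> e)" using C.BU[of e 1] by (metis C.bB(3))
          finally obtain j where "C.B e * s = C.U j * C.B (\<not> e)" by blast
          then have "w * u = C.U (i + j) * C.B (\<not> e)" by (simp add: w 1 mult.assoc)
          then show ?thesis by auto
        next
          case 2
          then have "w * u = C.U i * C.B (\<not> e)" by (simp add: w mult.assoc)
          then show ?thesis by auto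
        qed
      qed
    qed
    show "C.D \<subseteq> mon {s, t}"
    proof
      fix w assume "w \<in> C.D"
      then obtain i e where w: "w = C.U i * C.B e" by (auto simp: C.D_def)
      have "C.U i \<in> mon {s, t}" unfolding C.U_def zp_def by (rule mon_pow[OF st])
      moreover have "C.B e \<in> mon {s, t}" by (auto simp: C.B_def intro: mon.one mon_gen)
      ultimately show "w \<in> mon {s, t}" unfolding w by (rule mon_mult)
    qed
  qed
  let ?f = "\<lambda>(i, e). C.U i * C.B e" and ?A = "{0..<int n} \<times> (UNIV :: bool set)"
  have inj: "inj_on ?f ?A"
  proof (rule inj_onI, simp only: split_paired_all mem_Sigma_iff split prod.inject)
    fix i e j f assume ij: "i \<in> {0..<int n} \<and> e \<in> UNIV" "j \<in> {0..<int n} \<and> f \<in> UNIV"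
      and eq: "C.U i * C.B e = C.U j * C.B f"
    have "C.U (i - j) = C.U (- j) * (C.U i * C.B e) * C.B e" by (simp add: mult.assoc)
    also have "\<dots> = C.B (f \<noteq> e)" unfolding eq by (simp add: mult.assoc)
    finally have ef: "C.U (i - j) = C.B (f \<noteq> e)" .
    then have "f = e" using nt[of "i - j"] by (auto simp: C.B_def split: if_splits)
    then have "int n dvd i - j" using ef U1 by (simp add: C.B_def)
    then have "i mod int n = j mod int n" by (simp add: mod_eq_dvd_iff)
    then show "i = j \<and> e = f" using ij \<open>f = e\<close> by simp
  qed
  have "C.D = ?f ` ?A"
  proof
    show "C.D \<subseteq> ?f ` ?A"
    proof
      fix w assume "w \<in> C.D"
      then obtain i e where w: "w = C.U i * C.B e" by (auto simp: C.D_def)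
      have "w = C.U (i mod int n) * C.B e" unfolding w using C.U_cong[of i "i mod int n"] by simp
      then show "w \<in> ?f ` ?A" using n(1) by (intro image_eqI[of _ _ "(i mod int n, e)"]) auto
    qed
  qed auto
  then have "card (mon {s, t}) = 2 * n" using card_image[OF inj] by (simp add: D card_cartesian_product)
  then show ?thesis using n U1 nt by (intro exI[of _ n]) (simp add: C.U_def)
qed

section \<open>Automorphisms and their free action on flags\<close>

context finite_polyhedron begin

definition Aut :: "('a \<Rightarrow> 'a) set" where "Aut = carrier (aut_group P)"

text \<open>Members of \<open>Bij\<close> take the value \<open>undefined\<close> off the carrier.
  Extending by the identity turns them into elements of a monoid type, where the results on triples
  apply.\<close>

definition ext :: "('a \<Rightarrow> 'a) \<Rightarrow> 'a endo" where
  "ext \<gamma> = Endo (\<lambda>x. if x \<in> elems P then \<gamma> x else x)"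

definition \<Gamma> :: "'a endo set" where
  "\<Gamma> = {g. bij_betw (app g) (elems P) (elems P) \<and> (\<forall>x\<in>elems P. rk P (app g x) = rk P x) \<and>
    (\<forall>x\<in>elems P. \<forall>y\<in>elems P. (app g x, app g y) \<in> leq P \<longleftrightarrow> (x, y) \<in> leq P) \<and>
    (\<forall>x. x \<notin> elems P \<longrightarrow> app g x = x)}"

lemma Aut_iff: "\<gamma> \<in> Aut \<longleftrightarrow> \<gamma> \<in> extensional (elems P) \<and> poly_iso_map P P \<gamma>"
  by (auto simp: Aut_def aut_group_def Bij_def poly_iso_map_def)

text \<open>Incidence forgets the direction of the order; the preserved rank restores it.\<close>

lemma poly_iso_map_leq:
  assumes "bij_betw \<gamma> (elems P) (elems P)" "\<And>x. x \<in> elems P \<Longrightarrow> rk P (\<gamma> x) = rk P x"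
  shows "(\<forall>x\<in>elems P. \<forall>y\<in>elems P. incident P x y \<longleftrightarrow> incident P (\<gamma> x) (\<gamma> y)) \<longleftrightarrow>
    (\<forall>x\<in>elems P. \<forall>y\<in>elems P. (\<gamma> x, \<gamma> y) \<in> leq P \<longleftrightarrow> (x, y) \<in> leq P)" (is "?l \<longleftrightarrow> ?r")
proof
  assume l: ?l
  show ?r
  proof (intro ballI)
    fix x y assume xy: "x \<in> elems P" "y \<in> elems P"
    have eq: "\<gamma> x = \<gamma> y \<longleftrightarrow> x = y" using assms(1) xy unfolding bij_betw_def by (auto dest: inj_onD)
    have "\<gamma> x \<in> elems P" using assms(1) xy by (auto simp: bij_betw_def)
    then have refl: "(x, x) \<in> leq P" "(\<gamma> x, \<gamma> x) \<in> leq P" using leq_refl xy by auto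
    show "(\<gamma> x, \<gamma> y) \<in> leq P \<longleftrightarrow> (x, y) \<in> leq P"
    proof (cases "rk P x < rk P y")
      case True
      then show ?thesis using l xy assms(2) incident_iff[of x y] incident_iff[of "\<gamma> x" "\<gamma> y"] by simp
    next
      case False
      then have "(x, y) \<in> leq P \<longleftrightarrow> x = y" "(\<gamma> x, \<gamma> y) \<in> leq P \<longleftrightarrow> \<gamma> x = \<gamma> y"
        using leq_rk[of x y] leq_rk[of "\<gamma> x" "\<gamma> y"] refl assms(2) xy by auto
      then show ?thesis using eq by simp
    qed
  qed
qed (simp add: incident_def)

lemma app_ext: "x \<in> elems P \<Longrightarrow> app (ext \<gamma>) x = \<gamma> x" "x \<notin> elems P \<Longrightarrow> app (ext \<gamma>) x = x"
  by (simp_all add: ext_def)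

lemma ext_Aut: "ext ` Aut = \<Gamma>"
proof
  show "ext ` Aut \<subseteq> \<Gamma>"
  proof
    fix g assume "g \<in> ext ` Aut"
    then obtain \<gamma> where \<gamma>: "poly_iso_map P P \<gamma>" "g = ext \<gamma>" by (auto simp: Aut_iff)
    have "bij_betw (app (ext \<gamma>)) (elems P) (elems P) \<longleftrightarrow> bij_betw \<gamma> (elems P) (elems P)"
      by (rule bij_betw_cong) (simp add: app_ext)
    then show "g \<in> \<Gamma>" using \<gamma> poly_iso_map_leq[of \<gamma>] by (simp add: \<Gamma>_def app_ext poly_iso_map_def)
  qed
  show "\<Gamma> \<subseteq> ext ` Aut"
  proof
    fix g assume g: "g \<in> \<Gamma>"
    define \<gamma> where "\<gamma> = restrict (app g) (elems P)"
    have bij: "bij_betw \<gamma> (elems P) (elems P)"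
      using g bij_betw_cong[of "elems P" \<gamma> "app g"] by (simp add: \<Gamma>_def \<gamma>_def)
    have rk: "\<And>x. x \<in> elems P \<Longrightarrow> rk P (\<gamma> x) = rk P x" using g by (simp add: \<Gamma>_def \<gamma>_def)
    have "\<forall>x\<in>elems P. \<forall>y\<in>elems P. (\<gamma> x, \<gamma> y) \<in> leq P \<longleftrightarrow> (x, y) \<in> leq P"
      using g by (simp add: \<Gamma>_def \<gamma>_def)
    then have "poly_iso_map P P \<gamma>"
      unfolding poly_iso_map_def using bij rk poly_iso_map_leq[OF bij rk] by blast
    then have "\<gamma> \<in> Aut" by (simp add: Aut_iff \<gamma>_def)
    moreover have "g = ext \<gamma>" using g by (intro endo_eqI) (auto simp: \<Gamma>_def \<gamma>_def ext_def)
    ultimately show "g \<in> ext ` Aut" by blast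
  qed
qed

lemma inj_ext: "inj_on ext Aut"
proof (rule inj_onI)
  fix \<gamma> \<delta> assume "\<gamma> \<in> Aut" "\<delta> \<in> Aut" "ext \<gamma> = ext \<delta>"
  then show "\<gamma> = \<delta>" using app_ext by (metis Aut_iff extensionalityI)
qed

lemma \<Gamma>D:
  assumes "g \<in> \<Gamma>"
  shows "x \<in> elems P \<Longrightarrow> app g x \<in> elems P" "x \<in> elems P \<Longrightarrow> rk P (app g x) = rk P x"
    "x \<in> elems P \<Longrightarrow> y \<in> elems P \<Longrightarrow> (app g x, app g y) \<in> leq P \<longleftrightarrow> (x, y) \<in> leq P"
    "x \<in> elems P \<Longrightarrow> y \<in> elems P \<Longrightarrow> app g x = app g y \<longleftrightarrow> x = y" "x \<notin> elems P \<Longrightarrow> app g x = x"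
  using assms by (auto simp: \<Gamma>_def bij_betw_def dest: inj_onD)

lemma one_\<Gamma>: "1 \<in> \<Gamma>"
  by (simp add: \<Gamma>_def)

lemma mult_\<Gamma>: assumes "g \<in> \<Gamma>" "h \<in> \<Gamma>" shows "g * h \<in> \<Gamma>"
proof -
  have "bij_betw (app g \<circ> app h) (elems P) (elems P)"
    using assms by (intro bij_betw_trans[of _ _ "elems P"]) (auto simp: \<Gamma>_def)
  then show ?thesis using \<Gamma>D[OF assms(1)] \<Gamma>D[OF assms(2)] unfolding \<Gamma>_def by simp
qed

lemma inv_\<Gamma>: assumes g: "g \<in> \<Gamma>" shows "\<exists>h\<in>\<Gamma>. g * h = 1 \<and> h * g = 1"
proof -
  define h where "h = Endo (\<lambda>x. if x \<in> elems P then inv_into (elems P) (app g) x else x)"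
  have bij: "bij_betw (app g) (elems P) (elems P)" using g by (simp add: \<Gamma>_def)
  have gh: "app g (app h x) = x" and hg: "app h (app g x) = x" for x
    using bij_betw_inv_into_right[OF bij] bij_betw_inv_into_left[OF bij] \<Gamma>D(1,5)[OF g]
    by (cases "x \<in> elems P"; simp add: h_def)+
  have h1: "app h x \<in> elems P" if "x \<in> elems P" for x
    using bij_betw_inv_into[OF bij] that by (auto simp: h_def bij_betw_def)
  have "bij_betw (app h) (elems P) (elems P)"
    using bij_betw_inv_into[OF bij] bij_betw_cong[of "elems P" "app h" "inv_into (elems P) (app g)"]
    by (simp add: h_def)
  moreover have "rk P (app h x) = rk P x" if "x \<in> elems P" for x
    using \<Gamma>D(2)[OF g h1[OF that]] gh by simp
  moreover have "(app h x, app h y) \<in> leq P \<longleftrightarrow> (x, y) \<in> leq P" if "x \<in> elems P" "y \<in> elems P" for x y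
    using \<Gamma>D(3)[OF g h1[OF that(1)] h1[OF that(2)]] gh by simp
  ultimately have "h \<in> \<Gamma>" by (simp add: \<Gamma>_def) (simp add: h_def)
  moreover have "g * h = 1" "h * g = 1" by (rule endo_eqI; simp add: gh hg)+
  ultimately show ?thesis by blast
qed

lemma Aut_mult: "\<gamma> \<in> Aut \<Longrightarrow> \<delta> \<in> Aut \<Longrightarrow> \<gamma> \<otimes>\<^bsub>aut_group P\<^esub> \<delta> = compose (elems P) \<gamma> \<delta>"
  by (simp add: aut_group_def Aut_def BijGroup_def)

lemma ext_mult: assumes "\<gamma> \<in> Aut" "\<delta> \<in> Aut" shows "ext (\<gamma> \<otimes>\<^bsub>aut_group P\<^esub> \<delta>) = ext \<gamma> * ext \<delta>"
proof (rule endo_eqI)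
  fix x
  have "ext \<delta> \<in> \<Gamma>" using assms ext_Aut by blast
  then show "app (ext (\<gamma> \<otimes>\<^bsub>aut_group P\<^esub> \<delta>)) x = app (ext \<gamma> * ext \<delta>) x"
    unfolding Aut_mult[OF assms] using \<Gamma>D(1)[of "ext \<delta>" x] by (auto simp: ext_def compose_def)
qed

text \<open>The axioms are pulled back from \<open>\<Gamma>\<close> along the injective map
  \<open>ext\<close>.\<close>

lemma aut_group_group: "group (aut_group P)"
proof (rule groupI)
  have eqI: "\<gamma> = \<delta>" if "\<gamma> \<in> Aut" "\<delta> \<in> Aut" "ext \<gamma> = ext \<delta>" for \<gamma> \<delta>
    using inj_ext that by (auto dest: inj_onD)
  have ex: "\<exists>\<gamma>\<in>Aut. ext \<gamma> = g" if "g \<in> \<Gamma>" for g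
    using that unfolding ext_Aut[symmetric] by auto
  have mem: "ext \<gamma> \<in> \<Gamma>" if "\<gamma> \<in> Aut" for \<gamma> using ext_Aut that by auto
  have closed: "\<gamma> \<otimes>\<^bsub>aut_group P\<^esub> \<delta> \<in> Aut" if *: "\<gamma> \<in> Aut" "\<delta> \<in> Aut" for \<gamma> \<delta>
  proof -
    have "ext \<gamma> * ext \<delta> \<in> \<Gamma>" using mem * mult_\<Gamma> by blast
    then obtain \<eta> where \<eta>: "\<eta> \<in> Aut" "ext \<eta> = ext \<gamma> * ext \<delta>" using ex by blast
    have "\<gamma> \<otimes>\<^bsub>aut_group P\<^esub> \<delta> = \<eta>"
    proof (rule extensionalityI[of _ "elems P"])
      show "\<gamma> \<otimes>\<^bsub>aut_group P\<^esub> \<delta> \<in> extensional (elems P)" by (simp add: Aut_mult *)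
      show "\<eta> \<in> extensional (elems P)" using \<eta> Aut_iff by blast
      show "(\<gamma> \<otimes>\<^bsub>aut_group P\<^esub> \<delta>) x = \<eta> x" if "x \<in> elems P" for x
        using \<eta>(2) ext_mult[OF *] app_ext(1)[OF that] by metis
    qed
    then show ?thesis using \<eta> by simp
  qed
  have one: "\<one>\<^bsub>aut_group P\<^esub> \<in> Aut" "ext \<one>\<^bsub>aut_group P\<^esub> = 1"
  proof -
    have o: "\<one>\<^bsub>aut_group P\<^esub> = (\<lambda>x\<in>elems P. x)" by (simp add: aut_group_def BijGroup_def)
    show "\<one>\<^bsub>aut_group P\<^esub> \<in> Aut" unfolding o Aut_iff poly_iso_map_def
      by (auto simp: bij_betw_def inj_on_def)
    show "ext \<one>\<^bsub>aut_group P\<^esub> = 1" unfolding o by (rule endo_eqI) (simp add: ext_def)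
  qed
  show "\<gamma> \<otimes>\<^bsub>aut_group P\<^esub> \<delta> \<in> carrier (aut_group P)"
    if "\<gamma> \<in> carrier (aut_group P)" "\<delta> \<in> carrier (aut_group P)" for \<gamma> \<delta>
    using closed that by (simp add: Aut_def)
  show "\<one>\<^bsub>aut_group P\<^esub> \<in> carrier (aut_group P)" using one by (simp add: Aut_def)
  show "\<gamma> \<otimes>\<^bsub>aut_group P\<^esub> \<delta> \<otimes>\<^bsub>aut_group P\<^esub> \<eta> = \<gamma> \<otimes>\<^bsub>aut_group P\<^esub> (\<delta> \<otimes>\<^bsub>aut_group P\<^esub> \<eta>)"
    if "\<gamma> \<in> carrier (aut_group P)" "\<delta> \<in> carrier (aut_group P)" "\<eta> \<in> carrier (aut_group P)" for \<gamma> \<delta> \<eta>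
    by (rule eqI) (use that closed in \<open>simp_all add: Aut_def[symmetric] ext_mult mult.assoc\<close>)
  show "\<one>\<^bsub>aut_group P\<^esub> \<otimes>\<^bsub>aut_group P\<^esub> \<gamma> = \<gamma>" if "\<gamma> \<in> carrier (aut_group P)" for \<gamma>
    by (rule eqI) (use that closed one in \<open>simp_all add: Aut_def[symmetric] ext_mult\<close>)
  show "\<exists>\<delta>\<in>carrier (aut_group P). \<delta> \<otimes>\<^bsub>aut_group P\<^esub> \<gamma> = \<one>\<^bsub>aut_group P\<^esub>"
    if "\<gamma> \<in> carrier (aut_group P)" for \<gamma>
  proof -
    have \<gamma>: "\<gamma> \<in> Aut" using that by (simp add: Aut_def)
    obtain h where h: "h \<in> \<Gamma>" "h * ext \<gamma> = 1" using inv_\<Gamma> mem[OF \<gamma>] by blast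
    obtain \<delta> where \<delta>: "\<delta> \<in> Aut" "ext \<delta> = h" using ex h by blast
    have "\<delta> \<otimes>\<^bsub>aut_group P\<^esub> \<gamma> = \<one>\<^bsub>aut_group P\<^esub>"
      by (rule eqI) (use \<gamma> \<delta> h closed one in \<open>simp_all add: ext_mult\<close>)
    then show ?thesis using \<delta> by (auto simp: Aut_def)
  qed
qed

definition act :: "'a endo \<Rightarrow> 'a \<times> 'a \<times> 'a \<Rightarrow> 'a \<times> 'a \<times> 'a" where
  "act g = (\<lambda>(v, e, f). (app g v, app g e, app g f))"

lemma act_simp [simp]: "act g (v, e, f) = (app g v, app g e, app g f)" by (simp add: act_def)
lemma act_mult: "act (g * h) t = act g (act h t)" by (cases t) simp
lemma act_one [simp]: "act 1 t = t" by (cases t) simp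

lemma act_FL: assumes "g \<in> \<Gamma>" "t \<in> FL" shows "act g t \<in> FL"
proof -
  obtain v e f where [simp]: "t = (v, e, f)" by (metis prod_cases3)
  show ?thesis using assms(2) \<Gamma>D[OF assms(1)] by (simp add: FL_def of_rank_def)
qed

lemma act_nb: assumes "g \<in> \<Gamma>" "t \<in> FL" "i \<in> {0, 1, 2}" shows "act g (nb i t) = nb i (act g t)"
proof (rule nb_eqI[symmetric])
  have n: "nb i t \<in> FL" "nb i t \<noteq> t" "agree i t (nb i t)" using nb assms by blast+
  obtain v e f v' e' f' where t: "t = (v, e, f)" and t': "nb i t = (v', e', f')" by (metis prod_cases3)
  show "act g (nb i t) \<in> FL" "act g t \<in> FL" using act_FL assms n by blast+
  have n': "(v', e', f') \<in> FL" "(v', e', f') \<noteq> (v, e, f)" "agree i (v, e, f) (v', e', f')" "(v, e, f) \<in> FL"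
    using n assms(2) unfolding t' unfolding t by auto
  have el: "v \<in> elems P" "e \<in> elems P" "f \<in> elems P" "v' \<in> elems P" "e' \<in> elems P" "f' \<in> elems P"
    using FL_rk n' by auto
  show "act g (nb i t) \<noteq> act g t" unfolding t' unfolding t using n'(2) el \<Gamma>D(4)[OF assms(1)] by simp
  show "agree i (act g t) (act g (nb i t))" unfolding t' unfolding t using n'(3) by (auto simp: agree_def)
qed (rule assms(3))

text \<open>Automorphisms commute with \<open>nb\<close>, so agreement on one flag spreads to all
  flags, and every element lies in a flag.\<close>

lemma act_free:
  assumes g: "g \<in> \<Gamma>" and h: "h \<in> \<Gamma>" and t: "t \<in> FL" and eq: "act g t = act h t"
  shows "g = h"
proof (rule endo_eqI)
  fix x
  have all: "act g s = act h s" if "s \<in> FL" for s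
  proof -
    have "(t, s) \<in> reach {0, 1, 2}" using reach_all t that by blast
    then have "s \<in> FL \<and> act g s = act h s" unfolding reach_def
      by (induction rule: rtrancl_induct) (use t eq act_nb g h nb in auto)
    then show ?thesis by blast
  qed
  show "app g x = app h x"
  proof (cases "x \<in> elems P")
    case True
    then obtain s where s: "s \<in> FL" "x \<in> fset s" using in_flag by blast
    then show ?thesis using all[OF s(1)] by (cases s) (auto simp: fset_def)
  next
    case False
    then show ?thesis using \<Gamma>D(5) g h by simp
  qed
qed

lemma fset_act: "fset (act g t) = app g ` fset t"
  by (cases t) (simp add: fset_def)

end

section \<open>The tight triple of a tight regular polyhedron\<close>

locale tight_polyhedron = finite_polyhedron P for P :: "'a ranked_poset" +
  fixes p q :: nat and t0 :: "'a \<times> 'a \<times> 'a" and v0 e0 f0 :: 'a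
  assumes p2: "p \<ge> 2" and q2: "q \<ge> 2" and tight: "tight_regular p q P" and t0: "t0 \<in> FL"
    and t0_eq: "t0 = (v0, e0, f0)"
begin

declare One_nat_def [simp del]

lemma act_trans: assumes "t \<in> FL" shows "\<exists>g\<in>\<Gamma>. act g t0 = t"
proof -
  have "fset t0 \<in> flags P" "fset t \<in> flags P" using flags_eq t0 assms by auto
  then obtain \<gamma> where \<gamma>: "\<gamma> \<in> Aut" "\<gamma> ` fset t0 = fset t"
    using tight unfolding tight_regular_def regular_poly_def Aut_def by blast
  have g: "ext \<gamma> \<in> \<Gamma>" using ext_Aut \<gamma> by blast
  have "fset t0 \<subseteq> elems P" using t0 FL_rk by (cases t0) (auto simp: fset_def)
  then have "fset (act (ext \<gamma>) t0) = fset t"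
    unfolding fset_act \<gamma>(2)[symmetric] by (intro image_cong) (auto simp: app_ext)
  then have "act (ext \<gamma>) t0 = t" using fset_inj act_FL[OF g t0] assms by (auto dest: inj_onD)
  then show ?thesis using g by blast
qed

definition \<rho> :: "nat \<Rightarrow> 'a endo" where "\<rho> i = (THE g. g \<in> \<Gamma> \<and> act g t0 = nb i t0)"

lemma \<rho>: assumes "i \<in> {0, 1, 2}" shows "\<rho> i \<in> \<Gamma> \<and> act (\<rho> i) t0 = nb i t0"
proof -
  obtain g where g: "g \<in> \<Gamma>" "act g t0 = nb i t0" using act_trans nb t0 assms by blast
  show ?thesis unfolding \<rho>_def
    by (rule theI[of _ g]) (use g act_free t0 in auto)
qed

lemma \<rho>_rho: assumes "i \<in> {0, 1, 2}" shows "rho P (fset t0) i \<in> Aut \<and> ext (rho P (fset t0) i) = \<rho> i"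
proof -
  have "\<rho> i \<in> ext ` Aut" unfolding ext_Aut using \<rho>[OF assms] by blast
  then obtain \<gamma> where \<gamma>: "\<gamma> \<in> Aut" "ext \<gamma> = \<rho> i" by auto
  have el: "fset t0 \<subseteq> elems P" using t0 FL_rk by (cases t0) (auto simp: fset_def)
  have im: "\<delta> ` fset t0 = fset (act (ext \<delta>) t0)" for \<delta>
    unfolding fset_act using el by (intro image_cong) (auto simp: app_ext)
  have "rho P (fset t0) i = \<gamma>" unfolding rho_def adj_flag_eq[OF t0 assms] Aut_def[symmetric]
  proof (rule the_equality)
    show "\<gamma> \<in> Aut \<and> \<gamma> ` fset t0 = fset (nb i t0)" using \<gamma> im \<rho>[OF assms] by simp
    fix \<delta> assume \<delta>: "\<delta> \<in> Aut \<and> \<delta> ` fset t0 = fset (nb i t0)"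
    then have \<delta>\<Gamma>: "ext \<delta> \<in> \<Gamma>" using ext_Aut by blast
    have "fset (act (ext \<delta>) t0) = fset (nb i t0)" using \<delta> im by simp
    then have "act (ext \<delta>) t0 = nb i t0"
      using fset_inj act_FL[OF \<delta>\<Gamma> t0] nb[OF t0 assms] by (auto dest: inj_onD)
    then have "ext \<delta> = \<rho> i" using act_free[OF \<delta>\<Gamma> _ t0] \<rho>[OF assms] by simp
    then show "\<delta> = \<gamma>" using \<gamma> \<delta> by (intro inj_onD[OF inj_ext]) auto
  qed
  then show ?thesis using \<gamma> by simp
qed

lemma \<rho>\<Gamma>: "\<rho> 0 \<in> \<Gamma>" "\<rho> 1 \<in> \<Gamma>" "\<rho> 2 \<in> \<Gamma>" using \<rho> by auto

lemma \<rho>_invol: assumes "i \<in> {0, 1, 2}" shows "\<rho> i * \<rho> i = 1" "\<rho> i \<noteq> 1"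
proof -
  show "\<rho> i * \<rho> i = 1"
    by (rule act_free[OF mult_\<Gamma> one_\<Gamma> t0])
      (use \<rho>[OF assms] nb_nb[OF t0 assms] act_nb[OF _ t0 assms] in \<open>simp_all add: act_mult\<close>)
  show "\<rho> i \<noteq> 1" using \<rho>[OF assms] nb[OF t0 assms] by auto
qed

lemma \<rho>02: "\<rho> 0 * \<rho> 2 = \<rho> 2 * \<rho> 0"
  by (rule act_free[OF mult_\<Gamma> mult_\<Gamma> t0])
    (use \<rho>[of 0] \<rho>[of 2] nb02[OF t0] act_nb[OF _ t0, of _ 0] act_nb[OF _ t0, of _ 2] in \<open>simp_all add: act_mult\<close>)

lemma mon_\<Gamma>: assumes "I \<subseteq> {0, 1, 2}" shows "mon (\<rho> ` I) \<subseteq> \<Gamma>"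
proof
  fix w assume "w \<in> mon (\<rho> ` I)"
  then show "w \<in> \<Gamma>" by induction (use assms \<rho> in \<open>auto intro: one_\<Gamma> mult_\<Gamma>\<close>)
qed

lemma reach_mon:
  assumes I: "I \<subseteq> {0, 1, 2}" and r: "(t0, t) \<in> reach I"
  shows "\<exists>w\<in>mon (\<rho> ` I). act w t0 = t"
  using r unfolding reach_def
proof (induction rule: rtrancl_induct)
  case base
  then show ?case using mon.one by force
next
  case (step s t)
  then obtain i w where i: "i \<in> I" "t = nb i s" and w: "w \<in> mon (\<rho> ` I)" "act w t0 = s" by auto
  have "act (w * \<rho> i) t0 = act w (nb i t0)" using \<rho> i I by (auto simp: act_mult)
  also have "\<dots> = t" using act_nb[OF _ t0, of w i] w mon_\<Gamma>[OF I] i I by auto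
  finally show ?case using mon.step[OF w(1), of "\<rho> i"] i by blast
qed

lemma base_elems: "v0 \<in> elems P" "e0 \<in> elems P" "f0 \<in> elems P" "rk P v0 = 0" "rk P e0 = 1" "rk P f0 = 2"
  using t0 FL_rk[of v0 e0 f0] by (auto simp: t0_eq)

lemma \<rho>_fix: "app (\<rho> 1) v0 = v0" "app (\<rho> 2) v0 = v0" "app (\<rho> 0) e0 = e0" "app (\<rho> 2) e0 = e0"
  "app (\<rho> 0) f0 = f0" "app (\<rho> 1) f0 = f0"
  using \<rho>[of 0] \<rho>[of 1] \<rho>[of 2] nb[OF t0, of 0] nb[OF t0, of 1] nb[OF t0, of 2]
  by (auto simp: t0_eq agree_def split: prod.splits)

lemma mon_fix: "w \<in> mon S \<Longrightarrow> (\<And>s. s \<in> S \<Longrightarrow> app s x = x) \<Longrightarrow> app w x = x"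
  by (induction rule: mon.induct) auto

text \<open>An automorphism fixing \<open>x\<close> sends the base flag to a flag that is reachable
  by changes in \<open>I\<close>. A word in the corresponding generators has the same effect on the
  base flag, and the action is free.\<close>

lemma stab:
  assumes I: "I \<subseteq> {0, 1, 2}" and fixes_x: "\<And>i. i \<in> I \<Longrightarrow> app (\<rho> i) x = x"
    and orbit: "app g x = x \<Longrightarrow> (t0, act g t0) \<in> reach I" and g: "g \<in> \<Gamma>"
  shows "app g x = x \<longleftrightarrow> g \<in> mon (\<rho> ` I)"
proof
  assume x: "app g x = x"
  obtain w where w: "w \<in> mon (\<rho> ` I)" "act w t0 = act g t0"
    using reach_mon[OF I orbit[OF x]] by blast
  then have "w = g" using act_free[OF _ g t0] mon_\<Gamma>[OF I] by blast
  then show "g \<in> mon (\<rho> ` I)" using w by simp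
next
  assume "g \<in> mon (\<rho> ` I)"
  then show "app g x = x" by (rule mon_fix) (use fixes_x in auto)
qed

lemma stab_v: assumes g: "g \<in> \<Gamma>" shows "app g v0 = v0 \<longleftrightarrow> g \<in> mon {\<rho> 1, \<rho> 2}"
proof -
  have "app g v0 = v0 \<longleftrightarrow> g \<in> mon (\<rho> ` {1, 2})"
  proof (rule stab[OF _ _ _ g])
    show "(t0, act g t0) \<in> reach {1, 2}" if "app g v0 = v0"
      using reach_vertex act_FL[OF g t0] t0 that by (simp add: t0_eq)
  qed (auto simp: \<rho>_fix)
  then show ?thesis by simp
qed

lemma stab_e: assumes g: "g \<in> \<Gamma>" shows "app g e0 = e0 \<longleftrightarrow> g \<in> mon {\<rho> 0, \<rho> 2}"
proof -
  have "app g e0 = e0 \<longleftrightarrow> g \<in> mon (\<rho> ` {0, 2})"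
  proof (rule stab[OF _ _ _ g])
    show "(t0, act g t0) \<in> reach {0, 2}" if "app g e0 = e0"
      using reach_edge act_FL[OF g t0] t0 that by (simp add: t0_eq)
  qed (auto simp: \<rho>_fix)
  then show ?thesis by simp
qed

lemma stab_f: assumes g: "g \<in> \<Gamma>" shows "app g f0 = f0 \<longleftrightarrow> g \<in> mon {\<rho> 0, \<rho> 1}"
proof -
  have "app g f0 = f0 \<longleftrightarrow> g \<in> mon (\<rho> ` {0, 1})"
  proof (rule stab[OF _ _ _ g])
    show "(t0, act g t0) \<in> reach {0, 1}" if "app g f0 = f0"
      using reach_face act_FL[OF g t0] t0 that by (simp add: t0_eq)
  qed (auto simp: \<rho>_fix)
  then show ?thesis by simp
qed

text \<open>Counts subsets of the group as sets of flags: regularity gives surjectivity, freeness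
  injectivity.\<close>

lemma bij_act: assumes "\<And>g. g \<in> \<Gamma> \<Longrightarrow> Q (act g t0) \<longleftrightarrow> g \<in> S"
  shows "card {t \<in> FL. Q t} = card (\<Gamma> \<inter> S)"
proof -
  have "bij_betw (\<lambda>g. act g t0) (\<Gamma> \<inter> S) {t \<in> FL. Q t}"
    unfolding bij_betw_def
  proof
    show "inj_on (\<lambda>g. act g t0) (\<Gamma> \<inter> S)" by (rule inj_onI) (use act_free t0 in blast)
    show "(\<lambda>g. act g t0) ` (\<Gamma> \<inter> S) = {t \<in> FL. Q t}"
    proof
      show "(\<lambda>g. act g t0) ` (\<Gamma> \<inter> S) \<subseteq> {t \<in> FL. Q t}" using assms act_FL t0 by blast
      show "{t \<in> FL. Q t} \<subseteq> (\<lambda>g. act g t0) ` (\<Gamma> \<inter> S)" using assms act_trans by blast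
    qed
  qed
  then show ?thesis by (metis bij_betw_same_card)
qed

lemma finite_FL: "finite FL"
  by (rule finite_subset[of _ "elems P \<times> elems P \<times> elems P"]) (use fin in \<open>auto simp: FL_def of_rank_def\<close>)

lemma finite_\<Gamma>: "finite \<Gamma>"
proof (rule finite_imageD)
  show "finite ((\<lambda>g. act g t0) ` \<Gamma>)" by (rule finite_subset[OF _ finite_FL]) (use act_FL t0 in blast)
  show "inj_on (\<lambda>g. act g t0) \<Gamma>" by (rule inj_onI) (use act_free t0 in blast)
qed

lemma card_\<Gamma>: "card \<Gamma> = 2 * p * q"
proof -
  have "card \<Gamma> = card FL" using bij_act[of "\<lambda>_. True" UNIV] by simp
  also have "\<dots> = card (flags P)" unfolding flags_eq using fset_inj by (simp add: card_image)
  finally show ?thesis using tight by (simp add: tight_regular_def)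
qed

lemma card_vertex_flags: "card {t \<in> FL. fst t = v0} = 2 * q"
proof -
  have v0: "v0 \<in> vertices P" using base_elems by (simp add: of_rank_def)
  let ?A = "{e \<in> edges P. (v0, e) \<in> leq P}" and ?B = "\<lambda>e. {f \<in> faces P. (e, f) \<in> leq P}"
  have "{t \<in> FL. fst t = v0} = (\<lambda>(e, f). (v0, e, f)) ` (SIGMA e:?A. ?B e)"
    using v0 by (auto simp: FL_def)
  moreover have "inj_on (\<lambda>(e, f). (v0, e, f)) (SIGMA e:?A. ?B e)" by (auto simp: inj_on_def)
  ultimately have "card {t \<in> FL. fst t = v0} = card (SIGMA e:?A. ?B e)" by (simp add: card_image)
  also have "\<dots> = (\<Sum>e\<in>?A. card (?B e))" by (rule card_SigmaI) (use fin in \<open>auto simp: of_rank_def\<close>)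
  also have "\<dots> = (\<Sum>e\<in>?A. 2)" by (rule sum.cong) (use edge_faces in auto)
  also have "\<dots> = 2 * card ?A" by simp
  also have "?A = {e \<in> edges P. incident P v0 e}" using incident_leq(1)[OF v0] by auto
  also have "card \<dots> = q" using tight v0 unfolding tight_regular_def has_type_def by blast
  finally show ?thesis .
qed

lemma card_face_flags: "card {t \<in> FL. snd (snd t) = f0} = 2 * p"
proof -
  have f0: "f0 \<in> faces P" using base_elems by (simp add: of_rank_def)
  let ?A = "{e \<in> edges P. (e, f0) \<in> leq P}" and ?B = "\<lambda>e. {v \<in> vertices P. (v, e) \<in> leq P}"
  have "{t \<in> FL. snd (snd t) = f0} = (\<lambda>(e, v). (v, e, f0)) ` (SIGMA e:?A. ?B e)"
    using f0 by (auto simp: FL_def)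
  moreover have "inj_on (\<lambda>(e, v). (v, e, f0)) (SIGMA e:?A. ?B e)" by (auto simp: inj_on_def)
  ultimately have "card {t \<in> FL. snd (snd t) = f0} = card (SIGMA e:?A. ?B e)" by (simp add: card_image)
  also have "\<dots> = (\<Sum>e\<in>?A. card (?B e))" by (rule card_SigmaI) (use fin in \<open>auto simp: of_rank_def\<close>)
  also have "\<dots> = (\<Sum>e\<in>?A. 2)" by (rule sum.cong) (use edge_vertices in auto)
  also have "\<dots> = 2 * card ?A" by simp
  also have "?A = {e \<in> edges P. incident P e f0}" using incident_leq(2)[OF _ f0] by auto
  also have "card \<dots> = p" using tight f0 unfolding tight_regular_def has_type_def by blast
  finally show ?thesis .
qed

lemma card_mon_v: "card (mon {\<rho> 1, \<rho> 2}) = 2 * q"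
proof -
  have "card {t \<in> FL. fst t = v0} = card (\<Gamma> \<inter> mon {\<rho> 1, \<rho> 2})"
    by (rule bij_act) (simp add: t0_eq stab_v)
  moreover have "\<Gamma> \<inter> mon {\<rho> 1, \<rho> 2} = mon {\<rho> 1, \<rho> 2}" using mon_\<Gamma>[of "{1, 2}"] by auto
  ultimately show ?thesis using card_vertex_flags by simp
qed

lemma card_mon_f: "card (mon {\<rho> 0, \<rho> 1}) = 2 * p"
proof -
  have "card {t \<in> FL. snd (snd t) = f0} = card (\<Gamma> \<inter> mon {\<rho> 0, \<rho> 1})"
    by (rule bij_act) (simp add: t0_eq stab_f)
  moreover have "\<Gamma> \<inter> mon {\<rho> 0, \<rho> 1} = mon {\<rho> 0, \<rho> 1}" using mon_\<Gamma>[of "{0, 1}"] by auto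
  ultimately show ?thesis using card_face_flags by simp
qed

text \<open>The dihedral stabiliser of the base face has as many elements as the face has flags,
  namely \<open>2 * p\<close>, so its rotation has order exactly \<open>p\<close>.\<close>

lemma face_order: "(\<rho> 0 * \<rho> 1) ^ p = 1" "zp (\<rho> 0 * \<rho> 1) p i = 1 \<longleftrightarrow> int p dvd i" "zp (\<rho> 0 * \<rho> 1) p i \<noteq> \<rho> 1"
proof -
  have "finite (mon {\<rho> 0, \<rho> 1})" using mon_\<Gamma>[of "{0, 1}"] finite_\<Gamma> finite_subset by auto
  then obtain n where "(\<rho> 0 * \<rho> 1) ^ n = 1" "card (mon {\<rho> 0, \<rho> 1}) = 2 * n"
    "\<forall>i. zp (\<rho> 0 * \<rho> 1) n i = 1 \<longleftrightarrow> int n dvd i" "\<forall>i. zp (\<rho> 0 * \<rho> 1) n i \<noteq> \<rho> 1"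
    using dihedral_order[of "\<rho> 0" "\<rho> 1"] \<rho>_invol by auto
  then show "(\<rho> 0 * \<rho> 1) ^ p = 1" "zp (\<rho> 0 * \<rho> 1) p i = 1 \<longleftrightarrow> int p dvd i" "zp (\<rho> 0 * \<rho> 1) p i \<noteq> \<rho> 1"
    using card_mon_f by auto
qed

lemma vertex_order: "(\<rho> 1 * \<rho> 2) ^ q = 1" "zp (\<rho> 1 * \<rho> 2) q i = 1 \<longleftrightarrow> int q dvd i" "zp (\<rho> 1 * \<rho> 2) q i \<noteq> \<rho> 2"
proof -
  have "finite (mon {\<rho> 1, \<rho> 2})" using mon_\<Gamma>[of "{1, 2}"] finite_\<Gamma> finite_subset by auto
  then obtain n where "(\<rho> 1 * \<rho> 2) ^ n = 1" "card (mon {\<rho> 1, \<rho> 2}) = 2 * n"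
    "\<forall>i. zp (\<rho> 1 * \<rho> 2) n i = 1 \<longleftrightarrow> int n dvd i" "\<forall>i. zp (\<rho> 1 * \<rho> 2) n i \<noteq> \<rho> 2"
    using dihedral_order[of "\<rho> 1" "\<rho> 2"] \<rho>_invol by auto
  then show "(\<rho> 1 * \<rho> 2) ^ q = 1" "zp (\<rho> 1 * \<rho> 2) q i = 1 \<longleftrightarrow> int q dvd i" "zp (\<rho> 1 * \<rho> 2) q i \<noteq> \<rho> 2"
    using card_mon_v by auto
qed

sublocale C: coxeter_pair "\<rho> 0" "\<rho> 1" "\<rho> 2" p q
  by unfold_locales (use \<rho>_invol \<rho>02 p2 q2 face_order(1) vertex_order(1) in auto)

lemma C_\<Gamma>: "C.U i \<in> \<Gamma>" "C.V i \<in> \<Gamma>" "C.B e \<in> \<Gamma>"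
proof -
  have pow: "g ^ n \<in> \<Gamma>" if "g \<in> \<Gamma>" for g and n :: nat
    by (induction n) (use that in \<open>auto intro: one_\<Gamma> mult_\<Gamma>\<close>)
  show "C.U i \<in> \<Gamma>" "C.V i \<in> \<Gamma>" "C.B e \<in> \<Gamma>"
    unfolding C.U_def C.V_def C.B_def zp_def using pow mult_\<Gamma> \<rho>\<Gamma> one_\<Gamma> by auto
qed

text \<open>If the product is 1, then \<open>U i\<close> fixes the base vertex, because the other
  factors do, and it always fixes the base face. Only two flags contain both, the base flag and its
  1-neighbour, so \<open>U i\<close> is 1 or \<open>\<rho> 1\<close>, and \<open>\<rho> 1\<close> is
  not a rotation.\<close>

sublocale C: factorized_pair "\<rho> 0" "\<rho> 1" "\<rho> 2" p q
proof
  fix i e j assume eq: "C.U i * (C.B e * C.V j) = 1"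
  let ?w = "C.B e * C.V j"
  have V: "app (C.V k) v0 = v0" for k
  proof -
    have "C.V k \<in> mon {\<rho> 1, \<rho> 2}" unfolding C.V_def zp_def
      by (intro mon_pow mon_mult mon_gen) auto
    then show ?thesis by (rule mon_fix) (auto simp: \<rho>_fix)
  qed
  have w: "app ?w v0 = v0" using V \<rho>_fix by (simp add: C.B_def)
  have "app (C.U i * ?w) v0 = v0" by (simp add: eq)
  then have Uv: "app (C.U i) v0 = v0" using w by simp
  have Uf: "app (C.U i) f0 = f0"
  proof -
    have "C.U i \<in> mon {\<rho> 0, \<rho> 1}" unfolding C.U_def zp_def by (intro mon_pow mon_mult mon_gen) auto
    then show ?thesis by (rule mon_fix) (auto simp: \<rho>_fix)
  qed
  have UFL: "act (C.U i) t0 \<in> FL" using act_FL C_\<Gamma> t0 by blast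
  have U1: "C.U i = 1"
  proof (rule ccontr)
    assume "C.U i \<noteq> 1"
    then have "act (C.U i) t0 \<noteq> t0" using act_free[OF C_\<Gamma>(1) one_\<Gamma> t0] by auto
    then have "nb 1 t0 = act (C.U i) t0"
      by (intro nb_eqI[OF t0 _ UFL]) (use Uv Uf in \<open>auto simp: t0_eq agree_def\<close>)
    then have "C.U i = \<rho> 1" using act_free[OF C_\<Gamma>(1) \<rho>\<Gamma>(2) t0] \<rho>[of 1] by simp
    then show False using face_order(3) by (simp add: C.U_def)
  qed
  then have p: "int p dvd i" using face_order(2) by (simp add: C.U_def)
  have BV: "C.B e * C.V j = 1" using eq U1 by simp
  have "\<not> e"
  proof
    assume e
    then have "\<rho> 1 * C.V j = 1" using BV by simp
    then have "\<rho> 1 * (\<rho> 1 * C.V j) = \<rho> 1" by simp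
    then have Vj: "C.V j = \<rho> 1" by simp
    have "C.V (j + 1) = C.V j * C.V 1" by simp
    also have "\<dots> = \<rho> 2" unfolding Vj C.V1 by simp
    finally show False using vertex_order(3) by (simp add: C.V_def)
  qed
  then have "C.V j = 1" using BV by simp
  then show "int p dvd i \<and> \<not> e \<and> int q dvd j" using p \<open>\<not> e\<close> vertex_order(2) by (simp add: C.V_def)
qed

text \<open>Tightness enters here: the \<open>2 * p * q\<close> normal forms exhaust a group of that
  order, and closure comes for free.\<close>

lemma G_\<Gamma>: "C.G = \<Gamma>"
proof (rule card_subset_eq[OF finite_\<Gamma>])
  show "C.G \<subseteq> \<Gamma>" unfolding C.G_def using C_\<Gamma> mult_\<Gamma> by auto
  show "card C.G = card \<Gamma>" by (simp add: C.card_G card_\<Gamma>)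
qed

sublocale C: tight_triple "\<rho> 0" "\<rho> 1" "\<rho> 2" p q
proof
  show "\<rho> 2 * C.U i \<in> C.G" for i unfolding G_\<Gamma> by (intro mult_\<Gamma> \<rho>\<Gamma> C_\<Gamma>)
qed

text \<open>\<open>generate\<close> allows inverses while \<open>rotations\<close> only multiplies
  by the two products; the inverses are supplied by \<open>U (-1)\<close> and
  \<open>V (-1)\<close>.\<close>

lemma ext_rotation_subgroup: "ext ` rotation_subgroup P (fset t0) = rotations (\<rho> 0) (\<rho> 1) (\<rho> 2)"
  and rotation_subgroup_Aut: "rotation_subgroup P (fset t0) \<subseteq> Aut"
  and subgroup_rotation: "subgroup (rotation_subgroup P (fset t0)) (aut_group P)"
proof -
  interpret A: group "aut_group P" by (rule aut_group_group)
  define a b c where "a = rho P (fset t0) 0" and "b = rho P (fset t0) 1" and "c = rho P (fset t0) 2"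
  have abc: "a \<in> Aut" "b \<in> Aut" "c \<in> Aut" "ext a = \<rho> 0" "ext b = \<rho> 1" "ext c = \<rho> 2"
    using \<rho>_rho by (auto simp: a_def b_def c_def)
  let ?S = "{a \<otimes>\<^bsub>aut_group P\<^esub> b, b \<otimes>\<^bsub>aut_group P\<^esub> c}"
  have rs: "rotation_subgroup P (fset t0) = generate (aut_group P) ?S"
    by (simp add: rotation_subgroup_def a_def b_def c_def)
  have SA: "?S \<subseteq> carrier (aut_group P)" using abc by (auto simp: Aut_def)
  show sub: "subgroup (rotation_subgroup P (fset t0)) (aut_group P)"
    unfolding rs by (rule A.generate_is_subgroup[OF SA])
  show RA: "rotation_subgroup P (fset t0) \<subseteq> Aut" using subgroup.subset[OF sub] by (simp add: Aut_def)
  have ext1: "ext \<one>\<^bsub>aut_group P\<^esub> = 1"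
    by (rule endo_eqI) (simp add: ext_def aut_group_def BijGroup_def)
  have extinv: "ext (inv\<^bsub>aut_group P\<^esub> g) * ext g = 1" if "g \<in> Aut" for g
  proof -
    have g: "g \<in> carrier (aut_group P)" using that by (simp add: Aut_def)
    then have "ext (inv\<^bsub>aut_group P\<^esub> g \<otimes>\<^bsub>aut_group P\<^esub> g) = ext (inv\<^bsub>aut_group P\<^esub> g) * ext g"
      by (intro ext_mult) (simp_all add: Aut_def)
    then show ?thesis using g ext1 by simp
  qed
  have eab: "ext (a \<otimes>\<^bsub>aut_group P\<^esub> b) = \<rho> 0 * \<rho> 1" "ext (b \<otimes>\<^bsub>aut_group P\<^esub> c) = \<rho> 1 * \<rho> 2"
    using abc by (simp_all add: ext_mult)
  have inveq: "u = w" if "u * g = 1" "g * w = 1" for u g w :: "'a endo"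
    by (metis mult.assoc mult.left_neutral mult.right_neutral that)
  let ?R = "rotations (\<rho> 0) (\<rho> 1) (\<rho> 2)"
  have U: "C.U i \<in> ?R" and V: "C.V i \<in> ?R" for i
    using C.rotations_U[OF rotations.one] C.rotations_V[OF rotations.one] by (metis mult.right_neutral)+
  show "ext ` rotation_subgroup P (fset t0) = ?R"
  proof
    show "ext ` rotation_subgroup P (fset t0) \<subseteq> ?R"
    proof
      fix g assume "g \<in> ext ` rotation_subgroup P (fset t0)"
      then obtain \<gamma> where \<gamma>: "\<gamma> \<in> generate (aut_group P) ?S" "g = ext \<gamma>" using rs by auto
      have "\<gamma> \<in> Aut \<and> ext \<gamma> \<in> ?R" using \<gamma>(1)
      proof induction
        case one
        then show ?case using ext1 rotations.one by (simp add: Aut_def)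
      next
        case (incl h)
        then show ?case using SA eab U[of 1] V[of 1] by (auto simp: Aut_def C.U1 C.V1)
      next
        case (inv h)
        then have h: "h \<in> Aut" using SA by (auto simp: Aut_def)
        have "ext h = C.U 1 \<or> ext h = C.V 1" using inv eab by (auto simp: C.U1 C.V1)
        then have "ext (inv\<^bsub>aut_group P\<^esub> h) = C.U (-1) \<or> ext (inv\<^bsub>aut_group P\<^esub> h) = C.V (-1)"
        proof
          assume "ext h = C.U 1"
          then have "ext (inv\<^bsub>aut_group P\<^esub> h) = C.U (-1)" by (intro inveq[OF extinv[OF h]]) simp
          then show ?thesis ..
        next
          assume "ext h = C.V 1"
          then have "ext (inv\<^bsub>aut_group P\<^esub> h) = C.V (-1)" by (intro inveq[OF extinv[OF h]]) simp
          then show ?thesis ..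
        qed
        then show ?case using U V h by (auto simp: Aut_def)
      next
        case (eng h1 h2)
        then show ?case using C.rotations_mult by (auto simp: ext_mult) (simp add: Aut_def)
      qed
      then show "g \<in> ?R" using \<gamma> by simp
    qed
    show "?R \<subseteq> ext ` rotation_subgroup P (fset t0)"
    proof
      fix g assume "g \<in> ?R"
      then show "g \<in> ext ` rotation_subgroup P (fset t0)"
      proof induction
        case one
        show ?case unfolding rs using ext1 generate.one by (metis image_eqI)
      next
        case (ab h)
        then obtain \<gamma> where \<gamma>: "\<gamma> \<in> generate (aut_group P) ?S" "h = ext \<gamma>" using rs by auto
        have "\<gamma> \<in> Aut" using RA \<gamma> rs by auto
        then have "\<rho> 0 * \<rho> 1 * h = ext ((a \<otimes>\<^bsub>aut_group P\<^esub> b) \<otimes>\<^bsub>aut_group P\<^esub> \<gamma>)"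
          using SA \<gamma> eab by (subst ext_mult) (auto simp: Aut_def)
        moreover have "(a \<otimes>\<^bsub>aut_group P\<^esub> b) \<otimes>\<^bsub>aut_group P\<^esub> \<gamma> \<in> generate (aut_group P) ?S"
          by (intro generate.eng generate.incl \<gamma>) auto
        ultimately show ?case unfolding rs by blast
      next
        case (bc h)
        then obtain \<gamma> where \<gamma>: "\<gamma> \<in> generate (aut_group P) ?S" "h = ext \<gamma>" using rs by auto
        have "\<gamma> \<in> Aut" using RA \<gamma> rs by auto
        then have "\<rho> 1 * \<rho> 2 * h = ext ((b \<otimes>\<^bsub>aut_group P\<^esub> c) \<otimes>\<^bsub>aut_group P\<^esub> \<gamma>)"
          using SA \<gamma> eab by (subst ext_mult) (auto simp: Aut_def)
        moreover have "(b \<otimes>\<^bsub>aut_group P\<^esub> c) \<otimes>\<^bsub>aut_group P\<^esub> \<gamma> \<in> generate (aut_group P) ?S"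
          by (intro generate.eng generate.incl \<gamma>) auto
        ultimately show ?case unfolding rs by blast
      qed
    qed
  qed
qed

lemma index_two:
  assumes "card (rotations (\<rho> 0) (\<rho> 1) (\<rho> 2)) = p * q"
  shows "card (rcosets\<^bsub>aut_group P\<^esub> (rotation_subgroup P (fset t0))) = 2"
proof -
  interpret A: group "aut_group P" by (rule aut_group_group)
  have "card (rotation_subgroup P (fset t0)) = p * q"
    using assms card_image[OF inj_on_subset[OF inj_ext rotation_subgroup_Aut]] ext_rotation_subgroup by simp
  moreover have "order (aut_group P) = 2 * p * q"
    using card_image[OF inj_ext] ext_Aut card_\<Gamma> by (simp add: order_def Aut_def)
  ultimately show ?thesis using A.lagrange[OF subgroup_rotation] p2 q2 by simp
qed

lemma rotations_all:
  assumes "rotations (\<rho> 0) (\<rho> 1) (\<rho> 2) = C.G"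
  shows "rotation_subgroup P (fset t0) = carrier (aut_group P)"
proof -
  have "ext ` rotation_subgroup P (fset t0) = ext ` Aut"
    using ext_rotation_subgroup assms G_\<Gamma> ext_Aut by simp
  then show ?thesis using inj_on_image_eq_iff[OF inj_ext rotation_subgroup_Aut order_refl] by (simp add: Aut_def)
qed

end

section \<open>Recovering a polyhedron from its group\<close>

context finite_polyhedron begin

lemma incident_flag:
  assumes "x \<in> elems P" "y \<in> elems P"
  shows "incident P x y \<longleftrightarrow> (\<exists>s\<in>FL. x \<in> fset s \<and> y \<in> fset s)"
proof
  assume "incident P x y"
  then have "pred_on.chain (elems P) (\<lambda>x y. (x, y) \<in> leq P) {x, y}"
    unfolding pred_on.chain_def incident_def using assms by auto
  from chain_extends[OF this] show "\<exists>s\<in>FL. x \<in> fset s \<and> y \<in> fset s" unfolding flags_eq by auto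
next
  assume "\<exists>s\<in>FL. x \<in> fset s \<and> y \<in> fset s"
  then obtain v e f where s: "(v, e, f) \<in> FL" "x \<in> {v, e, f}" "y \<in> {v, e, f}" by (auto simp: fset_def)
  then have "(v, e) \<in> leq P" "(e, f) \<in> leq P" by (auto simp: FL_def)
  moreover from this have "(v, f) \<in> leq P" by (rule leq_trans)
  ultimately show "incident P x y" using s(2,3) leq_refl assms by (auto simp: incident_def)
qed

end

context tight_polyhedron begin

lemma flag_orbit: "FL = (\<lambda>k. act k t0) ` \<Gamma>"
  using act_trans act_FL t0 by blast

lemma elem_orbit: "x \<in> elems P \<Longrightarrow> \<exists>g\<in>\<Gamma>. x = app g v0 \<or> x = app g e0 \<or> x = app g f0"
  using in_flag flag_orbit by (force simp: t0_eq fset_def)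

lemma in_fset_act:
  assumes "g \<in> \<Gamma>" "k \<in> \<Gamma>"
  shows "app g v0 \<in> fset (act k t0) \<longleftrightarrow> app k v0 = app g v0"
    "app g e0 \<in> fset (act k t0) \<longleftrightarrow> app k e0 = app g e0"
    "app g f0 \<in> fset (act k t0) \<longleftrightarrow> app k f0 = app g f0"
proof -
  have "rk P (app g v0) = 0" "rk P (app g e0) = 1" "rk P (app g f0) = 2"
    "rk P (app k v0) = 0" "rk P (app k e0) = 1" "rk P (app k f0) = 2"
    using \<Gamma>D(2)[OF assms(1)] \<Gamma>D(2)[OF assms(2)] base_elems by auto
  then show "app g v0 \<in> fset (act k t0) \<longleftrightarrow> app k v0 = app g v0"
    "app g e0 \<in> fset (act k t0) \<longleftrightarrow> app k e0 = app g e0"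
    "app g f0 \<in> fset (act k t0) \<longleftrightarrow> app k f0 = app g f0"
    unfolding t0_eq fset_def by (auto simp: act_def)
qed

end

text \<open>The map sends \<open>app g v0\<close> to \<open>app (\<theta> g) v1\<close>, and
  likewise for edges and faces. It is well defined and injective because \<open>\<theta>\<close>
  matches the stabilisers, each generated by two of the generators. Incidence is preserved since it
  means lying in a common flag.\<close>

theorem cayley_iso_poly_isomorphic:
  assumes "tight_polyhedron P p q t0 v0 e0 f0" and "tight_polyhedron Q p q t1 v1 e1 f1"
    and iso: "cayley_iso (finite_polyhedron.\<Gamma> P)
      (tight_polyhedron.\<rho> P t0 0) (tight_polyhedron.\<rho> P t0 1) (tight_polyhedron.\<rho> P t0 2) (finite_polyhedron.\<Gamma> Q)
      (tight_polyhedron.\<rho> Q t1 0) (tight_polyhedron.\<rho> Q t1 1) (tight_polyhedron.\<rho> Q t1 2) \<theta>"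
  shows "poly_isomorphic P Q"
proof -
  interpret L: tight_polyhedron P p q t0 v0 e0 f0 by fact
  interpret R: tight_polyhedron Q p q t1 v1 e1 f1 by fact
  note One_nat_def [simp del]
  have bij: "bij_betw \<theta> L.\<Gamma> R.\<Gamma>" and one: "\<theta> 1 = 1"
    and gens: "\<And>g. g \<in> L.\<Gamma> \<Longrightarrow> \<theta> (L.\<rho> 0 * g) = R.\<rho> 0 * \<theta> g" "\<And>g. g \<in> L.\<Gamma> \<Longrightarrow> \<theta> (L.\<rho> 1 * g) = R.\<rho> 1 * \<theta> g"
      "\<And>g. g \<in> L.\<Gamma> \<Longrightarrow> \<theta> (L.\<rho> 2 * g) = R.\<rho> 2 * \<theta> g"
    using iso unfolding cayley_iso_def by auto
  have mem: "\<theta> g \<in> R.\<Gamma>" if "g \<in> L.\<Gamma>" for g using bij that by (auto simp: bij_betw_def)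
  have inj: "\<theta> g = \<theta> h \<longleftrightarrow> g = h" if "g \<in> L.\<Gamma>" "h \<in> L.\<Gamma>" for g h
    using bij that by (auto simp: bij_betw_def dest: inj_onD)
  have surj: "\<exists>g\<in>L.\<Gamma>. g' = \<theta> g" if "g' \<in> R.\<Gamma>" for g' using bij that unfolding bij_betw_def by blast
  have mult: "\<theta> (g * h) = \<theta> g * \<theta> h" if "g \<in> L.\<Gamma>" "h \<in> L.\<Gamma>" for g h
  proof -
    have "g \<in> L.C.G" using that L.G_\<Gamma> by simp
    then show ?thesis
    proof (induction rule: L.C.G_induct)
      case one
      then show ?case using \<open>\<theta> 1 = 1\<close> by simp
    qed (use L.G_\<Gamma> gens that L.mult_\<Gamma> in \<open>simp_all add: mult.assoc\<close>)
  qed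
  have gen: "\<theta> (L.\<rho> i) = R.\<rho> i" if i: "i \<in> {0, 1, 2}" for i
    using gens[of 1] one L.one_\<Gamma> i by auto
  have mon: "\<theta> w \<in> mon (R.\<rho> ` I)" if I: "I \<subseteq> {0, 1, 2}" and w: "w \<in> mon (L.\<rho> ` I)" for w I
    using w
  proof induction
    case one
    then show ?case using \<open>\<theta> 1 = 1\<close> mon.one by metis
  next
    case (step w s)
    then obtain i where i: "i \<in> I" "s = L.\<rho> i" by auto
    have i': "i \<in> {0, 1, 2}" and "w \<in> L.\<Gamma>" using i I step(1) L.mon_\<Gamma>[OF I] by blast+
    then have "\<theta> (w * s) = \<theta> w * R.\<rho> i"
      using mult[of w "L.\<rho> i"] i(2) L.\<rho>[OF i'] gen[OF i'] by simp
    then show ?case using step i by (auto intro: mon.step)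
  qed
  have mon': "\<exists>w\<in>mon (L.\<rho> ` I). \<theta> w = w'" if I: "I \<subseteq> {0, 1, 2}" and w: "w' \<in> mon (R.\<rho> ` I)" for w' I
    using w
  proof induction
    case one
    then show ?case using \<open>\<theta> 1 = 1\<close> mon.one by metis
  next
    case (step w' s)
    then obtain w i where i: "i \<in> I" "s = R.\<rho> i" "w \<in> mon (L.\<rho> ` I)" "\<theta> w = w'" by auto
    have i': "i \<in> {0, 1, 2}" and "w \<in> L.\<Gamma>" using i I L.mon_\<Gamma>[OF I] by blast+
    then have "\<theta> (w * L.\<rho> i) = w' * s"
      using mult[of w "L.\<rho> i"] i(2,4) L.\<rho>[OF i'] gen[OF i'] by simp
    then show ?case using mon.step[OF i(3), of "L.\<rho> i"] i(1) by blast
  qed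
  have mon_iff: "\<theta> w \<in> mon (R.\<rho> ` I) \<longleftrightarrow> w \<in> mon (L.\<rho> ` I)" if I: "I \<subseteq> {0, 1, 2}" and w: "w \<in> L.\<Gamma>" for w I
    using mon[OF I] mon'[OF I, of "\<theta> w"] inj[OF _ w] L.mon_\<Gamma>[OF I] by blast
  have eq: "app (\<theta> g) x' = app (\<theta> h) x' \<longleftrightarrow> app g x = app h x"
    if st: "\<And>g. g \<in> L.\<Gamma> \<Longrightarrow> app (\<theta> g) x' = x' \<longleftrightarrow> app g x = x" and gh: "g \<in> L.\<Gamma>" "h \<in> L.\<Gamma>" for x x' g h
  proof -
    obtain k where k: "k \<in> L.\<Gamma>" "h * k = 1" "k * h = 1" using L.inv_\<Gamma> gh by blast
    have k': "\<theta> h * \<theta> k = 1" "\<theta> k * \<theta> h = 1" using k mult gh one by metis+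
    have kh: "app k (app h z) = z" "app h (app k z) = z" for z
      using arg_cong[OF k(3), of "\<lambda>g. app g z"] arg_cong[OF k(2), of "\<lambda>g. app g z"] by simp_all
    have kh': "app (\<theta> k) (app (\<theta> h) z) = z" "app (\<theta> h) (app (\<theta> k) z) = z" for z
      using arg_cong[OF k'(2), of "\<lambda>g. app g z"] arg_cong[OF k'(1), of "\<lambda>g. app g z"] by simp_all
    have "app g x = app h x \<longleftrightarrow> app (k * g) x = x" using kh by (metis app_times comp_apply)
    also have "\<dots> \<longleftrightarrow> app (\<theta> (k * g)) x' = x'" using st L.mult_\<Gamma> k gh by blast
    also have "\<theta> (k * g) = \<theta> k * \<theta> g" using mult k gh by blast
    also have "app (\<theta> k * \<theta> g) x' = x' \<longleftrightarrow> app (\<theta> g) x' = app (\<theta> h) x'" using kh' by (metis app_times comp_apply)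
    finally show ?thesis by simp
  qed
  have eqv: "app (\<theta> g) v1 = app (\<theta> h) v1 \<longleftrightarrow> app g v0 = app h v0" if "g \<in> L.\<Gamma>" "h \<in> L.\<Gamma>" for g h
    by (rule eq[OF _ that]) (use mon_iff[of "{1, 2}"] mem L.stab_v R.stab_v in simp)
  have eqe: "app (\<theta> g) e1 = app (\<theta> h) e1 \<longleftrightarrow> app g e0 = app h e0" if "g \<in> L.\<Gamma>" "h \<in> L.\<Gamma>" for g h
    by (rule eq[OF _ that]) (use mon_iff[of "{0, 2}"] mem L.stab_e R.stab_e in simp)
  have eqf: "app (\<theta> g) f1 = app (\<theta> h) f1 \<longleftrightarrow> app g f0 = app h f0" if "g \<in> L.\<Gamma>" "h \<in> L.\<Gamma>" for g h
    by (rule eq[OF _ that]) (use mon_iff[of "{0, 1}"] mem L.stab_f R.stab_f in simp)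
  have rkL: "rk P (app g v0) = 0" "rk P (app g e0) = 1" "rk P (app g f0) = 2"
    "app g v0 \<in> elems P" "app g e0 \<in> elems P" "app g f0 \<in> elems P" if "g \<in> L.\<Gamma>" for g
    using L.\<Gamma>D(1,2)[OF that] L.base_elems by auto
  have rkR: "rk Q (app g v1) = 0" "rk Q (app g e1) = 1" "rk Q (app g f1) = 2"
    "app g v1 \<in> elems Q" "app g e1 \<in> elems Q" "app g f1 \<in> elems Q" if "g \<in> R.\<Gamma>" for g
    using R.\<Gamma>D(1,2)[OF that] R.base_elems by auto
  \<comment> \<open>The three clauses cannot conflict, because the three orbits have different
    ranks; within one clause different choices of \<open>g\<close> agree by \<open>eqv\<close>,
    \<open>eqe\<close> or \<open>eqf\<close>.\<close>
  have "\<exists>y. \<forall>g\<in>L.\<Gamma>. (x = app g v0 \<longrightarrow> y = app (\<theta> g) v1) \<and> (x = app g e0 \<longrightarrow> y = app (\<theta> g) e1) \<and>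
    (x = app g f0 \<longrightarrow> y = app (\<theta> g) f1)" for x
  proof (cases "x \<in> elems P")
    case True
    then obtain h where h: "h \<in> L.\<Gamma>" "x = app h v0 \<or> x = app h e0 \<or> x = app h f0" using L.elem_orbit by blast
    have ne: "app g v0 \<noteq> app h e0" "app g v0 \<noteq> app h f0" "app g e0 \<noteq> app h f0"
       "app h v0 \<noteq> app g e0" "app h v0 \<noteq> app g f0" "app h e0 \<noteq> app g f0" if "g \<in> L.\<Gamma>" for g
      using rkL[OF that] rkL[OF h(1)] by (auto dest!: arg_cong[of _ _ "rk P"])
    from h(2) show ?thesis
    proof (elim disjE)
      assume "x = app h v0"
      then show ?thesis using ne eqv[OF h(1)] by (intro exI[of _ "app (\<theta> h) v1"]) metis
    next
      assume "x = app h e0"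
      then show ?thesis using ne eqe[OF h(1)] by (intro exI[of _ "app (\<theta> h) e1"]) metis
    next
      assume "x = app h f0"
      then show ?thesis using ne eqf[OF h(1)] by (intro exI[of _ "app (\<theta> h) f1"]) metis
    qed
  next
    case False
    then show ?thesis using rkL by blast
  qed
  then obtain \<phi> where \<phi>: "\<And>g. g \<in> L.\<Gamma> \<Longrightarrow> \<phi> (app g v0) = app (\<theta> g) v1"
    "\<And>g. g \<in> L.\<Gamma> \<Longrightarrow> \<phi> (app g e0) = app (\<theta> g) e1" "\<And>g. g \<in> L.\<Gamma> \<Longrightarrow> \<phi> (app g f0) = app (\<theta> g) f1"
    by metis
  have orb: "Q x" if "x \<in> elems P" "\<And>g. g \<in> L.\<Gamma> \<Longrightarrow> Q (app g v0)" "\<And>g. g \<in> L.\<Gamma> \<Longrightarrow> Q (app g e0)"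
    "\<And>g. g \<in> L.\<Gamma> \<Longrightarrow> Q (app g f0)" for Q x using that L.elem_orbit by blast
  have \<phi>el: "\<phi> x \<in> elems Q \<and> rk Q (\<phi> x) = rk P x" if "x \<in> elems P" for x
    by (rule orb[OF that]) (use \<phi> rkL rkR mem in auto)
  have fl: "\<phi> x \<in> R.fset (R.act (\<theta> k) t1) \<longleftrightarrow> x \<in> L.fset (L.act k t0)" if "x \<in> elems P" "k \<in> L.\<Gamma>" for x k
    by (rule orb[OF that(1)])
      (use that(2) \<phi> L.in_fset_act R.in_fset_act mem eqv eqe eqf in simp_all)
  have "poly_iso_map P Q \<phi>"
    unfolding poly_iso_map_def
  proof (intro conjI ballI)
    show "bij_betw \<phi> (elems P) (elems Q)"
      unfolding bij_betw_def
    proof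
      show "inj_on \<phi> (elems P)"
      proof (rule inj_onI)
        fix x y assume x: "x \<in> elems P" and y: "y \<in> elems P" and xy: "\<phi> x = \<phi> y"
        have r: "rk P x = rk P y" using \<phi>el x y xy by metis
        obtain g h where "g \<in> L.\<Gamma>" "x = app g v0 \<or> x = app g e0 \<or> x = app g f0"
          "h \<in> L.\<Gamma>" "y = app h v0 \<or> y = app h e0 \<or> y = app h f0" using L.elem_orbit x y by metis
        then show "x = y" using r xy rkL[of g] rkL[of h] \<phi>[of g] \<phi>[of h] eqv[of g h] eqe[of g h] eqf[of g h]
          by (elim disjE) simp_all
      qed
      show "\<phi> ` elems P = elems Q"
      proof
        show "\<phi> ` elems P \<subseteq> elems Q" using \<phi>el by blast
        show "elems Q \<subseteq> \<phi> ` elems P"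
        proof
          fix y assume "y \<in> elems Q"
          then obtain g' where g': "g' \<in> R.\<Gamma>" "y = app g' v1 \<or> y = app g' e1 \<or> y = app g' f1"
            using R.elem_orbit by blast
          obtain g where g: "g \<in> L.\<Gamma>" "g' = \<theta> g" using surj g' by blast
          show "y \<in> \<phi> ` elems P" using g'(2) \<phi>[OF g(1)] rkL(4-6)[OF g(1)] unfolding g(2) by (metis image_eqI)
        qed
      qed
    qed
    show "rk Q (\<phi> x) = rk P x" if "x \<in> elems P" for x using \<phi>el that by blast
    fix x y assume x: "x \<in> elems P" and y: "y \<in> elems P"
    have "incident P x y \<longleftrightarrow> (\<exists>k\<in>L.\<Gamma>. x \<in> L.fset (L.act k t0) \<and> y \<in> L.fset (L.act k t0))"
      unfolding L.incident_flag[OF x y] L.flag_orbit by blast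
    also have "\<dots> \<longleftrightarrow> (\<exists>k\<in>L.\<Gamma>. \<phi> x \<in> R.fset (R.act (\<theta> k) t1) \<and> \<phi> y \<in> R.fset (R.act (\<theta> k) t1))"
      using fl x y by blast
    also have "\<dots> \<longleftrightarrow> (\<exists>k\<in>R.\<Gamma>. \<phi> x \<in> R.fset (R.act k t1) \<and> \<phi> y \<in> R.fset (R.act k t1))"
      using mem surj by blast
    also have "\<dots> \<longleftrightarrow> incident Q (\<phi> x) (\<phi> y)"
      using R.incident_flag[of "\<phi> x" "\<phi> y"] \<phi>el x y unfolding R.flag_orbit by blast
    finally show "incident P x y \<longleftrightarrow> incident Q (\<phi> x) (\<phi> y)" .
  qed
  then show ?thesis unfolding poly_isomorphic_def by blast
qed

section \<open>Coset geometries\<close>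

text \<open>\<open>K\<close> stands for the flags at a fixed vertex or in a fixed face, and
  \<open>lo\<close>, \<open>hi\<close> for their other two elements. \<open>S\<close> and
  \<open>T\<close> give the other flag with the same \<open>lo\<close> or the same
  \<open>hi\<close>; the \<open>lo\<close> values are the vertices of the graph and the
  \<open>hi\<close> values its edges.\<close>

lemma polygonalI:
  fixes lo hi :: "'k \<Rightarrow> 'a" and S T :: "'k \<Rightarrow> 'k"
  assumes r: "r = Id_on (lo ` K \<union> hi ` K) \<union> {(lo k, hi k) | k. k \<in> K}"
    and disj: "lo ` K \<inter> hi ` K = {}"
    and ST: "\<And>k. k \<in> K \<Longrightarrow> S k \<in> K" "\<And>k. k \<in> K \<Longrightarrow> T k \<in> K"
    and ne: "\<And>k. k \<in> K \<Longrightarrow> S k \<noteq> k" "\<And>k. k \<in> K \<Longrightarrow> T k \<noteq> k" "\<And>k. k \<in> K \<Longrightarrow> S k \<noteq> T k"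
    and lo_eq: "\<And>k k'. k \<in> K \<Longrightarrow> k' \<in> K \<Longrightarrow> lo k = lo k' \<longleftrightarrow> k' = k \<or> k' = S k"
    and hi_eq: "\<And>k k'. k \<in> K \<Longrightarrow> k' \<in> K \<Longrightarrow> hi k = hi k' \<longleftrightarrow> k' = k \<or> k' = T k"
    and base: "base \<in> K"
    and conn: "\<And>k. k \<in> K \<Longrightarrow> (base, k) \<in> {(k, k'). k \<in> K \<and> (k' = S k \<or> k' = T k)}\<^sup>*"
  shows "polygonal r"
proof -
  define M where "M h = {lo k | k. k \<in> K \<and> hi k = h}" for h
  define Gr :: "('a, 'a) multigraph" where "Gr = \<lparr>mverts = lo ` K, medges = hi ` K, mends = M\<rparr>"
  have M: "M (hi k) = {lo k, lo (T k)}" if k: "k \<in> K" for k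
  proof
    show "M (hi k) \<subseteq> {lo k, lo (T k)}"
    proof
      fix x assume "x \<in> M (hi k)"
      then obtain k' where k': "k' \<in> K" "hi k' = hi k" "x = lo k'" by (auto simp: M_def)
      then have "k' = k \<or> k' = T k" using hi_eq[OF k k'(1)] by simp
      then show "x \<in> {lo k, lo (T k)}" using k'(3) by auto
    qed
    show "{lo k, lo (T k)} \<subseteq> M (hi k)" using hi_eq[OF k ST(2)[OF k]] ST(2)[OF k] k by (auto simp: M_def)
  qed
  have loT: "lo k \<noteq> lo (T k)" if k: "k \<in> K" for k
    using lo_eq[OF k ST(2)[OF k]] ne(2,3)[OF k] by auto
  have hiS: "hi k \<noteq> hi (S k)" if k: "k \<in> K" for k
    using hi_eq[OF k ST(1)[OF k]] ne(1,3)[OF k] by auto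
  have "is_multigraph Gr"
    unfolding is_multigraph_def
  proof
    fix e assume "e \<in> medges Gr"
    then obtain k where k: "k \<in> K" "e = hi k" by (auto simp: Gr_def)
    show "mends Gr e \<subseteq> mverts Gr \<and> card (mends Gr e) = 2"
      using M[OF k(1)] loT[OF k(1)] k ST(2)[OF k(1)] by (simp add: Gr_def)
  qed
  moreover have "regular_multigraph 2 Gr"
    unfolding regular_multigraph_def
  proof
    fix v assume "v \<in> mverts Gr"
    then obtain k where k: "k \<in> K" "v = lo k" by (auto simp: Gr_def)
    have "{e \<in> medges Gr. v \<in> mends Gr e} = {hi k, hi (S k)}"
    proof
      show "{e \<in> medges Gr. v \<in> mends Gr e} \<subseteq> {hi k, hi (S k)}"
      proof
        fix e assume "e \<in> {e \<in> medges Gr. v \<in> mends Gr e}"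
        then have "v \<in> M e" by (simp add: Gr_def)
        then obtain l where l: "l \<in> K" "hi l = e" "v = lo l" by (auto simp: M_def)
        then have "l = k \<or> l = S k" using lo_eq[OF k(1) l(1)] k(2) by simp
        then show "e \<in> {hi k, hi (S k)}" using l(2) by auto
      qed
      show "{hi k, hi (S k)} \<subseteq> {e \<in> medges Gr. v \<in> mends Gr e}"
      proof -
        have "v = lo (S k)" using lo_eq[OF k(1) ST(1)[OF k(1)]] k(2) by simp
        then have "v \<in> M (hi k)" "v \<in> M (hi (S k))" unfolding M_def using k ST(1) by blast+
        then show ?thesis using k(1) ST(1) by (simp add: Gr_def)
      qed
    qed
    then show "card {e \<in> medges Gr. v \<in> mends Gr e} = 2" using hiS[OF k(1)] by simp
  qed
  moreover have "connected_multigraph Gr"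
  proof -
    let ?E = "{(x, y). \<exists>e \<in> medges Gr. mends Gr e = {x, y}}"
    have sym: "sym (?E\<^sup>*)" by (rule sym_rtrancl) (auto simp: sym_def insert_commute)
    have from0: "(lo base, lo k) \<in> ?E\<^sup>*" if "k \<in> K" for k
      using conn[OF that]
    proof (induction rule: rtrancl_induct)
      case (step k k')
      then have k: "k \<in> K" and k': "k' = S k \<or> k' = T k" by auto
      from k' show ?case
      proof
        assume "k' = S k"
        then have "lo k' = lo k" using lo_eq[OF k ST(1)[OF k]] by simp
        then show ?thesis using step.IH by simp
      next
        assume "k' = T k"
        then have "(lo k, lo k') \<in> ?E" using M[OF k] k by (auto simp: Gr_def)
        then show ?thesis using step.IH by (rule rtrancl_into_rtrancl[rotated])
      qed
    qed simp
    show ?thesis unfolding connected_multigraph_def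
    proof (intro ballI)
      fix u v assume "u \<in> mverts Gr" "v \<in> mverts Gr"
      then have "(lo base, u) \<in> ?E\<^sup>*" "(lo base, v) \<in> ?E\<^sup>*" using from0 by (auto simp: Gr_def)
      then show "(u, v) \<in> ?E\<^sup>*" using sym by (meson rtrancl_trans symD)
    qed
  qed
  moreover have "poset_iso r (incidence_poset Gr)"
  proof -
    define f :: "'a \<Rightarrow> 'a + 'a" where "f z = (if z \<in> lo ` K then Inl z else Inr z)" for z
    have Fid: "Field (Id_on A \<union> R) = A" if "R \<subseteq> A \<times> A" for A and R :: "'c rel"
      unfolding Field_def using that by auto
    have Fr: "Field r = lo ` K \<union> hi ` K" unfolding r by (rule Fid) auto
    have FG: "Field (incidence_poset Gr) = Inl ` (lo ` K) \<union> Inr ` (hi ` K)"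
      unfolding incidence_poset_def Gr_def by (subst Fid) auto
    have flo: "f (lo k) = Inl (lo k)" if "k \<in> K" for k using that by (simp add: f_def)
    have fhi: "f (hi k) = Inr (hi k)" if "k \<in> K" for k using that disj by (auto simp: f_def)
    have "bij_betw f (Field r) (Field (incidence_poset Gr))"
      unfolding Fr FG bij_betw_def
    proof
      show "inj_on f (lo ` K \<union> hi ` K)" by (rule inj_onI) (auto simp: f_def split: if_splits)
      have "f ` (lo ` K) = Inl ` (lo ` K)" by (rule image_cong) (auto simp: f_def)
      moreover have "f ` (hi ` K) = Inr ` (hi ` K)" by (rule image_cong) (use disj in \<open>auto simp: f_def\<close>)
      ultimately show "f ` (lo ` K \<union> hi ` K) = Inl ` lo ` K \<union> Inr ` hi ` K" by (simp only: image_Un)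
    qed
    moreover have "(x, y) \<in> r \<longleftrightarrow> (f x, f y) \<in> incidence_poset Gr" if "x \<in> Field r" "y \<in> Field r" for x y
    proof -
      have inc: "(Inl v, Inr e) \<in> incidence_poset Gr \<longleftrightarrow> v \<in> lo ` K \<and> e \<in> hi ` K \<and> v \<in> M e"
        "(Inl v, Inl w) \<in> incidence_poset Gr \<longleftrightarrow> v \<in> lo ` K \<and> v = w"
        "(Inr e, Inr e') \<in> incidence_poset Gr \<longleftrightarrow> e \<in> hi ` K \<and> e = e'"
        "(Inr e, Inl v) \<notin> incidence_poset Gr" for v w e e'
        unfolding incidence_poset_def Gr_def by auto
      have inr: "(lo k, hi k') \<in> r \<longleftrightarrow> lo k \<in> M (hi k')"  "(lo k, lo k') \<in> r \<longleftrightarrow> lo k = lo k'"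
        "(hi k, hi k') \<in> r \<longleftrightarrow> hi k = hi k'" "(hi k, lo k') \<notin> r" if "k \<in> K" "k' \<in> K" for k k'
        unfolding r M_def using that disj by auto
      from that consider k k' where "k \<in> K" "k' \<in> K" "x = lo k" "y = lo k'" | k k' where "k \<in> K" "k' \<in> K" "x = lo k" "y = hi k'"
        | k k' where "k \<in> K" "k' \<in> K" "x = hi k" "y = lo k'" | k k' where "k \<in> K" "k' \<in> K" "x = hi k" "y = hi k'"
        unfolding Fr by blast
      then show ?thesis by cases (simp_all add: flo fhi inc inr)
    qed
    ultimately show ?thesis unfolding poset_iso_def by blast
  qed
  ultimately show ?thesis unfolding polygonal_def by blast
qed

text \<open>Cosets are subsets of \<open>G\<close>; numbering all such subsets by \<open>enc\<close>
  places the polyhedron on \<open>nat\<close>.\<close>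

locale coset_geometry = tight_triple a b c p q for a b c :: "'g::monoid_mult" and p q +
  fixes enc :: "'g set \<Rightarrow> nat"
  assumes p2: "p \<ge> 2" and q2: "q \<ge> 2" and enc: "inj_on enc (Pow G)"
begin

declare One_nat_def [simp del]

definition T :: "'g set" where "T = {1, a, c, a * c}"
definition cs :: "'g set \<Rightarrow> 'g \<Rightarrow> 'g set" where "cs K g = (\<lambda>k. g * k) ` K"

text \<open>The residue modulo 3 keeps the three kinds of cosets apart and serves as the
  rank.\<close>

definition vt :: "'g \<Rightarrow> nat" where "vt g = 3 * enc (cs E g)"
definition ed :: "'g \<Rightarrow> nat" where "ed g = 3 * enc (cs T g) + 1"
definition fc :: "'g \<Rightarrow> nat" where "fc g = 3 * enc (cs D g) + 2"

lemma rk_mod [simp]: "vt g mod 3 = 0" "ed g mod 3 = 1" "fc g mod 3 = 2"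
  unfolding vt_def ed_def fc_def by presburger+

lemma rk_ne [simp]: "vt g \<noteq> ed h" "vt g \<noteq> fc h" "ed g \<noteq> fc h" "ed g \<noteq> vt h" "fc g \<noteq> vt h" "fc g \<noteq> ed h"
  unfolding vt_def ed_def fc_def by presburger+

lemma rk_dvd [simp]: "\<not> 3 dvd ed g" "\<not> 3 dvd fc g"
  unfolding ed_def fc_def by presburger+

lemma T_G: "T \<subseteq> G"
  using a_G c_G G_mult one_G by (auto simp: T_def)

lemma cs_G: "K \<subseteq> G \<Longrightarrow> g \<in> G \<Longrightarrow> cs K g \<in> Pow G"
  using G_mult by (auto simp: cs_def)

lemma mem_cs: "h \<in> cs K g \<longleftrightarrow> (\<exists>k\<in>K. h = g * k)"
  by (auto simp: cs_def)

lemma cs_eq: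
  assumes K: "K \<subseteq> G" "1 \<in> K" "\<And>k l. k \<in> K \<Longrightarrow> l \<in> K \<Longrightarrow> k * l \<in> K" "\<And>k. k \<in> K \<Longrightarrow> \<exists>l\<in>K. k * l = 1"
  shows "cs K g = cs K h \<longleftrightarrow> (\<exists>k\<in>K. h = g * k)"
proof
  assume "cs K g = cs K h"
  moreover have "h \<in> cs K h" using K(2) by (auto simp: cs_def intro: image_eqI[of _ _ 1])
  ultimately show "\<exists>k\<in>K. h = g * k" by (auto simp: cs_def)
next
  assume "\<exists>k\<in>K. h = g * k"
  then obtain k where k: "k \<in> K" "h = g * k" by auto
  obtain l where l: "l \<in> K" "k * l = 1" using K(4) k by auto
  show "cs K g = cs K h"
  proof
    show "cs K h \<subseteq> cs K g" using k K(3) by (auto simp: cs_def mult.assoc)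
    show "cs K g \<subseteq> cs K h"
    proof
      fix x assume "x \<in> cs K g"
      then obtain m where m: "m \<in> K" "x = g * m" by (auto simp: cs_def)
      have "h * (l * m) = g * ((k * l) * m)" by (simp only: k(2) mult.assoc)
      then have "x = h * (l * m)" by (simp add: l m)
      moreover have "l * m \<in> K" using K(3) l m by blast
      ultimately show "x \<in> cs K h" by (auto simp: cs_def)
    qed
  qed
qed

lemma E_sub: "1 \<in> E" "k \<in> E \<Longrightarrow> l \<in> E \<Longrightarrow> k * l \<in> E" "k \<in> E \<Longrightarrow> \<exists>l\<in>E. k * l = 1"
proof -
  show "1 \<in> E" using EI[of False 0] by simp
  have VE: "V i * B e \<in> E" for i e using VB[of i e 1] EI by simp
  show "k * l \<in> E" if kl: "k \<in> E" "l \<in> E"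
  proof -
    obtain e i f j where [simp]: "k = B e * V i" "l = B f * V j" using kl by (auto simp: E_def)
    have "k * l = B e * (V i * (B f * V j))" by (simp add: mult.assoc)
    also have "\<dots> \<in> E" unfolding VB by (auto intro: EI)
    finally show ?thesis .
  qed
  show "\<exists>l\<in>E. k * l = 1" if k: "k \<in> E"
  proof -
    obtain e i where k: "k = B e * V i" using k by (auto simp: E_def)
    show ?thesis by (rule bexI[of _ "V (- i) * B e"]) (simp_all add: k VE mult.assoc)
  qed
qed

lemma D_sub: "1 \<in> D" "k \<in> D \<Longrightarrow> l \<in> D \<Longrightarrow> k * l \<in> D" "k \<in> D \<Longrightarrow> \<exists>l\<in>D. k * l = 1"
proof -
  have BU': "\<exists>j. B e * U i = U j * B e" for e i using BU[of e i] by (metis mult.right_neutral)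
  show "1 \<in> D" using DI[of 0 False] by simp
  show "k * l \<in> D" if kl: "k \<in> D" "l \<in> D"
  proof -
    obtain e i f j where kl: "k = U i * B e" "l = U j * B f" using kl by (auto simp: D_def)
    obtain j' where "\<And>z. B e * (U j * z) = U j' * (B e * z)" using BU by blast
    then have "k * l = U (i + j') * B (e \<noteq> f)" by (simp add: kl mult.assoc)
    then show ?thesis using DI by simp
  qed
  show "\<exists>l\<in>D. k * l = 1" if k: "k \<in> D"
  proof -
    obtain e i where k: "k = U i * B e" using k by (auto simp: D_def)
    obtain j where j: "B e * U (- i) = U j * B e" using BU' by blast
    show ?thesis
      by (rule bexI[of _ "B e * U (- i)"]) (simp add: k mult.assoc, simp only: j DI)
  qed
qed

lemma aa_c: "c * a = a * c" "c * (a * z) = a * (c * z)"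
  by (simp_all only: ac[symmetric]) (simp only: mult.assoc[symmetric] ac)

lemma T_sub: "1 \<in> T" "k \<in> T \<Longrightarrow> l \<in> T \<Longrightarrow> k * l \<in> T" "k \<in> T \<Longrightarrow> \<exists>l\<in>T. k * l = 1"
proof -
  show "1 \<in> T" by (simp add: T_def)
  show "k * l \<in> T" if "k \<in> T" "l \<in> T"
    using that by (auto simp: T_def aa_c mult.assoc)
  show "\<exists>l\<in>T. k * l = 1" if k: "k \<in> T"
    by (rule bexI[of _ k]) (use k in \<open>auto simp: T_def aa_c mult.assoc\<close>)
qed

lemma vt_eq: assumes "g \<in> G" "h \<in> G" shows "vt g = vt h \<longleftrightarrow> (\<exists>k\<in>E. h = g * k)"
  by (simp add: vt_def inj_on_eq_iff[OF enc cs_G[OF E_G assms(1)] cs_G[OF E_G assms(2)]] cs_eq[OF E_G E_sub])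

lemma ed_eq: assumes "g \<in> G" "h \<in> G" shows "ed g = ed h \<longleftrightarrow> (\<exists>k\<in>T. h = g * k)"
  by (simp add: ed_def inj_on_eq_iff[OF enc cs_G[OF T_G assms(1)] cs_G[OF T_G assms(2)]] cs_eq[OF T_G T_sub])

lemma fc_eq: assumes "g \<in> G" "h \<in> G" shows "fc g = fc h \<longleftrightarrow> (\<exists>k\<in>D. h = g * k)"
  by (simp add: fc_def inj_on_eq_iff[OF enc cs_G[OF D_G assms(1)] cs_G[OF D_G assms(2)]] cs_eq[OF D_G D_sub])

lemma bE: "b \<in> E" "c \<in> E" and bD: "b \<in> D" "a \<in> D"
proof -
  show "b \<in> E" using EI[of True 0] by simp
  show "b \<in> D" using DI[of 0 True] by simp
  show "c \<in> E" using EI[of True 1] by (simp add: c_nf[symmetric])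
  show "a \<in> D" using DI[of 1 True] by (simp add: a_nf[symmetric])
qed

lemma not_dvd_1: "\<not> int p dvd 1" "\<not> int q dvd 1"
  using p2 q2 by auto

text \<open>Any two of the stabilisers \<open>E\<close>, \<open>T\<close>, \<open>D\<close> meet in
  a group of order two. This is what gives each flag exactly one neighbour of each rank.\<close>

lemma ED: "k \<in> E \<Longrightarrow> k \<in> D \<Longrightarrow> k = 1 \<or> k = b"
proof -
  assume "k \<in> E" "k \<in> D"
  from \<open>k \<in> E\<close> obtain e j where k: "k = B e * V j" by (auto simp: E_def)
  moreover from \<open>k \<in> D\<close> obtain i f where "k = U i * B f" by (auto simp: D_def)
  ultimately have "U 0 * (B e * V j) = U i * (B f * V 0)" by simp
  then have "int q dvd j" unfolding nf_eq by simp
  then have "V j = 1" by (simp add: V_eq_1)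
  then show ?thesis using k by (cases e) auto
qed

lemma a_nE: "a \<notin> E"
proof
  assume "a \<in> E"
  then obtain e j where "a = B e * V j" by (auto simp: E_def)
  moreover have "a = U 1 * (B True * V 0)" by (simp add: U1 mult.assoc)
  ultimately have "U 1 * (B True * V 0) = U 0 * (B e * V j)" by (metis U0 mult_1_left)
  then show False unfolding nf_eq using not_dvd_1 by simp
qed

lemma c_nD: "c \<notin> D"
proof
  assume "c \<in> D"
  then obtain i e where "c = U i * B e" by (auto simp: D_def)
  moreover have "c = U 0 * (B True * V 1)" by (simp add: V1 mult.assoc)
  ultimately have "U 0 * (B True * V 1) = U i * (B e * V 0)" by (metis V0 mult.right_neutral)
  then show False unfolding nf_eq using not_dvd_1 by simp
qed

lemma ET: "k \<in> E \<Longrightarrow> k \<in> T \<Longrightarrow> k = 1 \<or> k = c"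
proof -
  assume k: "k \<in> E" "k \<in> T"
  have "a * c \<notin> E"
  proof
    assume "a * c \<in> E"
    then have "a * c * c \<in> E" using E_sub bE by blast
    then show False using a_nE by (simp add: mult.assoc)
  qed
  then show ?thesis using k a_nE by (auto simp: T_def)
qed

lemma DT: "k \<in> D \<Longrightarrow> k \<in> T \<Longrightarrow> k = 1 \<or> k = a"
proof -
  assume k: "k \<in> D" "k \<in> T"
  have "a * c \<notin> D"
  proof
    assume "a * c \<in> D"
    then have "a * (a * c) \<in> D" using D_sub bD by blast
    then show False using c_nD by simp
  qed
  then show ?thesis using k c_nD by (auto simp: T_def)
qed

lemma cancel: assumes "g \<in> G" "g * k = g * l" shows "k = l"
proof -
  obtain h where "h * g = 1" using G_inv assms by blast
  then have "k = h * (g * k)" "l = h * (g * l)" by (simp_all flip: mult.assoc)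
  then show ?thesis using assms(2) by simp
qed

lemma vt_ed: assumes "g \<in> G" "h \<in> G" shows "vt g = vt h \<and> ed g = ed h \<longleftrightarrow> h = g \<or> h = g * c"
proof
  assume "vt g = vt h \<and> ed g = ed h"
  then obtain k l where "k \<in> E" "h = g * k" "l \<in> T" "h = g * l" using vt_eq ed_eq assms by auto
  moreover from this have "k = l" using cancel[OF assms(1), of k l] by simp
  ultimately have "k = 1 \<or> k = c" "h = g * k" using ET[of k] by simp_all
  then show "h = g \<or> h = g * c" by auto
next
  show "h = g \<or> h = g * c \<Longrightarrow> vt g = vt h \<and> ed g = ed h"
    using vt_eq[OF assms] ed_eq[OF assms] bE by (auto simp: T_def)
qed

lemma vt_fc: assumes "g \<in> G" "h \<in> G" shows "vt g = vt h \<and> fc g = fc h \<longleftrightarrow> h = g \<or> h = g * b"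
proof
  assume "vt g = vt h \<and> fc g = fc h"
  then obtain k l where "k \<in> E" "h = g * k" "l \<in> D" "h = g * l" using vt_eq fc_eq assms by auto
  moreover from this have "k = l" using cancel[OF assms(1), of k l] by simp
  ultimately have "k = 1 \<or> k = b" "h = g * k" using ED[of k] by simp_all
  then show "h = g \<or> h = g * b" by auto
next
  show "h = g \<or> h = g * b \<Longrightarrow> vt g = vt h \<and> fc g = fc h"
    using vt_eq[OF assms] fc_eq[OF assms] bE bD by auto
qed

lemma ed_fc: assumes "g \<in> G" "h \<in> G" shows "ed g = ed h \<and> fc g = fc h \<longleftrightarrow> h = g \<or> h = g * a"
proof
  assume "ed g = ed h \<and> fc g = fc h"
  then obtain k l where "k \<in> D" "h = g * k" "l \<in> T" "h = g * l" using fc_eq ed_eq assms by auto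
  moreover from this have "k = l" using cancel[OF assms(1), of k l] by simp
  ultimately have "k = 1 \<or> k = a" "h = g * k" using DT[of k] by simp_all
  then show "h = g \<or> h = g * a" by auto
next
  show "h = g \<or> h = g * a \<Longrightarrow> ed g = ed h \<and> fc g = fc h"
    using fc_eq[OF assms] ed_eq[OF assms] bD by (auto simp: T_def)
qed

lemma ne_gens: assumes "g \<in> G" shows "g * a \<noteq> g" "g * b \<noteq> g" "g * c \<noteq> g" "g * c \<noteq> g * b" "g * b \<noteq> g * a"
proof -
  have 1: "a \<noteq> 1" "c \<noteq> 1" "c \<noteq> b" "b \<noteq> a" using a_nE c_nD bE bD E_sub D_sub by metis+
  have 2: "b \<noteq> 1" using distinct[of 0 True 0] by auto
  show "g * a \<noteq> g" "g * b \<noteq> g" "g * c \<noteq> g" "g * c \<noteq> g * b" "g * b \<noteq> g * a"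
    using cancel[OF assms] 1 2 by (metis mult.right_neutral)+
qed

lemma right_G: "g \<in> G \<Longrightarrow> g * a \<in> G" "g \<in> G \<Longrightarrow> g * b \<in> G" "g \<in> G \<Longrightarrow> g * c \<in> G"
  using G_mult a_G b_G c_G by blast+

lemma vt_inv: "g \<in> G \<Longrightarrow> vt (g * b) = vt g" "g \<in> G \<Longrightarrow> vt (g * c) = vt g"
  and ed_inv: "g \<in> G \<Longrightarrow> ed (g * a) = ed g" "g \<in> G \<Longrightarrow> ed (g * c) = ed g"
  and fc_inv: "g \<in> G \<Longrightarrow> fc (g * a) = fc g" "g \<in> G \<Longrightarrow> fc (g * b) = fc g"
  using vt_fc[of g "g * b"] vt_ed[of g "g * c"] ed_fc[of g "g * a"] right_G by auto

lemma ed_cases: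
  assumes "g \<in> G" "h \<in> G" "ed g = ed h"
  obtains "h = g" | "h = g * a" | "h = g * c" | "h = g * c * a"
proof -
  obtain k where "k \<in> T" "h = g * k" using ed_eq assms by auto
  then have "h = g \<or> h = g * a \<or> h = g * c \<or> h = g * c * a" by (auto simp: T_def aa_c mult.assoc)
  then show ?thesis using that by blast
qed

text \<open>\<open>T\<close> consists of products of \<open>c\<close>, which keeps the vertex, and
  \<open>a\<close>, which keeps the face. So the vertex of one flag and the face of another on the
  same edge lie in a common flag; this gives transitivity of the order.\<close>

lemma glue:
  assumes g: "g \<in> G" "h \<in> G" "ed g = ed h"
  shows "\<exists>k\<in>G. vt k = vt g \<and> ed k = ed g \<and> fc k = fc h"
  using g
proof (cases rule: ed_cases)
  case 1
  then show ?thesis using g by auto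
next
  case 2
  then show ?thesis using g fc_inv by auto
next
  case 3
  then show ?thesis using g by (intro bexI[of _ "g * c"]) (auto simp: vt_inv ed_inv right_G)
next
  case 4
  then show ?thesis using g by (intro bexI[of _ "g * c"]) (auto simp: vt_inv ed_inv fc_inv right_G)
qed

definition elts :: "nat set" where "elts = vt ` G \<union> ed ` G \<union> fc ` G"

definition P :: "nat ranked_poset" where
  "P = \<lparr>elems = elts,
    leq = Id_on elts \<union> {(vt g, ed g) | g. g \<in> G} \<union> {(vt g, fc g) | g. g \<in> G} \<union> {(ed g, fc g) | g. g \<in> G},
    rk = (\<lambda>n. n mod 3)\<rparr>"

lemma P_simps [simp]: "elems P = elts" "rk P n = n mod 3"
  by (simp_all add: P_def)

lemma leq_iff: "(x, y) \<in> leq P \<longleftrightarrow> x \<in> elts \<and> x = y \<or>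
  (\<exists>g\<in>G. x = vt g \<and> y = ed g \<or> x = vt g \<and> y = fc g \<or> x = ed g \<and> y = fc g)"
  by (auto simp: P_def)

lemma of_rank_P: "vertices P = vt ` G" "edges P = ed ` G" "faces P = fc ` G"
  by (auto simp: of_rank_def elts_def)

lemma inc_ve: "g \<in> G \<Longrightarrow> h \<in> G \<Longrightarrow> incident P (vt g) (ed h) \<longleftrightarrow> (\<exists>k\<in>G. vt k = vt g \<and> ed k = ed h)"
  and inc_vf: "g \<in> G \<Longrightarrow> h \<in> G \<Longrightarrow> incident P (vt g) (fc h) \<longleftrightarrow> (\<exists>k\<in>G. vt k = vt g \<and> fc k = fc h)"
  and inc_ef: "g \<in> G \<Longrightarrow> h \<in> G \<Longrightarrow> incident P (ed g) (fc h) \<longleftrightarrow> (\<exists>k\<in>G. ed k = ed g \<and> fc k = fc h)"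
  unfolding incident_def leq_iff by (auto 4 3) metis+

lemma ranked: "is_ranked_poset P"
  unfolding is_ranked_poset_def partial_order_on_def preorder_on_def
proof (intro conjI allI impI ballI)
  show "leq P \<subseteq> elems P \<times> elems P" by (auto simp: leq_iff elts_def)
  show "refl_on (elems P) (leq P)" by (auto simp: refl_on_def leq_iff)
  show "antisym (leq P)" by (rule antisymI) (auto simp: leq_iff)
  show "trans (leq P)"
  proof (rule transI)
    fix x y z assume xy: "(x, y) \<in> leq P" and yz: "(y, z) \<in> leq P"
    show "(x, z) \<in> leq P"
    proof (cases "x = y \<or> y = z")
      case False
      then obtain g h where g: "g \<in> G" "x = vt g \<and> y = ed g \<or> x = vt g \<and> y = fc g \<or> x = ed g \<and> y = fc g"
        and h: "h \<in> G" "y = vt h \<and> z = ed h \<or> y = vt h \<and> z = fc h \<or> y = ed h \<and> z = fc h"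
        using xy yz unfolding leq_iff by blast
      then have *: "x = vt g" "y = ed g" "ed g = ed h" "z = fc h"
        by (metis rk_ne)+
      then obtain k where "k \<in> G" "vt k = vt g" "fc k = fc h" using glue g(1) h(1) by blast
      then show ?thesis using * unfolding leq_iff by metis
    qed (use xy yz in auto)
  qed
  show "rk P x \<in> {0, 1, 2}" if "x \<in> elems P" for x using that by (auto simp: elts_def)
  show "rk P x < rk P y" if "(x, y) \<in> leq P \<and> x \<noteq> y" for x y using that by (auto simp: leq_iff)
qed

definition M :: "'g \<Rightarrow> nat set" where "M g = {vt g, ed g, fc g}"

lemma M_eq: assumes "g \<in> G" "h \<in> G" shows "M g = M h \<longleftrightarrow> g = h"
proof
  assume "M g = M h"
  moreover have "vt g \<in> M g" "ed g \<in> M g" "fc g \<in> M g" by (simp_all add: M_def)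
  ultimately have "vt g \<in> M h" "ed g \<in> M h" "fc g \<in> M h" by (simp_all only:)
  then have e: "vt g = vt h" "ed g = ed h" "fc g = fc h" by (auto simp: M_def)
  then have "h = g \<or> h = g * c" "h = g \<or> h = g * a" using vt_ed[OF assms] ed_fc[OF assms] by auto
  moreover have "g * c \<noteq> g * a" using cancel[OF assms(1), of c a] c_nD bD by metis
  ultimately show "g = h" by auto
qed simp

text \<open>If the chain contains an edge, flags for its vertex and for its face are glued along
  this edge. Without an edge, the incidence of vertex and face already provides a flag. A rank
  missing from the chain imposes no condition.\<close>

lemma chain_in_M:
  assumes "pred_on.chain elts (\<lambda>x y. (x, y) \<in> leq P) C"
  shows "\<exists>g\<in>G. C \<subseteq> M g"
proof -
  have C: "C \<subseteq> elts" and cmp: "\<And>x y. x \<in> C \<Longrightarrow> y \<in> C \<Longrightarrow> (x, y) \<in> leq P \<or> (y, x) \<in> leq P"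
    using assms leq_iff unfolding pred_on.chain_def by blast+
  have uniq: "x = y" if "x \<in> C" "y \<in> C" "x mod 3 = y mod 3" for x y
    using cmp[OF that(1,2)] that(3) by (auto simp: leq_iff)
  have vtC: "vt h \<in> C \<Longrightarrow> vt h' \<in> C \<Longrightarrow> vt h = vt h'" and edC: "ed h \<in> C \<Longrightarrow> ed h' \<in> C \<Longrightarrow> ed h = ed h'"
    and fcC: "fc h \<in> C \<Longrightarrow> fc h' \<in> C \<Longrightarrow> fc h = fc h'" for h h' using uniq by auto
  have sub: "C \<subseteq> M g" if "\<And>h. vt h \<in> C \<Longrightarrow> h \<in> G \<Longrightarrow> vt h = vt g" "\<And>h. ed h \<in> C \<Longrightarrow> h \<in> G \<Longrightarrow> ed h = ed g"
    "\<And>h. fc h \<in> C \<Longrightarrow> h \<in> G \<Longrightarrow> fc h = fc g" for g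
  proof
    fix x assume x: "x \<in> C"
    then have "x \<in> elts" using C by blast
    then show "x \<in> M g" using that x by (auto simp: elts_def M_def)
  qed
  show ?thesis
  proof (cases "\<exists>h\<in>G. ed h \<in> C")
    case True
    then obtain h where h: "h \<in> G" "ed h \<in> C" by blast
    obtain g1 where g1: "g1 \<in> G" "ed g1 = ed h" "\<And>h'. h' \<in> G \<Longrightarrow> vt h' \<in> C \<Longrightarrow> vt g1 = vt h'"
    proof (cases "\<exists>h'\<in>G. vt h' \<in> C")
      case True
      then obtain h' where h': "h' \<in> G" "vt h' \<in> C" by blast
      have "incident P (vt h') (ed h)" using cmp[OF h'(2) h(2)] by (simp add: incident_def)
      then obtain k where "k \<in> G" "vt k = vt h'" "ed k = ed h" using inc_ve h h' by blast
      then show ?thesis using that vtC h' by metis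
    next
      case False
      then show ?thesis using that h by blast
    qed
    obtain g2 where g2: "g2 \<in> G" "ed g2 = ed h" "\<And>h'. h' \<in> G \<Longrightarrow> fc h' \<in> C \<Longrightarrow> fc g2 = fc h'"
    proof (cases "\<exists>h'\<in>G. fc h' \<in> C")
      case True
      then obtain h' where h': "h' \<in> G" "fc h' \<in> C" by blast
      have "incident P (ed h) (fc h')" using cmp[OF h(2) h'(2)] by (simp add: incident_def)
      then obtain k where "k \<in> G" "ed k = ed h" "fc k = fc h'" using inc_ef h h' by blast
      then show ?thesis using that fcC h' by metis
    next
      case False
      then show ?thesis using that h by blast
    qed
    obtain k where k: "k \<in> G" "vt k = vt g1" "ed k = ed h" "fc k = fc g2"
      using glue[OF g1(1) g2(1)] g1(2) g2(2) by auto
    show ?thesis by (rule bexI[OF sub k(1)]) (use k g1 g2 edC h in \<open>metis+\<close>)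
  next
    case False
    then have ned: "\<And>h. h \<in> G \<Longrightarrow> ed h \<notin> C" by blast
    show ?thesis
    proof (cases "(\<exists>h\<in>G. vt h \<in> C) \<and> (\<exists>h\<in>G. fc h \<in> C)")
      case True
      then obtain h h' where h: "h \<in> G" "vt h \<in> C" "h' \<in> G" "fc h' \<in> C" by blast
      have "incident P (vt h) (fc h')" using cmp[OF h(2) h(4)] by (simp add: incident_def)
      then obtain k where k: "k \<in> G" "vt k = vt h" "fc k = fc h'" using inc_vf h by blast
      show ?thesis by (rule bexI[OF sub k(1)]) (use k h vtC fcC ned in \<open>metis+\<close>)
    next
      case False
      then consider "\<And>h. h \<in> G \<Longrightarrow> fc h \<notin> C" | "\<And>h. h \<in> G \<Longrightarrow> vt h \<notin> C" by blast
      then show ?thesis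
      proof cases
        case 1
        show ?thesis
        proof (cases "\<exists>h\<in>G. vt h \<in> C")
          case True
          then obtain h where h: "h \<in> G" "vt h \<in> C" by blast
          show ?thesis by (rule bexI[OF sub h(1)]) (use 1 h vtC ned in \<open>metis+\<close>)
        next
          case False
          show ?thesis by (rule bexI[OF sub one_G]) (use 1 False ned in blast)+
        qed
      next
        case 2
        show ?thesis
        proof (cases "\<exists>h\<in>G. fc h \<in> C")
          case True
          then obtain h where h: "h \<in> G" "fc h \<in> C" by blast
          show ?thesis by (rule bexI[OF sub h(1)]) (use 2 h fcC ned in \<open>metis+\<close>)
        next
          case False
          show ?thesis by (rule bexI[OF sub one_G]) (use 2 False ned in blast)+
        qed
      qed
    qed
  qed
qed

lemma flags_P: "flags P = M ` G"
proof -
  have chM: "pred_on.chain elts (\<lambda>x y. (x, y) \<in> leq P) (M g)" if "g \<in> G" for g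
    unfolding pred_on.chain_def using that by (auto simp: M_def elts_def leq_iff)
  have MM: "M g = M h" if "M g \<subseteq> M h" for g h
    using that by (auto simp: M_def)
  show ?thesis
  proof
    show "flags P \<subseteq> M ` G"
    proof
      fix \<Phi> assume "\<Phi> \<in> flags P"
      then have mc: "pred_on.maxchain elts (\<lambda>x y. (x, y) \<in> leq P) \<Phi>" by (simp add: flags_def)
      then obtain g where "g \<in> G" "\<Phi> \<subseteq> M g" using chain_in_M unfolding pred_on.maxchain_def by blast
      then have "\<Phi> = M g" using mc chM unfolding pred_on.maxchain_def by blast
      then show "\<Phi> \<in> M ` G" using \<open>g \<in> G\<close> by blast
    qed
    show "M ` G \<subseteq> flags P"
    proof
      fix \<Phi> assume "\<Phi> \<in> M ` G"
      then obtain g where g: "g \<in> G" "\<Phi> = M g" by blast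
      have "\<not> (pred_on.chain elts (\<lambda>x y. (x, y) \<in> leq P) S \<and> M g \<subset> S)" for S
      proof
        assume S: "pred_on.chain elts (\<lambda>x y. (x, y) \<in> leq P) S \<and> M g \<subset> S"
        then obtain h where "S \<subseteq> M h" using chain_in_M by blast
        then show False using MM[of g h] S by blast
      qed
      then show "\<Phi> \<in> flags P" using chM[OF g(1)] g(2) by (simp add: flags_def pred_on.maxchain_def)
    qed
  qed
qed

lemma ends: assumes g: "g \<in> G"
  shows "{v \<in> vertices P. incident P v (ed g)} = {vt g, vt (g * a)}"
    and "vt g \<noteq> vt (g * a)"
proof -
  have "vt h \<in> {vt g, vt (g * a)}" if h: "h \<in> G" "ed h = ed g" for h
    using g h(1) h(2)[symmetric] by (cases rule: ed_cases) (auto simp: vt_inv right_G g aa_c mult.assoc vt_inv[of "g * a", unfolded mult.assoc])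
  then show "{v \<in> vertices P. incident P v (ed g)} = {vt g, vt (g * a)}"
    unfolding of_rank_P using inc_ve g right_G(1)[OF g] ed_inv(1)[OF g] by (auto 4 3) metis
  show "vt g \<noteq> vt (g * a)"
    using vt_eq[OF g right_G(1)[OF g]] cancel[OF g] a_nE by metis
qed

lemma cofaces: assumes g: "g \<in> G"
  shows "{f \<in> faces P. incident P (ed g) f} = {fc g, fc (g * c)}"
    and "fc g \<noteq> fc (g * c)"
proof -
  have "fc h \<in> {fc g, fc (g * c)}" if h: "h \<in> G" "ed h = ed g" for h
    using g h(1) h(2)[symmetric] by (cases rule: ed_cases) (auto simp: fc_inv right_G g)
  then show "{f \<in> faces P. incident P (ed g) f} = {fc g, fc (g * c)}"
    unfolding of_rank_P using inc_ef g right_G(3)[OF g] ed_inv(2)[OF g] by (auto 4 3) metis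
  show "fc g \<noteq> fc (g * c)"
    using fc_eq[OF g right_G(3)[OF g]] cancel[OF g] c_nD by metis
qed

lemma V_nat: obtains n where "V i = V (int n)"
proof
  show "V i = V (int (nat (i mod int q)))" by (rule V_cong) (use q0 in simp)
qed

text \<open>Every vertex is represented by some \<open>U n\<close>, and
  \<open>U (n + 1) = U n * a * b\<close> represents the same vertex as \<open>U n * a\<close>, which
  is adjacent to that of \<open>U n\<close>.\<close>

lemma skeleton_connected: "connected_multigraph (skeleton P)"
proof -
  let ?E = "{(x, y). \<exists>e \<in> medges (skeleton P). mends (skeleton P) e = {x, y}}"
  have sym: "sym (?E\<^sup>*)" by (rule sym_rtrancl) (auto simp: sym_def insert_commute)
  have step: "(vt g, vt (g * a)) \<in> ?E" if "g \<in> G" for g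
    using ends(1)[OF that] that by (auto simp: skeleton_def of_rank_P)
  have Un: "(vt 1, vt (U (int n))) \<in> ?E\<^sup>*" for n
  proof (induction n)
    case (Suc n)
    have "U (int (Suc n)) = U (int n) * U 1" by (simp add: add.commute)
    then have eq: "vt (U (int (Suc n))) = vt (U (int n) * a)"
      using vt_inv(1)[of "U (int n) * a"] right_G(1)[OF U_G] by (simp add: U1 mult.assoc)
    show ?case unfolding eq by (rule rtrancl_into_rtrancl[OF Suc step[OF U_G]])
  qed simp
  have from1: "(vt 1, vt g) \<in> ?E\<^sup>*" if g: "g \<in> G" for g
  proof -
    obtain i e j where gi: "g = U i * (B e * V j)" using g by (auto simp: G_def)
    then have "vt g = vt (U i)" using vt_eq[OF U_G[of i] g] EI by metis
    moreover obtain n where "U i = U (int n)" by (rule U_nat)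
    ultimately show ?thesis using Un by simp
  qed
  show ?thesis unfolding connected_multigraph_def
  proof (intro ballI)
    fix u v assume "u \<in> mverts (skeleton P)" "v \<in> mverts (skeleton P)"
    then have "(vt 1, u) \<in> ?E\<^sup>*" "(vt 1, v) \<in> ?E\<^sup>*" using from1 by (auto simp: skeleton_def of_rank_P)
    then show "(u, v) \<in> ?E\<^sup>*" using sym by (meson rtrancl_trans symD)
  qed
qed

text \<open>The coset \<open>cs E g\<close> is the set of flags at the vertex. Right multiplication
  by \<open>c\<close> keeps the edge and by \<open>b\<close> keeps the face, so these are the two
  neighbour maps for \<open>polygonalI\<close>.\<close>

lemma vertex_figure: assumes g: "g \<in> G" shows "polygonal (strictly_above P (vt g))"
proof (rule polygonalI[where lo = ed and hi = fc and S = "\<lambda>k. k * c" and T = "\<lambda>k. k * b" and K = "cs E g" and base = g])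
  have KG: "k \<in> G" if "k \<in> cs E g" for k using that cs_G[OF E_G g] by auto
  have K: "k \<in> cs E g \<longleftrightarrow> k \<in> G \<and> vt k = vt g" for k
    using vt_eq[OF g, of k] KG[of k] mem_cs[of k E g] by metis
  have up: "(vt g, y) \<in> leq P \<and> y \<noteq> vt g \<longleftrightarrow> y \<in> ed ` cs E g \<union> fc ` cs E g" for y
  proof -
    have "(vt g, y) \<in> leq P \<and> y \<noteq> vt g \<longleftrightarrow> (\<exists>h\<in>G. vt g = vt h \<and> (y = ed h \<or> y = fc h))"
      by (auto simp: leq_iff)
    then show ?thesis unfolding image_iff Un_iff Bex_def K by metis
  qed
  show "strictly_above P (vt g) = Id_on (ed ` cs E g \<union> fc ` cs E g) \<union> {(ed k, fc k) |k. k \<in> cs E g}"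
    unfolding strictly_above_def up
  proof (intro equalityI subrelI)
    fix x y assume "(x, y) \<in> Restr (leq P) {y. y \<in> ed ` cs E g \<union> fc ` cs E g}"
    then have xy: "(x, y) \<in> leq P" "x \<in> ed ` cs E g \<union> fc ` cs E g" "y \<in> ed ` cs E g \<union> fc ` cs E g" by auto
    show "(x, y) \<in> Id_on (ed ` cs E g \<union> fc ` cs E g) \<union> {(ed k, fc k) |k. k \<in> cs E g}"
    proof (cases "x = y")
      case False
      then obtain h where h: "h \<in> G" "x = ed h" "y = fc h" using xy by (auto simp: leq_iff)
      then obtain k where k: "k \<in> cs E g" "ed k = ed h" using xy(2) by auto
      obtain m where "m \<in> G" "vt m = vt k" "ed m = ed k" "fc m = fc h" using glue[of k h] k h KG by auto
      then show ?thesis using k h K by auto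
    qed (use xy in auto)
  next
    fix x y assume "(x, y) \<in> Id_on (ed ` cs E g \<union> fc ` cs E g) \<union> {(ed k, fc k) |k. k \<in> cs E g}"
    then show "(x, y) \<in> Restr (leq P) {y. y \<in> ed ` cs E g \<union> fc ` cs E g}"
      using KG by (auto simp: leq_iff elts_def)
  qed
  show "ed ` cs E g \<inter> fc ` cs E g = {}" by auto
  show Sc: "k * c \<in> cs E g" and Sb: "k * b \<in> cs E g" if "k \<in> cs E g" for k
    using that K vt_inv right_G by auto
  show "k * c \<noteq> k" "k * b \<noteq> k" "k * c \<noteq> k * b" if "k \<in> cs E g" for k using ne_gens KG that by auto
  show "ed k = ed k' \<longleftrightarrow> k' = k \<or> k' = k * c" if "k \<in> cs E g" "k' \<in> cs E g" for k k'
    using vt_ed[of k k'] that K by auto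
  show "fc k = fc k' \<longleftrightarrow> k' = k \<or> k' = k * b" if "k \<in> cs E g" "k' \<in> cs E g" for k k'
    using vt_fc[of k k'] that K by auto
  show gK: "g \<in> cs E g" using K g by simp
  let ?R = "{(k, k'). k \<in> cs E g \<and> (k' = k * c \<or> k' = k * b)}"
  \<comment> \<open>One more factor \<open>V 1 = b * c\<close> is one step by \<open>b\<close>
    followed by one by \<open>c\<close>.\<close>
  have Vn: "g * V (int n) \<in> cs E g \<and> (g, g * V (int n)) \<in> ?R\<^sup>*" for n
  proof (induction n)
    case (Suc n)
    let ?k = "g * V (int n)"
    have "V (int (Suc n)) = V (int n) * V 1" by (simp add: add.commute)
    then have k: "g * V (int (Suc n)) = ?k * b * c" by (simp add: V1 mult.assoc)
    have "(?k, ?k * b) \<in> ?R" "(?k * b, ?k * b * c) \<in> ?R" using Suc Sb by auto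
    then show ?case unfolding k using Suc Sc Sb by (meson rtrancl.rtrancl_into_rtrancl)
  qed (use gK in simp)
  show "(g, k) \<in> ?R\<^sup>*" if k: "k \<in> cs E g" for k
  proof -
    obtain e j where k: "k = g * (B e * V j)" using k by (auto simp: cs_def E_def)
    obtain n where n: "V (if e then - j else j) = V (int n)" by (rule V_nat)
    have "B e * V j = V (int n) * B e" using VB[of "if e then - j else j" e 1] unfolding n by (cases e) auto
    then have k: "k = g * V (int n) * B e" by (simp add: k mult.assoc)
    show ?thesis
    proof (cases e)
      case True
      then have "(g * V (int n), k) \<in> ?R" using Vn k by simp
      then show ?thesis using Vn by (meson rtrancl.rtrancl_into_rtrancl)
    qed (use Vn k in simp)
  qed
qed

lemma face_polygon: assumes g: "g \<in> G" shows "polygonal (strictly_below P (fc g))"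
proof (rule polygonalI[where lo = vt and hi = ed and S = "\<lambda>k. k * b" and T = "\<lambda>k. k * a" and K = "cs D g" and base = g])
  have KG: "k \<in> G" if "k \<in> cs D g" for k using that cs_G[OF D_G g] by auto
  have K: "k \<in> cs D g \<longleftrightarrow> k \<in> G \<and> fc k = fc g" for k
    using fc_eq[OF g, of k] KG[of k] mem_cs[of k D g] by metis
  have dn: "(y, fc g) \<in> leq P \<and> y \<noteq> fc g \<longleftrightarrow> y \<in> vt ` cs D g \<union> ed ` cs D g" for y
  proof -
    have "(y, fc g) \<in> leq P \<and> y \<noteq> fc g \<longleftrightarrow> (\<exists>h\<in>G. fc g = fc h \<and> (y = vt h \<or> y = ed h))"
      by (auto simp: leq_iff)
    then show ?thesis unfolding image_iff Un_iff Bex_def K by metis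
  qed
  show "strictly_below P (fc g) = Id_on (vt ` cs D g \<union> ed ` cs D g) \<union> {(vt k, ed k) |k. k \<in> cs D g}"
    unfolding strictly_below_def dn
  proof (intro equalityI subrelI)
    fix x y assume "(x, y) \<in> Restr (leq P) {y. y \<in> vt ` cs D g \<union> ed ` cs D g}"
    then have xy: "(x, y) \<in> leq P" "x \<in> vt ` cs D g \<union> ed ` cs D g" "y \<in> vt ` cs D g \<union> ed ` cs D g" by auto
    show "(x, y) \<in> Id_on (vt ` cs D g \<union> ed ` cs D g) \<union> {(vt k, ed k) |k. k \<in> cs D g}"
    proof (cases "x = y")
      case False
      then obtain h where h: "h \<in> G" "x = vt h" "y = ed h" using xy by (auto simp: leq_iff)
      then obtain k where k: "k \<in> cs D g" "ed k = ed h" using xy(3) by auto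
      obtain m where "m \<in> G" "vt m = vt h" "ed m = ed h" "fc m = fc k" using glue[of h k] k h KG by auto
      then show ?thesis using k h K by auto
    qed (use xy in auto)
  next
    fix x y assume "(x, y) \<in> Id_on (vt ` cs D g \<union> ed ` cs D g) \<union> {(vt k, ed k) |k. k \<in> cs D g}"
    then show "(x, y) \<in> Restr (leq P) {y. y \<in> vt ` cs D g \<union> ed ` cs D g}"
      using KG by (auto simp: leq_iff elts_def)
  qed
  show "vt ` cs D g \<inter> ed ` cs D g = {}" by auto
  show Sb: "k * b \<in> cs D g" and Sa: "k * a \<in> cs D g" if "k \<in> cs D g" for k
    using that K fc_inv right_G by auto
  show "k * b \<noteq> k" "k * a \<noteq> k" "k * b \<noteq> k * a" if "k \<in> cs D g" for k using ne_gens KG that by auto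
  show "vt k = vt k' \<longleftrightarrow> k' = k \<or> k' = k * b" if "k \<in> cs D g" "k' \<in> cs D g" for k k'
    using vt_fc[of k k'] that K by auto
  show "ed k = ed k' \<longleftrightarrow> k' = k \<or> k' = k * a" if "k \<in> cs D g" "k' \<in> cs D g" for k k'
    using ed_fc[of k k'] that K by auto
  show gK: "g \<in> cs D g" using K g by simp
  let ?R = "{(k, k'). k \<in> cs D g \<and> (k' = k * b \<or> k' = k * a)}"
  have Un: "g * U (int n) \<in> cs D g \<and> (g, g * U (int n)) \<in> ?R\<^sup>*" for n
  proof (induction n)
    case (Suc n)
    let ?k = "g * U (int n)"
    have "U (int (Suc n)) = U (int n) * U 1" by (simp add: add.commute)
    then have k: "g * U (int (Suc n)) = ?k * a * b" by (simp add: U1 mult.assoc)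
    have "(?k, ?k * a) \<in> ?R" "(?k * a, ?k * a * b) \<in> ?R" using Suc Sa by auto
    then show ?case unfolding k using Suc Sa Sb by (meson rtrancl.rtrancl_into_rtrancl)
  qed (use gK in simp)
  show "(g, k) \<in> ?R\<^sup>*" if k: "k \<in> cs D g" for k
  proof -
    obtain e i where k: "k = g * (U i * B e)" using k by (auto simp: cs_def D_def)
    obtain n where n: "U i = U (int n)" by (rule U_nat)
    have k: "k = g * U (int n) * B e" by (simp add: k n mult.assoc)
    show ?thesis
    proof (cases e)
      case True
      then have "(g * U (int n), k) \<in> ?R" using Un k by simp
      then show ?thesis using Un by (meson rtrancl.rtrancl_into_rtrancl)
    qed (use Un k in simp)
  qed
qed

lemma polyhedron_P: "polyhedron P"
  unfolding polyhedron_def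
proof (intro conjI ballI)
  show "is_ranked_poset P" by (rule ranked)
  show "connected_multigraph (skeleton P)" by (rule skeleton_connected)
  show "polygonal (strictly_above P v)" if "v \<in> vertices P" for v using that vertex_figure by (auto simp: of_rank_P)
  show "polygonal (strictly_below P f)" if "f \<in> faces P" for f using that face_polygon by (auto simp: of_rank_P)
  show "card {v \<in> vertices P. incident P v e} = 2" if "e \<in> edges P" for e
    using that ends by (auto simp: of_rank_P(2))
  show "card {f \<in> faces P. incident P e f} = 2" if "e \<in> edges P" for e
    using that cofaces by (auto simp: of_rank_P(2))
  fix \<Phi> assume "\<Phi> \<in> flags P"
  then obtain g where "g \<in> G" "\<Phi> = M g" using flags_P by auto
  then show "\<exists>v\<in>vertices P. \<exists>e\<in>edges P. \<exists>f\<in>faces P. \<Phi> = {v, e, f} \<and> incident P v e \<and> incident P e f \<and> incident P v f"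
    unfolding of_rank_P M_def using inc_ve inc_ef inc_vf by blast
qed

text \<open>Left multiplication by \<open>h\<close>: \<open>n div 3\<close> is decoded into a coset
  and \<open>n mod 3\<close> is kept as its rank. The restriction to \<open>elts\<close> is what
  \<open>Bij\<close> requires.\<close>

definition shift :: "'g \<Rightarrow> nat \<Rightarrow> nat" where
  "shift h = (\<lambda>n\<in>elts. 3 * enc ((\<lambda>z. h * z) ` inv_into (Pow G) enc (n div 3)) + n mod 3)"

lemma cs_shift: "(\<lambda>z. h * z) ` cs K g = cs K (h * g)"
  by (auto simp: cs_def image_image mult.assoc)

lemma shift: assumes "g \<in> G"
  shows "shift h (vt g) = vt (h * g)" "shift h (ed g) = ed (h * g)" "shift h (fc g) = fc (h * g)"
proof -
  have el: "vt g \<in> elts" "ed g \<in> elts" "fc g \<in> elts" using assms by (auto simp: elts_def)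
  have d: "vt g div 3 = enc (cs E g)" "ed g div 3 = enc (cs T g)" "fc g div 3 = enc (cs D g)"
    unfolding vt_def ed_def fc_def by simp_all
  have i: "inv_into (Pow G) enc (enc (cs K g)) = cs K g" if "K \<subseteq> G" for K
    using inv_into_f_f[OF enc cs_G[OF that assms]] .
  show "shift h (vt g) = vt (h * g)" "shift h (ed g) = ed (h * g)" "shift h (fc g) = fc (h * g)"
    unfolding shift_def using el d i[OF E_G] i[OF T_G] i[OF D_G]
    by (simp_all add: cs_shift) (simp_all add: vt_def ed_def fc_def)
qed

lemma elts_cases:
  assumes "x \<in> elts" obtains g where "g \<in> G" "x = vt g \<or> x = ed g \<or> x = fc g"
  using assms by (auto simp: elts_def)

lemma shift_elts: "h \<in> G \<Longrightarrow> x \<in> elts \<Longrightarrow> shift h x \<in> elts \<and> shift h x mod 3 = x mod 3"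
  by (erule elts_cases) (use G_mult shift in \<open>auto simp: elts_def\<close>)

lemma shift_shift:
  assumes "h * h' = 1" "h' \<in> G" "x \<in> elts" shows "shift h (shift h' x) = x"
proof -
  obtain g where g: "g \<in> G" "x = vt g \<or> x = ed g \<or> x = fc g" using elts_cases assms(3) by blast
  have "h * (h' * g) = g" using assms(1) by (simp flip: mult.assoc)
  then show ?thesis using g shift[OF g(1)] shift[OF G_mult[OF assms(2) g(1)], of h] by auto
qed

lemma shift_leq: assumes "h \<in> G" "(x, y) \<in> leq P" shows "(shift h x, shift h y) \<in> leq P"
proof -
  from assms(2) consider "x \<in> elts" "x = y" | g where "g \<in> G" "x = vt g \<and> y = ed g \<or> x = vt g \<and> y = fc g \<or> x = ed g \<and> y = fc g"
    unfolding leq_iff by blast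
  then show ?thesis
  proof cases
    case 1
    then show ?thesis using shift_elts[OF assms(1)] by (simp add: leq_iff)
  next
    case 2
    then show ?thesis using shift[OF 2(1)] G_mult[OF assms(1) 2(1)] unfolding leq_iff by metis
  qed
qed

lemma shift_aut: assumes h: "h \<in> G" shows "shift h \<in> carrier (aut_group P)"
proof -
  obtain h' where h': "h' \<in> G" "h * h' = 1" "h' * h = 1" using G_inv h by blast
  have bij: "bij_betw (shift h) elts elts"
    by (rule bij_betwI[where g = "shift h'"])
      (use shift_elts h h' shift_shift[OF h'(2) h'(1)] shift_shift[OF h'(3) h] in auto)
  have "incident P x y \<longleftrightarrow> incident P (shift h x) (shift h y)" if "x \<in> elts" "y \<in> elts" for x y
    using shift_leq[OF h, of x y] shift_leq[OF h, of y x] shift_leq[OF h'(1), of "shift h x" "shift h y"]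
      shift_leq[OF h'(1), of "shift h y" "shift h x"] shift_shift[OF h'(3) h] that
    unfolding incident_def by auto
  then have "poly_iso_map P P (shift h)"
    unfolding poly_iso_map_def using bij shift_elts[OF h] by simp
  moreover have "shift h \<in> Bij elts" using bij by (simp add: Bij_def shift_def)
  ultimately show ?thesis by (simp add: aut_group_def)
qed

lemma regular_P: "regular_poly P"
  unfolding regular_poly_def
proof (intro conjI ballI)
  show "polyhedron P" by (rule polyhedron_P)
  fix \<Phi> \<Psi> assume "\<Phi> \<in> flags P" "\<Psi> \<in> flags P"
  then obtain g h where gh: "g \<in> G" "h \<in> G" "\<Phi> = M g" "\<Psi> = M h" using flags_P by auto
  obtain g' where g': "g' \<in> G" "g' * g = 1" using G_inv gh by blast
  have "shift (h * g') ` \<Phi> = \<Psi>"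
    using shift[OF gh(1), of "h * g'"] g'(2) by (simp add: gh M_def mult.assoc)
  then show "\<exists>\<gamma>\<in>carrier (aut_group P). \<gamma> ` \<Phi> = \<Psi>"
    using shift_aut[OF G_mult[OF gh(2) g'(1)]] by blast
qed

lemma face_edges: assumes g: "g \<in> G" shows "card {e \<in> edges P. incident P e (fc g)} = p"
proof -
  have gU: "g * U i \<in> G" for i by (intro G_mult g U_G)
  have fU: "fc (g * U i) = fc g" for i
    using fc_eq[OF g gU[of i]] DI[of i False] by auto
  have "{e \<in> edges P. incident P e (fc g)} = (\<lambda>i. ed (g * U (int i))) ` {..<p}"
  proof
    show "(\<lambda>i. ed (g * U (int i))) ` {..<p} \<subseteq> {e \<in> edges P. incident P e (fc g)}"
    proof (rule image_subsetI)
      fix i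
      have "incident P (ed (g * U (int i))) (fc g)" using inc_ef[OF gU g] gU fU by blast
      then show "ed (g * U (int i)) \<in> {e \<in> edges P. incident P e (fc g)}" using gU by (auto simp: of_rank_P)
    qed
    show "{e \<in> edges P. incident P e (fc g)} \<subseteq> (\<lambda>i. ed (g * U (int i))) ` {..<p}"
    proof
      fix e assume "e \<in> {e \<in> edges P. incident P e (fc g)}"
      then obtain h where "h \<in> G" "e = ed h" "incident P (ed h) (fc g)" by (auto simp: of_rank_P(2))
      then obtain k where k: "k \<in> G" "e = ed k" "fc k = fc g" using inc_ef g by metis
      then obtain i f where kd: "k = g * (U i * B f)" using fc_eq[OF g k(1)] by (auto simp: D_def)
      \<comment> \<open>A trailing \<open>b\<close> is removed by a factor \<open>a\<close>, which
        keeps the edge: \<open>U i * b * a = U (i - 1)\<close>.\<close>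
      have "\<exists>j. ed k = ed (g * U j)"
      proof (cases f)
        case True
        have "U i * b * a = U (i - 1)"
        proof -
          have "U i * b * a = U i * U (-1)" by (simp add: Um1 mult.assoc)
          then show ?thesis by simp
        qed
        then have "k * a = g * U (i - 1)" using True by (simp add: kd mult.assoc)
        then show ?thesis using ed_inv(1)[OF k(1)] by metis
      qed (use kd in auto)
      then obtain j where j: "ed k = ed (g * U j)" by blast
      have "U j = U (int (nat (j mod int p)))" by (rule U_cong) (use p0 in simp)
      then have "e = ed (g * U (int (nat (j mod int p))))" using j k(2) by simp
      moreover have "nat (j mod int p) < p" using p0 by (simp add: nat_less_iff)
      ultimately show "e \<in> (\<lambda>i. ed (g * U (int i))) ` {..<p}" by blast
    qed
  qed
  moreover have "inj_on (\<lambda>i. ed (g * U (int i))) {..<p}"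
  proof (rule inj_onI)
    fix i j assume ij: "i \<in> {..<p}" "j \<in> {..<p}" "ed (g * U (int i)) = ed (g * U (int j))"
    then have "g * U (int j) = g * U (int i) \<or> g * U (int j) = g * U (int i) * a"
      using ed_fc[OF gU gU, of "int i" "int j"] fU by simp
    \<comment> \<open>The second possibility has a factor \<open>b\<close> in its normal form,
      whereas \<open>U j\<close> has none.\<close>
    then have "U (int j) = U (int i) \<or> U (int j) = U (int i) * a"
      using cancel[OF g] by (metis mult.assoc)
    moreover have "U (int i) * a = U (int i + 1) * (B True * V 0)"
    proof -
      have "U (int i) * a = U (int i) * (U 1 * b)" by (simp only: a_nf[symmetric])
      then show ?thesis by simp
    qed
    ultimately have "U (int j) = U (int i)"
      using nf_eq[of "int j" False 0 "int i + 1" True 0] by auto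
    then have "int j mod int p = int i mod int p" unfolding U_eq_iff by (simp add: mod_eq_dvd_iff)
    then show "i = j" using ij by simp
  qed
  ultimately show ?thesis by (simp add: card_image)
qed

lemma vertex_edges: assumes g: "g \<in> G" shows "card {e \<in> edges P. incident P (vt g) e} = q"
proof -
  have gV: "g * V i \<in> G" for i by (intro G_mult g V_G)
  have vV: "vt (g * V i) = vt g" for i
    using vt_eq[OF g gV[of i]] EI[of False i] by auto
  have "{e \<in> edges P. incident P (vt g) e} = (\<lambda>i. ed (g * V (int i))) ` {..<q}"
  proof
    show "(\<lambda>i. ed (g * V (int i))) ` {..<q} \<subseteq> {e \<in> edges P. incident P (vt g) e}"
    proof (rule image_subsetI)
      fix i
      have "incident P (vt g) (ed (g * V (int i)))" using inc_ve[OF g gV] gV vV by blast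
      then show "ed (g * V (int i)) \<in> {e \<in> edges P. incident P (vt g) e}" using gV by (auto simp: of_rank_P)
    qed
    show "{e \<in> edges P. incident P (vt g) e} \<subseteq> (\<lambda>i. ed (g * V (int i))) ` {..<q}"
    proof
      fix e assume "e \<in> {e \<in> edges P. incident P (vt g) e}"
      then obtain h where "h \<in> G" "e = ed h" "incident P (vt g) (ed h)" by (auto simp: of_rank_P(2))
      then obtain k where k: "k \<in> G" "e = ed k" "vt k = vt g" using inc_ve g by metis
      then obtain i f where kd: "k = g * (B f * V i)" using vt_eq[OF g k(1)] by (auto simp: E_def)
      have "\<exists>j. ed k = ed (g * V j)"
      proof (cases f)
        case True
        have "b * V i * c = V (1 - i)"
        proof -
          have "b * V i * c = V (- i) * V 1" by (simp add: bV V1 mult.assoc)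
          then show ?thesis by simp
        qed
        then have "k * c = g * V (1 - i)" using True by (simp add: kd mult.assoc)
        then show ?thesis using ed_inv(2)[OF k(1)] by metis
      qed (use kd in auto)
      then obtain j where j: "ed k = ed (g * V j)" by blast
      have "V j = V (int (nat (j mod int q)))" by (rule V_cong) (use q0 in simp)
      then have "e = ed (g * V (int (nat (j mod int q))))" using j k(2) by simp
      moreover have "nat (j mod int q) < q" using q0 by (simp add: nat_less_iff)
      ultimately show "e \<in> (\<lambda>i. ed (g * V (int i))) ` {..<q}" by blast
    qed
  qed
  moreover have "inj_on (\<lambda>i. ed (g * V (int i))) {..<q}"
  proof (rule inj_onI)
    fix i j assume ij: "i \<in> {..<q}" "j \<in> {..<q}" "ed (g * V (int i)) = ed (g * V (int j))"
    then have "g * V (int j) = g * V (int i) \<or> g * V (int j) = g * V (int i) * c"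
      using vt_ed[OF gV gV, of "int i" "int j"] vV by simp
    then have "V (int j) = V (int i) \<or> V (int j) = V (int i) * c"
      using cancel[OF g] by (metis mult.assoc)
    moreover have "V (int i) * c = B True * V (1 - int i)"
    proof -
      have "V (int i) * c = V (int i) * (b * V 1)" by (simp only: c_nf[symmetric])
      then show ?thesis by (simp add: Vb)
    qed
    ultimately have "V (int j) = V (int i)"
      using E_eq_iff[of False "int j" True "1 - int i"] by auto
    then have "int j mod int q = int i mod int q" unfolding V_eq_iff by (simp add: mod_eq_dvd_iff)
    then show "i = j" using ij by simp
  qed
  ultimately show ?thesis by (simp add: card_image)
qed

theorem tight_regular_P: "tight_regular p q P"
proof -
  have "inj_on M G" by (rule inj_onI) (use M_eq in blast)
  then have "card (flags P) = 2 * p * q" by (simp add: flags_P card_image card_G)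
  moreover have "has_type P p q"
    unfolding has_type_def using face_edges vertex_edges by (auto simp: of_rank_P(1,3))
  moreover have "finite (elems P)" using finite_G by (simp add: elts_def)
  ultimately show ?thesis using regular_P by (simp add: tight_regular_def)
qed

end

theorem (in tight_triple) ex_tight_regular:
  assumes "p \<ge> 2" "q \<ge> 2"
  shows "\<exists>P :: nat ranked_poset. tight_regular p q P"
proof -
  obtain enc :: "'g set \<Rightarrow> nat" where "inj_on enc (Pow G)"
    using finite_imp_inj_to_nat_seg[of "Pow G"] finite_G by blast
  then interpret coset_geometry a b c p q enc by unfold_locales (use assms in auto)
  show ?thesis using tight_regular_P by blast
qed

section \<open>Existence and the classification\<close>

context coxeter_pair begin

lemma closed_from_law: "law \<epsilon> \<tau> \<Longrightarrow> c * U i \<in> G"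
proof -
  assume law: "law \<epsilon> \<tau>"
  obtain n where "U i = U (int n)" by (rule U_nat)
  then have "c * U i = U (int n) * (B (\<epsilon> n) * V (\<tau> n))" using law by (simp add: law_def)
  then show ?thesis by auto
qed

text \<open>\<open>c\<close> passes even powers of \<open>a * b\<close> unchanged, and passing one
  further factor \<open>a * b\<close> costs \<open>b * V (-1)\<close>, because
  \<open>c * a * b = a * c * b\<close>. Hence only the parity of \<open>n\<close> matters.\<close>

lemma even_law:
  assumes "c * U 2 = U 2 * c"
  shows "law (\<lambda>_. True) (\<lambda>n. if even n then 1 else -1)"
proof -
  have c2: "c * U (2 * int n) = U (2 * int n) * c" for n
  proof (induction n)
    case (Suc n)
    have "c * U (2 * int (Suc n)) = (c * U 2) * U (2 * int n)" by (simp add: mult.assoc algebra_simps)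
    also have "\<dots> = U 2 * (c * U (2 * int n))" unfolding assms by (simp only: mult.assoc)
    also have "\<dots> = U (2 * int (Suc n)) * c" unfolding Suc by (simp add: algebra_simps)
    finally show ?case .
  qed simp
  have c1: "c * U 1 = U 1 * (b * V (-1))"
  proof -
    have "c * U 1 = (c * a) * b" by (simp only: U1 mult.assoc)
    also have "\<dots> = (a * c) * b" by (simp only: ac[symmetric])
    also have "\<dots> = U 1 * (b * V (-1))" by (simp add: U1 Vm1 mult.assoc)
    finally show ?thesis .
  qed
  have "c * U (int n) = U (int n) * (B True * V (if even n then 1 else -1))" for n
  proof (cases "even n")
    case True
    then obtain k where "n = 2 * k" by (rule evenE)
    then show ?thesis using c2[of k] by (simp add: c_nf[symmetric])
  next
    case False
    then obtain k where k: "n = 2 * k + 1" by (rule oddE)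
    have "c * U (int n) = (c * U (2 * int k)) * U 1" by (simp add: k mult.assoc add.commute)
    also have "\<dots> = U (2 * int k) * (c * U 1)" unfolding c2 by (simp only: mult.assoc)
    also have "\<dots> = U (int n) * (b * V (-1))" unfolding c1 by (simp add: k add.commute)
    finally show ?thesis using False by simp
  qed
  then show ?thesis by (simp add: law_def)
qed

end

section \<open>Concrete triples in products of permutation groups\<close>

definition prod_endo :: "('a \<Rightarrow> 'a) \<Rightarrow> ('b \<Rightarrow> 'b) \<Rightarrow> ('a \<times> 'b) endo" where
  "prod_endo f g = Endo (map_prod f g)"

lemma prod_endo_mult: "prod_endo f g * prod_endo f' g' = prod_endo (f \<circ> f') (g \<circ> g')"
  by (simp add: prod_endo_def times_endo_def map_prod_compose)

lemma prod_endo_one: "1 = prod_endo id id"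
  by (simp add: prod_endo_def one_endo_def map_prod.id)

lemma prod_endo_eq: "prod_endo f g = prod_endo f' g' \<longleftrightarrow> f = f' \<and> g = g'"
proof
  assume "prod_endo f g = prod_endo f' g'"
  then have "map_prod f g (x, y) = map_prod f' g' (x, y)" for x y by (simp add: prod_endo_def)
  then show "f = f' \<and> g = g'" by (auto simp: fun_eq_iff)
qed simp

lemma prod_endo_pow: "prod_endo f g ^ n = prod_endo (f ^^ n) (g ^^ n)"
proof (induction n)
  case 0
  show ?case by (simp only: power_0 funpow.simps(1) prod_endo_one)
next
  case (Suc n)
  show ?case by (simp only: power_Suc funpow.simps(2) prod_endo_mult Suc)
qed

lemma invol_funpow: "f \<circ> f = id \<Longrightarrow> f ^^ j = (if odd j then f else id)"
proof (induction j)
  case 0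
  show ?case by (simp only: funpow.simps(1) even_zero not_True_eq_False if_False)
next
  case (Suc j)
  show ?case unfolding funpow.simps(2) Suc.IH[OF Suc.prems] using Suc.prems by (cases "odd j") simp_all
qed

text \<open>Rotations and reflections of the residues modulo \<open>n\<close>, extended by the
  identity to all integers so that their relations are equations between functions.\<close>

definition cyc_rot :: "nat \<Rightarrow> int \<Rightarrow> int \<Rightarrow> int" where
  "cyc_rot n d t = (if t \<in> {0..<int n} then (t + d) mod int n else t)"

definition cyc_refl :: "nat \<Rightarrow> int \<Rightarrow> int \<Rightarrow> int" where
  "cyc_refl n d t = (if t \<in> {0..<int n} then (d - t) mod int n else t)"

context
  fixes n :: nat
  assumes n: "n > 0"
begin

lemma cyc_rot_rot: "cyc_rot n d \<circ> cyc_rot n e = cyc_rot n (d + e)"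
  using n by (auto simp: fun_eq_iff cyc_rot_def mod_simps algebra_simps)

lemma cyc_refl_refl: "cyc_refl n d \<circ> cyc_refl n e = cyc_rot n (d - e)"
  using n by (auto simp: fun_eq_iff cyc_rot_def cyc_refl_def mod_simps algebra_simps)

lemma cyc_rot_refl: "cyc_rot n d \<circ> cyc_refl n e = cyc_refl n (d + e)"
  using n by (auto simp: fun_eq_iff cyc_rot_def cyc_refl_def mod_simps algebra_simps)

lemma cyc_rot_0: "cyc_rot n 0 = id"
  using n by (auto simp: fun_eq_iff cyc_rot_def)

lemma cyc_rot_pow: "cyc_rot n d ^^ k = cyc_rot n (int k * d)"
  by (induction k) (simp_all add: cyc_rot_0 cyc_rot_rot algebra_simps)

lemma cyc_rot_eq: "cyc_rot n d = cyc_rot n e \<longleftrightarrow> int n dvd d - e"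
proof
  assume "cyc_rot n d = cyc_rot n e"
  then have "cyc_rot n d 0 = cyc_rot n e 0" by simp
  then show "int n dvd d - e" using n by (simp add: cyc_rot_def mod_eq_dvd_iff)
next
  assume "int n dvd d - e"
  then have "(t + d) mod int n = (t + e) mod int n" for t by (simp add: mod_eq_dvd_iff)
  then show "cyc_rot n d = cyc_rot n e" by (auto simp: fun_eq_iff cyc_rot_def)
qed

text \<open>Comparing the values at 0 and 1 gives \<open>n dvd 2\<close>. The bound
  \<open>n > 2\<close> is the reason for the enlarged moduli \<open>2 * p\<close>,
  \<open>2 * q\<close> and \<open>4 * r\<close> below.\<close>

lemma cyc_rot_ne_refl: "n > 2 \<Longrightarrow> cyc_rot n d \<noteq> cyc_refl n e"
proof
  assume n2: "n > 2" and eq: "cyc_rot n d = cyc_refl n e"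
  then have "cyc_rot n d 0 = cyc_refl n e 0" "cyc_rot n d 1 = cyc_refl n e 1" by simp_all
  then have "int n dvd d - e" "int n dvd (1 + d) - (e - 1)" using n2 by (simp_all add: cyc_rot_def cyc_refl_def mod_eq_dvd_iff)
  then have "int n dvd ((1 + d) - (e - 1)) - (d - e)" by (rule dvd_diff[rotated])
  then have "int n dvd 2" by simp
  then show False using n2 zdvd_imp_le[of "int n" 2] by simp
qed

end

text \<open>In all cases the group is a subgroup of a direct product whose first factor is the dihedral group that
  is the image of \<open>\<langle>a,b\<rangle>\<close>. It acts on \<open>\<int>/2p\<close> rather than \<open>\<int>/p\<close> in order to be faithful for \<open>p = 2\<close>.\<close>

lemma dihedral_product_triple:
  fixes p q :: nat and a2 b2 c2 :: "'b \<Rightarrow> 'b"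
  defines "a \<equiv> prod_endo (cyc_refl (2 * p) 2) a2" and "b \<equiv> prod_endo (cyc_refl (2 * p) 0) b2" and "c \<equiv> prod_endo id c2"
  assumes p: "p \<ge> 2" and q: "q > 0" "even q"
    and rel: "a2 \<circ> a2 = id" "b2 \<circ> b2 = id" "c2 \<circ> c2 = id" "a2 \<circ> c2 = c2 \<circ> a2"
      "(a2 \<circ> b2) ^^ p = id" "(b2 \<circ> c2) ^^ q = id"
    and free: "\<And>j. (b2 \<circ> c2) ^^ j = (if odd j then b2 else id) \<Longrightarrow> even j \<and> q dvd j"
  shows "factorized_pair a b c p q"
proof -
  have pp0: "2 * p > 0" and p2: "2 * p > 2" using p by auto
  have ab: "a * b = prod_endo (cyc_rot (2 * p) 2) (a2 \<circ> b2)" by (simp add: a_def b_def prod_endo_mult cyc_refl_refl[OF pp0])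
  have bc: "b * c = prod_endo (cyc_refl (2 * p) 0) (b2 \<circ> c2)" by (simp add: b_def c_def prod_endo_mult)
  have ref2: "cyc_refl (2 * p) 0 \<circ> cyc_refl (2 * p) 0 = id" by (simp add: cyc_refl_refl[OF pp0] cyc_rot_0[OF pp0])
  have ref_pow: "cyc_refl (2 * p) 0 ^^ j = (if odd j then cyc_refl (2 * p) 0 else id)" for j
    by (rule invol_funpow[OF ref2])
  have abn: "(a * b) ^ n = prod_endo (cyc_rot (2 * p) (int n * 2)) ((a2 \<circ> b2) ^^ n)" for n
    by (simp add: ab prod_endo_pow cyc_rot_pow[OF pp0])
  have bcn: "(b * c) ^ n = prod_endo (if odd n then cyc_refl (2 * p) 0 else id) ((b2 \<circ> c2) ^^ n)" for n
    by (simp add: bc prod_endo_pow ref_pow)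
  interpret coxeter_pair a b c p q
  proof
    show "a * a = 1" "b * b = 1" "c * c = 1" "a * c = c * a"
      by (simp_all add: a_def b_def c_def prod_endo_mult prod_endo_one prod_endo_eq cyc_refl_refl[OF pp0] cyc_rot_0[OF pp0] rel)
    have "cyc_rot (2 * p) (int p * 2) = cyc_rot (2 * p) 0" unfolding cyc_rot_eq[OF pp0] by simp
    then show "(a * b) ^ p = 1" by (simp add: abn prod_endo_one prod_endo_eq rel cyc_rot_0[OF pp0])
    show "(b * c) ^ q = 1" using q by (simp add: bcn prod_endo_one prod_endo_eq rel)
  qed (use p q in auto)
  show ?thesis
  proof
    fix i e j assume eq: "U i * (B e * V j) = 1"
    obtain n m where n: "U i = (a * b) ^ n" "int p dvd i - int n" and m: "V j = (b * c) ^ m" "int q dvd j - int m"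
      using zp_nat_ex[OF xp p0] zp_nat_ex[OF yq q(1)] unfolding U_def V_def by metis
    define r where "r = (if e then cyc_refl (2 * p) 0 else id) \<circ> (if odd m then cyc_refl (2 * p) 0 else id)"
    have "prod_endo (cyc_rot (2 * p) (int n * 2) \<circ> r) ((a2 \<circ> b2) ^^ n \<circ> ((if e then b2 else id) \<circ> (b2 \<circ> c2) ^^ m)) = prod_endo id id"
    proof -
      have "B e = prod_endo (if e then cyc_refl (2 * p) 0 else id) (if e then b2 else id)"
        by (simp only: B_def) (simp add: b_def prod_endo_one)
      then show ?thesis using eq unfolding n(1) m(1) abn bcn r_def by (simp only: prod_endo_mult prod_endo_one)
    qed
    then have 1: "cyc_rot (2 * p) (int n * 2) \<circ> r = id"
      and 2: "(a2 \<circ> b2) ^^ n \<circ> ((if e then b2 else id) \<circ> (b2 \<circ> c2) ^^ m) = id" by (simp_all add: prod_endo_eq)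
    \<comment> \<open>In the first component \<open>B e\<close> and each factor of
      \<open>V j\<close> are the reflection in 0. Their product with a rotation is the identity only
      if they are even in number.\<close>
    have em: "e \<longleftrightarrow> odd m"
    proof (rule ccontr)
      assume "\<not> (e \<longleftrightarrow> odd m)"
      then have "r = cyc_refl (2 * p) 0" by (auto simp: r_def)
      then have "cyc_refl (2 * p) (int n * 2) = cyc_rot (2 * p) 0" using 1 by (simp add: cyc_rot_refl[OF pp0] cyc_rot_0[OF pp0])
      then show False using cyc_rot_ne_refl[OF pp0 p2] by metis
    qed
    then have "r = id" by (auto simp: r_def ref2)
    then have "cyc_rot (2 * p) (int n * 2) = cyc_rot (2 * p) 0" using 1 by (simp add: cyc_rot_0[OF pp0])
    then have "int (2 * p) dvd int (2 * n)" unfolding cyc_rot_eq[OF pp0] by (simp add: mult.commute)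
    then have "2 * p dvd 2 * n" by (simp only: int_dvd_int_iff)
    then have pn: "p dvd n" by simp
    then obtain k where "n = p * k" by (auto elim: dvdE)
    then have "(a2 \<circ> b2) ^^ n = id" by (simp add: funpow_mult[symmetric] rel id_funpow flip: mult.commute[of p])
    then have "(if e then b2 else id) \<circ> (b2 \<circ> c2) ^^ m = id" using 2 by simp
    then have "(if e then b2 else id) \<circ> ((if e then b2 else id) \<circ> (b2 \<circ> c2) ^^ m) = (if e then b2 else id)" by simp
    then have "(b2 \<circ> c2) ^^ m = (if odd m then b2 else id)"
      using em rel(2) by (auto simp flip: comp_assoc split: if_splits)
    from free[OF this] have "even m" "q dvd m" by auto
    moreover have "int p dvd i" using n(2) pn by (metis dvd_diffD int_dvd_int_iff zdvd_zdiffD)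
    moreover have "int q dvd j" using m(2) \<open>q dvd m\<close> by (metis int_dvd_int_iff zdvd_zdiffD)
    ultimately show "int p dvd i \<and> \<not> e \<and> int q dvd j" using em by simp
  qed
qed

text \<open>\<open>a\<close> acts on the first factor, \<open>c\<close> on the second,
  \<open>b\<close> on both. For even exponents the contribution of \<open>b\<close> to the other
  factor cancels; in particular \<open>U 2\<close> lives in the first factor and commutes with
  \<open>c\<close>.\<close>

lemma ex_even_even:
  assumes "even p" "even q" "p \<ge> 2" "q \<ge> 2"
  shows "\<exists>a b c :: (int \<times> int) endo. tight_triple a b c p q"
proof -
  have qq0: "2 * q > 0" and q2: "2 * q > 2" using assms by auto
  define a b c where "a = prod_endo (cyc_refl (2 * p) 2) (id :: int \<Rightarrow> int)" and "b = prod_endo (cyc_refl (2 * p) 0) (cyc_refl (2 * q) 0)"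
    and "c = prod_endo (id :: int \<Rightarrow> int) (cyc_refl (2 * q) 2)"
  note R = cyc_refl_refl[OF qq0] cyc_rot_0[OF qq0] cyc_rot_pow[OF qq0]
  have "factorized_pair a b c p q"
    unfolding a_def b_def c_def
  proof (rule dihedral_product_triple)
    show "cyc_refl (2 * q) 0 \<circ> cyc_refl (2 * q) 0 = id" "cyc_refl (2 * q) 2 \<circ> cyc_refl (2 * q) 2 = id" by (simp_all add: R)
    have pow: "cyc_refl (2 * q) 0 ^^ j = (if odd j then cyc_refl (2 * q) 0 else id)" for j
      by (rule invol_funpow) (simp add: R)
    then show "(id \<circ> cyc_refl (2 * q) 0) ^^ p = id" using assms by simp
    have "cyc_rot (2 * q) (int q * (0 - 2)) = cyc_rot (2 * q) 0" unfolding cyc_rot_eq[OF qq0] by simp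
    then show "(cyc_refl (2 * q) 0 \<circ> cyc_refl (2 * q) 2) ^^ q = id" by (simp add: R)
    fix j assume eq: "(cyc_refl (2 * q) 0 \<circ> cyc_refl (2 * q) 2) ^^ j = (if odd j then cyc_refl (2 * q) 0 else id)"
    have ev: "even j" using eq cyc_rot_ne_refl[OF qq0 q2] by (auto simp: R split: if_splits)
    then have "cyc_rot (2 * q) (int j * (- 2)) = cyc_rot (2 * q) 0" using eq by (simp add: R)
    then have "int (2 * q) dvd int (2 * j)" unfolding cyc_rot_eq[OF qq0] by (simp add: mult.commute)
    then have "2 * q dvd 2 * j" by (simp only: int_dvd_int_iff)
    then show "even j \<and> q dvd j" using ev by simp
  qed (use assms in auto)
  then interpret factorized_pair a b c p q .
  have U2: "U 2 = prod_endo (cyc_rot (2 * p) 4) id"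
  proof -
    have pp0: "2 * p > 0" using assms by simp
    have "U 2 = U 1 * U 1" by simp
    also have "\<dots> = prod_endo (cyc_rot (2 * p) 4) id"
      unfolding U1 by (simp add: a_def b_def prod_endo_mult R cyc_refl_refl[OF pp0] cyc_rot_rot[OF pp0])
    finally show ?thesis .
  qed
  have "c * U 2 = U 2 * c" unfolding U2 by (simp add: c_def prod_endo_mult)
  then have "tight_triple a b c p q" by unfold_locales (rule closed_from_law[OF even_law])
  then show ?thesis by blast
qed

text \<open>With \<open>q = 2 * r\<close>, the second factor is dihedral with rotations of odd order
  \<open>r\<close>, and \<open>a\<close> and \<open>c\<close> have the same image in it. As
  \<open>r dvd p\<close>, the order of \<open>a * b\<close> remains \<open>p\<close>; the reflection
  in the first factor doubles the order of \<open>b * c\<close> from \<open>r\<close> to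
  \<open>q\<close>. The rotation step 4 modulo \<open>4 * r\<close> keeps rotations and reflections
  distinct even for \<open>r = 1\<close>.\<close>

lemma ex_orientable:
  assumes "odd p" "even q" "q dvd 2 * p" "p \<ge> 2" "q \<ge> 2"
  shows "\<exists>a b c :: (int \<times> int) endo. tight_triple a b c p q"
proof -
  obtain r where r: "q = 2 * r" using assms by (auto elim: evenE)
  have rp: "r dvd p" using assms r by simp
  then have odd_r: "odd r" and r0: "r > 0" using assms by (auto intro: Nat.gr0I)
  have n0: "4 * r > 0" and n2: "4 * r > 2" using r0 by auto
  define a b c where "a = prod_endo (cyc_refl (2 * p) 2) (cyc_refl (4 * r) 4)" and "b = prod_endo (cyc_refl (2 * p) 0) (cyc_refl (4 * r) 0)"
    and "c = prod_endo (id :: int \<Rightarrow> int) (cyc_refl (4 * r) 4)"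
  note R = cyc_refl_refl[OF n0] cyc_rot_0[OF n0] cyc_rot_pow[OF n0] cyc_rot_rot[OF n0]
  have "factorized_pair a b c p q"
    unfolding a_def b_def c_def
  proof (rule dihedral_product_triple)
    show "cyc_refl (4 * r) 0 \<circ> cyc_refl (4 * r) 0 = id" "cyc_refl (4 * r) 4 \<circ> cyc_refl (4 * r) 4 = id"
      "cyc_refl (4 * r) 4 \<circ> cyc_refl (4 * r) 4 = id" by (simp_all add: R)
    have "int (4 * r) dvd int p * 4" using rp by (simp add: mult.commute)
    then have "cyc_rot (4 * r) (int p * 4) = cyc_rot (4 * r) 0" unfolding cyc_rot_eq[OF n0] by simp
    then show "(cyc_refl (4 * r) 4 \<circ> cyc_refl (4 * r) 0) ^^ p = id" by (simp add: R)
    have "cyc_rot (4 * r) (int q * (0 - 4)) = cyc_rot (4 * r) 0" unfolding cyc_rot_eq[OF n0] by (simp add: r)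
    then show "(cyc_refl (4 * r) 0 \<circ> cyc_refl (4 * r) 4) ^^ q = id" by (simp add: R)
    fix j assume eq: "(cyc_refl (4 * r) 0 \<circ> cyc_refl (4 * r) 4) ^^ j = (if odd j then cyc_refl (4 * r) 0 else id)"
    have ev: "even j" using eq cyc_rot_ne_refl[OF n0 n2] by (auto simp: R split: if_splits)
    then have "cyc_rot (4 * r) (int j * (- 4)) = cyc_rot (4 * r) 0" using eq by (simp add: R)
    then have "int (4 * r) dvd int (4 * j)" unfolding cyc_rot_eq[OF n0] by (simp add: mult.commute)
    then have "4 * r dvd 4 * j" by (simp only: int_dvd_int_iff)
    \<comment> \<open>The rotation only gives \<open>r\<close>; as \<open>r\<close> is odd,
      \<open>even j\<close> supplies the missing factor 2.\<close>
    then have "r dvd j" by simp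
    moreover have "coprime 2 r" using odd_r by simp
    ultimately have "2 * r dvd j" using ev by (intro divides_mult)
    then show "even j \<and> q dvd j" using ev r by simp
  qed (use assms in auto)
  then interpret factorized_pair a b c p q .
  have V2': "V 2 = prod_endo id (cyc_rot (4 * r) (-8))"
  proof -
    have pp0: "2 * p > 0" using assms by simp
    have "V 2 = V 1 * V 1" by simp
    also have "\<dots> = prod_endo id (cyc_rot (4 * r) (-8))"
      unfolding V1 by (simp add: b_def c_def prod_endo_mult R cyc_refl_refl[OF pp0] cyc_rot_0[OF pp0])
    finally show ?thesis .
  qed
  have "cyc_refl (4 * r) 4 \<circ> cyc_rot (4 * r) (-8) = cyc_refl (4 * r) 12"
    using n0 by (auto simp: fun_eq_iff cyc_rot_def cyc_refl_def mod_simps algebra_simps)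
  then have "a * V 2 * a * V 2 = 1"
    unfolding V2' using assms
    by (simp add: a_def prod_endo_mult prod_endo_one prod_endo_eq R cyc_refl_refl cyc_rot_0)
  then have "tight_triple a b c p q" by unfold_locales (rule closed_from_law[OF orientable_law(1)])
  then show ?thesis by blast
qed

lemma funpow_small: "f ^^ 1 = f" "f ^^ 2 = f \<circ> f" "f ^^ 3 = f \<circ> f \<circ> f" "f ^^ 4 = f \<circ> f \<circ> f \<circ> f"
  by (simp_all add: eval_nat_numeral comp_assoc)

text \<open>The second factor is the symmetric group on 0, 1, 2, 3, the automorphism group of the
  hemi-octahedron of type \<open>{3,4}\<close>. Its rotation \<open>a2 \<circ> b2\<close> has order
  3, which divides \<open>p\<close>.\<close>

lemma ex_nonorientable:
  assumes "odd p" "3 dvd p" "p \<ge> 2"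
  shows "\<exists>a b c :: (int \<times> nat) endo. tight_triple a b c p 4"
proof -
  define a2 b2 c2 :: "nat \<Rightarrow> nat" where "a2 = transpose 0 1" and "b2 = transpose 1 2"
    and "c2 = transpose 0 1 \<circ> transpose 2 3"
  define a b c where "a = prod_endo (cyc_refl (2 * p) 2) a2" and "b = prod_endo (cyc_refl (2 * p) 0) b2" and "c = prod_endo (id :: int \<Rightarrow> int) c2"
  have pp0: "2 * p > 0" using assms by simp
  note One_nat_def [simp del]
  have ev: "a2 0 = 1" "a2 1 = 0" "a2 2 = 2" "a2 3 = 3" "b2 0 = 0" "b2 1 = 2" "b2 2 = 1" "b2 3 = 3"
    "c2 0 = 1" "c2 1 = 0" "c2 2 = 3" "c2 3 = 2"
    and ev_id: "x > 3 \<Longrightarrow> a2 x = x" "x > 3 \<Longrightarrow> b2 x = x" "x > 3 \<Longrightarrow> c2 x = x" for x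
    by (simp_all add: a2_def b2_def c2_def transpose_def)
  have eqI: "f = g" if "f 0 = g 0" "f 1 = g 1" "f 2 = g 2" "f 3 = g 3" "\<And>x. x > 3 \<Longrightarrow> f x = g x" for f g :: "nat \<Rightarrow> nat"
  proof
    fix x :: nat
    consider "x = 0" | "x = 1" | "x = 2" | "x = 3" | "x > 3" by linarith
    then show "f x = g x" by cases (simp_all add: that)
  qed
  have y4: "(b2 \<circ> c2) ^^ 4 = id"
    unfolding funpow_small by (rule eqI) (simp_all add: ev ev_id)
  have "factorized_pair a b c p 4"
    unfolding a_def b_def c_def
  proof (rule dihedral_product_triple)
    show "a2 \<circ> a2 = id" "b2 \<circ> b2 = id" "c2 \<circ> c2 = id" "a2 \<circ> c2 = c2 \<circ> a2"
      by (rule eqI; simp add: ev ev_id)+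
    have "(a2 \<circ> b2) ^^ 3 = id"
      unfolding funpow_small by (rule eqI) (simp_all add: ev ev_id)
    moreover obtain k where "p = 3 * k" using assms by (auto elim: dvdE)
    ultimately show "(a2 \<circ> b2) ^^ p = id" by (simp add: funpow_mult[symmetric] id_funpow)
    show "(b2 \<circ> c2) ^^ 4 = id" by (rule y4)
    fix j assume eq: "(b2 \<circ> c2) ^^ j = (if odd j then b2 else id)"
    have "j = 4 * (j div 4) + j mod 4" by simp
    then have "(b2 \<circ> c2) ^^ j = ((b2 \<circ> c2) ^^ 4) ^^ (j div 4) \<circ> (b2 \<circ> c2) ^^ (j mod 4)"
      by (metis funpow_add funpow_mult mult.commute)
    then have jm: "(b2 \<circ> c2) ^^ j = (b2 \<circ> c2) ^^ (j mod 4)" by (simp add: y4 id_funpow)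
    \<comment> \<open>\<open>b2 \<circ> c2\<close> is the 4-cycle through 0, 2, 3, 1, and both
      \<open>b2\<close> and \<open>id\<close> fix 0, so this one point decides.\<close>
    have j0: "((b2 \<circ> c2) ^^ (j mod 4)) 0 = 0"
      using eq unfolding jm by (auto simp: ev)
    have "j mod 4 < 4" by simp
    then consider "j mod 4 = 0" | "j mod 4 = 1" | "j mod 4 = 2" | "j mod 4 = 3" by linarith
    then show "even j \<and> 4 dvd j"
    proof cases
      case 1
      then show ?thesis by presburger
    qed (use j0 in \<open>simp_all add: funpow_small ev\<close>)
  qed (use assms in auto)
  then interpret factorized_pair a b c p 4 .
  have V2': "V 2 = prod_endo id ((b2 \<circ> c2) \<circ> (b2 \<circ> c2))"
  proof -
    have "V 2 = V 1 * V 1" by simp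
    also have "\<dots> = prod_endo id ((b2 \<circ> c2) \<circ> (b2 \<circ> c2))"
      unfolding V1 by (simp add: b_def c_def prod_endo_mult cyc_refl_refl[OF pp0] cyc_rot_0[OF pp0])
    finally show ?thesis .
  qed
  have "a2 \<circ> ((b2 \<circ> c2) \<circ> (b2 \<circ> c2)) \<circ> a2 = c2 \<circ> ((b2 \<circ> c2) \<circ> (b2 \<circ> c2))"
    by (rule eqI) (simp_all add: ev ev_id)
  then have "a * V 2 * a = c * V 2"
    unfolding V2' by (simp add: a_def c_def prod_endo_mult prod_endo_eq cyc_refl_refl[OF pp0] cyc_rot_0[OF pp0])
  then have "tight_triple a b c p 4" by unfold_locales (rule closed_from_law[OF nonorientable_law(1)], simp_all)
  then show ?thesis by blast
qed

section \<open>Assembling the classification\<close>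

lemma tight_polyhedron_at:
  assumes "p \<ge> 2" "q \<ge> 2" "tight_regular p q P" "\<Phi> \<in> flags P"
  shows "\<exists>t v e f. tight_polyhedron P p q t v e f \<and> finite_polyhedron.fset t = \<Phi>"
proof -
  interpret finite_polyhedron P
    by unfold_locales (use assms in \<open>auto simp: tight_regular_def regular_poly_def\<close>)
  obtain t where t: "t \<in> FL" "fset t = \<Phi>" using flags_eq assms(4) by auto
  obtain v e f where "t = (v, e, f)" by (metis prod_cases3)
  then have "tight_polyhedron P p q t v e f"
    by unfold_locales (use assms t in auto)
  then show ?thesis using t by blast
qed

lemma tight_polyhedron_ex:
  assumes "p \<ge> 2" "q \<ge> 2" "tight_regular p q P"
  shows "\<exists>t v e f. tight_polyhedron P p q t v e f"
proof -
  have "flags P \<noteq> {}" using assms by (auto simp: tight_regular_def)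
  then show ?thesis using tight_polyhedron_at[OF assms] by blast
qed

text \<open>The first argument is the odd one. The dual conditions are the same predicates with
  arguments exchanged, in accordance with the reversed triple.\<close>

definition odd_orientable :: "nat \<Rightarrow> nat \<Rightarrow> bool" where
  "odd_orientable p q \<longleftrightarrow> odd p \<and> even q \<and> q dvd 2 * p"

definition odd_nonorientable :: "nat \<Rightarrow> nat \<Rightarrow> bool" where
  "odd_nonorientable p q \<longleftrightarrow> q = 4 \<and> odd p \<and> 3 dvd p"

lemma odd_cases_exclusive: "odd_orientable p q \<Longrightarrow> \<not> odd_nonorientable p q"
  unfolding odd_orientable_def odd_nonorientable_def by presburger

lemma (in tight_triple) odd_classification:
  assumes "odd p" "p \<ge> 2"
  shows "(odd_orientable p q \<and> law (\<lambda>_. True) (\<lambda>n. 1 - 2 * int n) \<and> card (rotations a b c) = p * q) \<or>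
    (odd_nonorientable p q \<and> rotations a b c = G \<and>
      law (\<lambda>n. n mod 3 \<noteq> 2) (\<lambda>n. if n mod 3 = 0 then 1 else if n mod 3 = 1 then 3 else 2))"
  using classification[OF assms] assms(1) by (auto simp: odd_orientable_def odd_nonorientable_def)

text \<open>The two arithmetic conditions exclude each other, so both triples fall under the same
  alternative and obey the same law.\<close>

lemma odd_cayley_iso:
  fixes a b c :: "'g::monoid_mult" and a' b' c' :: "'h::monoid_mult"
  assumes t: "tight_triple a b c p q" "tight_triple a' b' c' p q" and p: "odd p" "p \<ge> 2"
  shows "\<exists>\<theta>. cayley_iso (coxeter_pair.G a b c p q) a b c (coxeter_pair.G a' b' c' p q) a' b' c' \<theta>"
  using tight_triple.odd_classification[OF t(1) p] tight_triple.odd_classification[OF t(2) p]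
    law_cayley_iso[OF t(1) _ t(2)] odd_cases_exclusive by blast

lemma odd_unique:
  assumes p: "p \<ge> 2" and q: "q \<ge> 2" and t: "tight_regular p q P" "tight_regular p q Q" and odd: "odd p \<or> odd q"
  shows "poly_isomorphic P Q"
proof -
  obtain t0 v0 e0 f0 where L: "tight_polyhedron P p q t0 v0 e0 f0" using tight_polyhedron_ex[OF p q t(1)] by blast
  obtain t1 v1 e1 f1 where R: "tight_polyhedron Q p q t1 v1 e1 f1" using tight_polyhedron_ex[OF p q t(2)] by blast
  interpret L: tight_polyhedron P p q t0 v0 e0 f0 by fact
  interpret R: tight_polyhedron Q p q t1 v1 e1 f1 by fact
  have "\<exists>\<theta>. cayley_iso L.C.G (L.\<rho> 0) (L.\<rho> 1) (L.\<rho> 2) R.C.G (R.\<rho> 0) (R.\<rho> 1) (R.\<rho> 2) \<theta>"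
    using odd
  proof
    assume "odd p"
    then show ?thesis by (intro odd_cayley_iso[OF L.C.tight_triple_axioms R.C.tight_triple_axioms] p)
  next
    assume "odd q"
    then obtain \<theta> where "cayley_iso (coxeter_pair.G (L.\<rho> 2) (L.\<rho> 1) (L.\<rho> 0) q p) (L.\<rho> 2) (L.\<rho> 1) (L.\<rho> 0)
       (coxeter_pair.G (R.\<rho> 2) (R.\<rho> 1) (R.\<rho> 0) q p) (R.\<rho> 2) (R.\<rho> 1) (R.\<rho> 0) \<theta>"
      using odd_cayley_iso[OF L.C.tight_triple_rev R.C.tight_triple_rev _ q] by blast
    \<comment> \<open>Reversal leaves \<open>G\<close> unchanged, and \<open>cayley_iso\<close>
      treats the three generators alike, so the same map serves.\<close>
    then show ?thesis unfolding L.C.G_rev_eq R.C.G_rev_eq cayley_iso_def by blast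
  qed
  then show ?thesis unfolding L.G_\<Gamma> R.G_\<Gamma> using cayley_iso_poly_isomorphic[OF L R] by blast
qed

text \<open>Stated for an arbitrary base flag \<open>t\<close>, because both notions of
  orientability quantify over all flags.\<close>

lemma odd_rotations:
  assumes "tight_polyhedron P p q t v e f" and odd: "odd p \<or> odd q"
  defines "R \<equiv> rotation_subgroup P (finite_polyhedron.fset t)"
  shows "((odd_orientable p q \<or> odd_orientable q p) \<and> card (rcosets\<^bsub>aut_group P\<^esub> R) = 2) \<or>
    ((odd_nonorientable p q \<or> odd_nonorientable q p) \<and> R = carrier (aut_group P))"
proof -
  interpret tight_polyhedron P p q t v e f by fact
  interpret R: tight_triple "\<rho> 2" "\<rho> 1" "\<rho> 0" q p by (rule C.tight_triple_rev)
  have "((odd_orientable p q \<or> odd_orientable q p) \<and> card (rotations (\<rho> 0) (\<rho> 1) (\<rho> 2)) = p * q) \<or>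
    ((odd_nonorientable p q \<or> odd_nonorientable q p) \<and> rotations (\<rho> 0) (\<rho> 1) (\<rho> 2) = C.G)"
    using odd
  proof
    assume "odd p"
    then show ?thesis using C.odd_classification p2 by blast
  next
    assume "odd q"
    then show ?thesis using R.odd_classification q2 unfolding C.rotations_rev C.G_rev_eq by (auto simp: mult.commute)
  qed
  then show ?thesis unfolding R_def using index_two rotations_all by blast
qed

lemma odd_type_cases:
  assumes p: "p \<ge> 2" and q: "q \<ge> 2" and t: "tight_regular p q P" and odd: "odd p \<or> odd q"
  shows "odd_orientable p q \<or> odd_orientable q p \<or> odd_nonorientable p q \<or> odd_nonorientable q p"
proof -
  obtain s v e f where "tight_polyhedron P p q s v e f" using tight_polyhedron_ex[OF p q t] by blast
  from odd_rotations[OF this odd] show ?thesis by blast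
qed

lemma orientable_exclusive:
  assumes "odd_orientable p q \<or> odd_orientable q p"
  shows "\<not> (odd_nonorientable p q \<or> odd_nonorientable q p)" "odd p \<or> odd q"
  using assms odd_cases_exclusive[of p q] odd_cases_exclusive[of q p]
  by (auto simp: odd_orientable_def odd_nonorientable_def)

lemma odd_orientably_regular:
  assumes p: "p \<ge> 2" and q: "q \<ge> 2" and t: "tight_regular p q P" and o: "odd_orientable p q \<or> odd_orientable q p"
  shows "orientably_regular P"
  unfolding orientably_regular_def
proof (intro conjI ballI)
  show "regular_poly P" using t by (simp add: tight_regular_def)
  fix \<Phi> assume "\<Phi> \<in> flags P"
  then obtain s v e f where s: "tight_polyhedron P p q s v e f" "finite_polyhedron.fset s = \<Phi>"
    using tight_polyhedron_at[OF p q t] by blast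
  show "card (rcosets\<^bsub>aut_group P\<^esub> rotation_subgroup P \<Phi>) = 2"
    using odd_rotations[OF s(1) orientable_exclusive(2)[OF o]] orientable_exclusive(1)[OF o] unfolding s(2) by blast
qed

lemma odd_non_orientably_regular:
  assumes p: "p \<ge> 2" and q: "q \<ge> 2" and t: "tight_regular p q P" and o: "odd_nonorientable p q \<or> odd_nonorientable q p"
  shows "non_orientably_regular P"
  unfolding non_orientably_regular_def
proof (intro conjI ballI)
  show "regular_poly P" using t by (simp add: tight_regular_def)
  have odd: "odd p \<or> odd q" using o by (auto simp: odd_nonorientable_def)
  fix \<Phi> assume "\<Phi> \<in> flags P"
  then obtain s v e f where s: "tight_polyhedron P p q s v e f" "finite_polyhedron.fset s = \<Phi>"
    using tight_polyhedron_at[OF p q t] by blast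
  show "rotation_subgroup P \<Phi> = carrier (aut_group P)"
    using odd_rotations[OF s(1) odd] orientable_exclusive(1)[of p q] o unfolding s(2) by blast
qed

lemma ex_tight:
  assumes p: "p \<ge> 2" and q: "q \<ge> 2"
    and "(even p \<and> even q) \<or> odd_orientable p q \<or> odd_orientable q p \<or> odd_nonorientable p q \<or> odd_nonorientable q p"
  shows "\<exists>P :: nat ranked_poset. tight_regular p q P"
  using assms(3)
proof (elim disjE)
  assume "even p \<and> even q"
  then show ?thesis using ex_even_even[OF _ _ p q] tight_triple.ex_tight_regular[OF _ p q] by blast
next
  assume "odd_orientable p q"
  then show ?thesis using ex_orientable[OF _ _ _ p q] tight_triple.ex_tight_regular[OF _ p q]
    unfolding odd_orientable_def by blast
next
  assume "odd_orientable q p"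
  then show ?thesis using ex_orientable[OF _ _ _ q p] tight_triple.ex_tight_regular[OF tight_triple.tight_triple_rev p q]
    unfolding odd_orientable_def by blast
next
  assume "odd_nonorientable p q"
  then show ?thesis using ex_nonorientable[OF _ _ p] tight_triple.ex_tight_regular[OF _ p q]
    unfolding odd_nonorientable_def by blast
next
  assume "odd_nonorientable q p"
  then show ?thesis using ex_nonorientable[OF _ _ q] tight_triple.ex_tight_regular[OF tight_triple.tight_triple_rev p q]
    unfolding odd_nonorientable_def by blast
qed

theorem theorem1p1:
  fixes p q :: nat
  assumes "p \<ge> 2" and "q \<ge> 2"
  shows
    "((\<exists>P :: nat ranked_poset. tight_regular p q P) \<longleftrightarrow>
        (even p \<and> even q) \<or>
        (odd p \<and> even q \<and> q dvd 2 * p) \<or>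
        (odd q \<and> even p \<and> p dvd 2 * q) \<or>
        (p = 4 \<and> odd q \<and> 3 dvd q) \<or>
        (q = 4 \<and> odd p \<and> 3 dvd p))
     \<and> ((odd p \<and> even q \<and> q dvd 2 * p) \<or> (odd q \<and> even p \<and> p dvd 2 * q) \<longrightarrow>
        (\<exists>P :: nat ranked_poset. tight_regular p q P \<and> orientably_regular P \<and>
          (\<forall>Q :: 'a ranked_poset. tight_regular p q Q \<longrightarrow> poly_isomorphic Q P)))
     \<and> ((p = 4 \<and> odd q \<and> 3 dvd q) \<or> (q = 4 \<and> odd p \<and> 3 dvd p) \<longrightarrow>
        (\<exists>P :: nat ranked_poset. tight_regular p q P \<and> non_orientably_regular P \<and>
          (\<forall>Q :: 'a ranked_poset. tight_regular p q Q \<longrightarrow> poly_isomorphic Q P)))"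
  unfolding odd_orientable_def[symmetric] odd_nonorientable_def[symmetric]
proof (intro conjI impI iffI)
  note pq = assms
  assume "\<exists>P :: nat ranked_poset. tight_regular p q P"
  then show "(even p \<and> even q) \<or> odd_orientable p q \<or> odd_orientable q p \<or> odd_nonorientable q p \<or> odd_nonorientable p q"
    using odd_type_cases[OF pq] by blast
next
  assume "(even p \<and> even q) \<or> odd_orientable p q \<or> odd_orientable q p \<or> odd_nonorientable q p \<or> odd_nonorientable p q"
  then show "\<exists>P :: nat ranked_poset. tight_regular p q P" using ex_tight[OF assms] by blast
next
  assume o: "odd_orientable p q \<or> odd_orientable q p"
  then obtain P :: "nat ranked_poset" where P: "tight_regular p q P" using ex_tight[OF assms] by blast
  show "\<exists>P :: nat ranked_poset. tight_regular p q P \<and> orientably_regular P \<and>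
    (\<forall>Q :: 'a ranked_poset. tight_regular p q Q \<longrightarrow> poly_isomorphic Q P)"
    using P odd_orientably_regular[OF assms P o] odd_unique[OF assms _ P orientable_exclusive(2)[OF o]] by blast
next
  assume o: "odd_nonorientable q p \<or> odd_nonorientable p q"
  then obtain P :: "nat ranked_poset" where P: "tight_regular p q P" using ex_tight[OF assms] by blast
  have "odd p \<or> odd q" using o by (auto simp: odd_nonorientable_def)
  then show "\<exists>P :: nat ranked_poset. tight_regular p q P \<and> non_orientably_regular P \<and>
    (\<forall>Q :: 'a ranked_poset. tight_regular p q Q \<longrightarrow> poly_isomorphic Q P)"
    using P odd_non_orientably_regular[OF assms P] o odd_unique[OF assms _ P] by blast
qed

end
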